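(* Let $K/k$ be a finitely generated field extension. Let $V_\bullet$ be a graded linear series of $K/k$ of subfinite type whose Kodaira-Iitaka dimension $d$ is nonnegative. Then the limit $$\mathrm{vol}(V_\bullet)=\lim_{n\in\mathbb N,\ V_n\neq\{0\},\ n\to+\infty}\frac{\dim_k(V_n)}{n^d/d!}$$ exists in $(0,+\infty)$. Moreover, $\mathrm{vol}(V_\bullet)$ is equal to the supremum of $\mathrm{vol}(W_\bullet)$, where $W_\bullet$ runs over the set of all graded linear series of finite type of $K/k$ contained in $V_\bullet$ and having $d$ as Kodaira-Iitaka dimension. Finally, there exists a function $f:\mathbb N\to\mathbb R_+$ such that $$f(n)=\mathrm{vol}(V_\bullet)\frac{n^d}{d!}+O(n^{d-1})\quad (n\to+\infty)$$ and $\dim_k(V_n)\leq f(n)$ for every $n\in\mathbb N$.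
   Context: Let $K[T]=\bigoplus_{n\in\mathbb N}KT^n$ be the graded polynomial ring in one variable. A graded linear series of $K/k$ is a graded sub-$k$-algebra $V_\bullet=\bigoplus_{n\in\mathbb N}V_nT^n$ of $K[T]$ such that $V_0=k$ and $V_n$ is a finite dimensional $k$-vector subspace of $K$ for every $n\geq 1$. $V_\bullet$ is contained in $V'_\bullet$ if $V_n\subset V'_n$ for all $n$. $V_\bullet$ is of finite type if it is finitely generated as a $k$-algebra; it is of subfinite type if it is contained in some graded linear series of $K/k$ of finite type. The field of rational functions $k(V_\bullet)$ is the subextension of $K/k$ generated over $k$ by all elements $f/g$, where $f,g$ are nonzero elements of $K$ for which there is $n\geq 1$ with $\{f,g\}\subset V_n$. If $V_n\neq\{0\}$ for some $n\geq1$, the Kodaira-Iitaka dimension of $V_\bullet$ is the transcendence degree of $k(V_\bullet)$ over $k$; otherwise it is $-\infty$. For a graded linear series $V_\bullet$ of Kodaira-Iitaka dimension $d\geq 0$, the volume is in general defined as $\mathrm{vol}(V_\bullet):=\limsup_{n\to+\infty}\dim_k(V_n)/(n^d/d!)$ (this agrees with the limit in the theorem when that limit exists). $\mathbb R_+$ is the set of nonnegative real numbers. *)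

theory Defs
  imports
    Complex_Main
    "HOL-Computational_Algebra.Polynomial"
    "HOL-Library.Poly_Mapping"
    "HOL-Library.Extended_Real"
    "HOL-Library.Liminf_Limsup"
    "HOL-Library.Landau_Symbols"
begin

(* A field extension K/k is given by a field homomorphism \<iota> from the type 'k to the type 'K;
   the base field k, as a subset of K, is range \<iota>. *)

definition field_embedding :: "('k::field \<Rightarrow> 'K::field) \<Rightarrow> bool" where
  "field_embedding \<iota> \<longleftrightarrow>
     \<iota> 1 = 1 \<and> (\<forall>x y. \<iota> (x + y) = \<iota> x + \<iota> y) \<and> (\<forall>x y. \<iota> (x * y) = \<iota> x * \<iota> y)"

definition ext_scale :: "('k::field \<Rightarrow> 'K::field) \<Rightarrow> 'k \<Rightarrow> 'K \<Rightarrow> 'K" where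
  "ext_scale \<iota> c x = \<iota> c * x"

lemma vector_space_ext_scale:
  assumes "field_embedding \<iota>"
  shows "vector_space (ext_scale \<iota>)"
  using assms by unfold_locales (auto simp: field_embedding_def ext_scale_def algebra_simps)

definition is_subfield :: "'K::field set \<Rightarrow> bool" where
  "is_subfield F \<longleftrightarrow>
     1 \<in> F \<and> (\<forall>x\<in>F. \<forall>y\<in>F. x - y \<in> F \<and> x * y \<in> F) \<and> (\<forall>x\<in>F. inverse x \<in> F)"

(* The subextension k(S). *)
definition field_adjoin :: "('k::field \<Rightarrow> 'K::field) \<Rightarrow> 'K set \<Rightarrow> 'K set" where
  "field_adjoin \<iota> S = is_subfield hull (range \<iota> \<union> S)"

definition fin_gen_extension :: "('k::field \<Rightarrow> 'K::field) \<Rightarrow> bool" where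
  "fin_gen_extension \<iota> \<longleftrightarrow> (\<exists>S. finite S \<and> field_adjoin \<iota> S = UNIV)"

(* A polynomial over k whose variables are indexed by (and evaluated at) the elements of K. *)
definition eval_mpoly ::
    "('k::field \<Rightarrow> 'K::field) \<Rightarrow> (('K \<Rightarrow>\<^sub>0 nat) \<Rightarrow>\<^sub>0 'k) \<Rightarrow> 'K" where
  "eval_mpoly \<iota> p =
     (\<Sum>m\<in>Poly_Mapping.keys p.
        \<iota> (Poly_Mapping.lookup p m) *
        (\<Prod>x\<in>Poly_Mapping.keys m. x ^ Poly_Mapping.lookup m x))"

definition alg_independent :: "('k::field \<Rightarrow> 'K::field) \<Rightarrow> 'K set \<Rightarrow> bool" where
  "alg_independent \<iota> B \<longleftrightarrow>
     (\<forall>p. (\<forall>m\<in>Poly_Mapping.keys p. Poly_Mapping.keys m \<subseteq> B) \<and> eval_mpoly \<iota> p = 0 \<longrightarrow> p = 0)"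

(* Transcendence degree over k of a subextension L of K/k: the largest cardinality of an
   algebraically independent subset (\<infinity> if there are arbitrarily large finite ones). *)
definition trdeg :: "('k::field \<Rightarrow> 'K::field) \<Rightarrow> 'K set \<Rightarrow> enat" where
  "trdeg \<iota> L = (SUP B\<in>{B. finite B \<and> B \<subseteq> L \<and> alg_independent \<iota> B}. enat (card B))"

definition is_subalgebra :: "('k::field \<Rightarrow> 'K::field) \<Rightarrow> 'K poly set \<Rightarrow> bool" where
  "is_subalgebra \<iota> A \<longleftrightarrow>
     (\<forall>c. [:\<iota> c:] \<in> A) \<and> (\<forall>p\<in>A. \<forall>q\<in>A. p + q \<in> A \<and> p * q \<in> A)"

(* A graded linear series is encoded by the family of its homogeneous pieces V n; total_space V is
   the direct sum of the V n T^n inside K[T]. *)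
definition total_space :: "(nat \<Rightarrow> 'K::field set) \<Rightarrow> 'K poly set" where
  "total_space V = {p. \<forall>n. coeff p n \<in> V n}"

definition graded_linear_series ::
    "('k::field \<Rightarrow> 'K::field) \<Rightarrow> (nat \<Rightarrow> 'K set) \<Rightarrow> bool" where
  "graded_linear_series \<iota> V \<longleftrightarrow>
     is_subalgebra \<iota> (total_space V) \<and> V 0 = range \<iota> \<and>
     (\<forall>n\<ge>1. \<exists>B. finite B \<and> V n = module.span (ext_scale \<iota>) B)"

definition contained_in :: "(nat \<Rightarrow> 'K set) \<Rightarrow> (nat \<Rightarrow> 'K set) \<Rightarrow> bool" where
  "contained_in V W \<longleftrightarrow> (\<forall>n. V n \<subseteq> W n)"

definition finite_type :: "('k::field \<Rightarrow> 'K::field) \<Rightarrow> (nat \<Rightarrow> 'K set) \<Rightarrow> bool" where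
  "finite_type \<iota> V \<longleftrightarrow> (\<exists>S. finite S \<and> is_subalgebra \<iota> hull S = total_space V)"

definition subfinite_type :: "('k::field \<Rightarrow> 'K::field) \<Rightarrow> (nat \<Rightarrow> 'K set) \<Rightarrow> bool" where
  "subfinite_type \<iota> V \<longleftrightarrow>
     (\<exists>W. graded_linear_series \<iota> W \<and> finite_type \<iota> W \<and> contained_in V W)"

definition function_field :: "('k::field \<Rightarrow> 'K::field) \<Rightarrow> (nat \<Rightarrow> 'K set) \<Rightarrow> 'K set" where
  "function_field \<iota> V =
     field_adjoin \<iota> {f / g | f g. f \<noteq> 0 \<and> g \<noteq> 0 \<and> (\<exists>n\<ge>1. {f, g} \<subseteq> V n)}"

definition kodaira_dim :: "('k::field \<Rightarrow> 'K::field) \<Rightarrow> (nat \<Rightarrow> 'K set) \<Rightarrow> ereal" where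
  "kodaira_dim \<iota> V =
     (if \<exists>n\<ge>1. V n \<noteq> {0} then ereal_of_enat (trdeg \<iota> (function_field \<iota> V)) else -\<infinity>)"

definition dim_over :: "('k::field \<Rightarrow> 'K::field) \<Rightarrow> 'K set \<Rightarrow> nat" where
  "dim_over \<iota> W = vector_space.dim (ext_scale \<iota>) W"

(* Meaningful only when the Kodaira-Iitaka dimension is a natural number. *)
definition series_volume :: "('k::field \<Rightarrow> 'K::field) \<Rightarrow> (nat \<Rightarrow> 'K set) \<Rightarrow> ereal" where
  "series_volume \<iota> V =
     (let d = (THE d::nat. kodaira_dim \<iota> V = ereal (real d))
      in limsup (\<lambda>n. ereal (real (dim_over \<iota> (V n)) / (real n ^ d / fact d))))"

end

theory Submission
  imports Defs "HOL-Library.Function_Algebras"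
begin

text \<open>
  The proof replaces a graded linear series \<open>V\<close> by the semigroup of values of its elements under
  a valuation and counts lattice points.

  Let \<open>B0\<close> be a transcendence basis of the function field of \<open>V\<close>, so that \<open>B0\<close> has \<open>d\<close> elements.
  A series of finite type containing \<open>V\<close> is generated by finitely many elements of \<open>K\<close>; some of
  these extend \<open>B0\<close> to a maximal algebraically independent set \<open>B\<close>. By Zorn's lemma there is a
  valuation ring of \<open>K\<close> over \<open>k\<close> in which distinct Laurent monomials in \<open>B\<close> have distinct values
  (\<open>adapted_valuation_ring\<close>). Finite generation bounds the dimension spanned by products of at
  most \<open>n\<close> generators by a constant times \<open>n\<^bsup>|B|\<^esup>\<close> (\<open>growth_bound\<close>), and comparing this with the
  number of monomials yields two facts: for \<open>h\<close> in \<open>V n\<close> a power \<open>h\<^sup>N\<close>, with \<open>N\<close> fixed, has the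
  value of a Laurent monomial with exponents of size \<open>O(n)\<close> (\<open>bounded_value_relation\<close>), and the
  space of elements of one given value modulo larger values, a leaf, has bounded dimension
  (\<open>leaf_system_bound\<close>). So \<open>h\<close> has a value in \<open>\<int>\<^sup>B\<close>. Elements of the function field are algebraic
  over \<open>k(B0)\<close>, hence have values in \<open>\<int>\<^bsup>B0\<^esup>\<close>; dividing by powers of a fixed homogeneous element of
  degree \<open>g\<close>, where \<open>g\<close> is the smallest positive difference of degrees that occur, puts the values
  of all of \<open>V\<close> into \<open>\<int>\<^bsup>B0\<^esup>\<close>. If \<open>e\<close> is the largest leaf dimension, then \<open>dim (V (g m))\<close> is at
  most \<open>e\<close> times the number of values in that degree, and at least \<open>e\<close> times the number of values
  in a degree smaller by a constant, because multiplication by the elements of a largest leaf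
  makes every leaf a largest one.

  It remains to count the points of a graded semigroup \<open>\<Gamma>\<close> in \<open>\<nat> \<times> \<int>\<^sup>d\<close> with bounded sections.
  Its saturation, all \<open>z\<close> with a positive multiple in \<open>\<Gamma>\<close>, is convex in the sense needed, so only
  \<open>O(n\<^bsup>d - 1\<^esup>)\<close> of the points in degree \<open>n\<close> do not carry a full unit cube, and dilating cubes by
  \<open>p\<close> shows that degree \<open>p n\<close> has at least \<open>p\<^sup>d\<close> times as many points as there are cubes in degree
  \<open>n\<close>. Thus the number of cubes divided by \<open>n\<^sup>d\<close> never exceeds the limit density; up to the
  boundary term this is the upper bound for \<open>dim (V n)\<close> in every degree. For the lower bound, the
  saturation in one large degree \<open>n\<close> depends on finitely many elements of \<open>\<Gamma>\<close> only, and the levels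
  of a finitely generated semigroup fill the lattice points of its cone up to a translation
  (\<open>conductor\<close>). This gives the limit, and at the same time the approximation by series of finite
  type: the subseries generated by \<open>V 1, \<dots>, V m\<close> contains the finitely many elements in question
  once \<open>m\<close> is large.
\<close>

section \<open>Counting lattice points in graded semigroups\<close>

definition funs_into :: "'i set \<Rightarrow> ('i \<Rightarrow> int set) \<Rightarrow> ('i \<Rightarrow> int) set" where
  "funs_into I A = {f. (\<forall>i\<in>I. f i \<in> A i) \<and> (\<forall>i. i \<notin> I \<longrightarrow> f i = 0)}"

lemma funs_into_insert:
  assumes "i \<notin> I"
  shows "bij_betw (\<lambda>(a, f). f(i := a)) (A i \<times> funs_into I A) (funs_into (insert i I) A)"
proof (rule bij_betw_byWitness[where f' = "\<lambda>f. (f i, f(i := 0))"])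
  show "\<forall>p\<in>A i \<times> funs_into I A. (\<lambda>f. (f i, f(i := 0))) ((\<lambda>(a, f). f(i := a)) p) = p"
    using assms by (auto simp: funs_into_def fun_eq_iff)
qed (use assms in \<open>auto simp: funs_into_def\<close>)

lemma card_funs_into:
  assumes "finite I" "\<And>i. i \<in> I \<Longrightarrow> finite (A i)"
  shows "finite (funs_into I A)" "card (funs_into I A) = (\<Prod>i\<in>I. card (A i))"
proof -
  have "finite (funs_into I A) \<and> card (funs_into I A) = (\<Prod>i\<in>I. card (A i))"
    using assms
  proof (induction I rule: finite_induct)
    case empty
    have "funs_into {} A = {\<lambda>_. 0}" by (auto simp: funs_into_def)
    then show ?case by simp
  next
    case (insert i I)
    note bij = funs_into_insert[OF insert(2), of A]
    have fin: "finite (A i \<times> funs_into I A)" using insert by auto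
    have "finite (funs_into (insert i I) A)" using bij_betw_finite[OF bij] fin by simp
    moreover have "card (funs_into (insert i I) A) = card (A i) * card (funs_into I A)"
      using bij_betw_same_card[OF bij] by (simp add: card_cartesian_product)
    ultimately show ?case using insert by simp
  qed
  then show "finite (funs_into I A)" "card (funs_into I A) = (\<Prod>i\<in>I. card (A i))" by auto
qed

text \<open>Lower bounds \<open>liminf f n / n\<^sup>d \<ge> a\<close> are used in this epsilon form because it passes through
  translations of the argument and lower order errors without a division by \<open>n\<close>.\<close>

definition growth_at_least :: "nat \<Rightarrow> (nat \<Rightarrow> real) \<Rightarrow> real \<Rightarrow> bool" where
  "growth_at_least d f a \<longleftrightarrow> (\<forall>\<epsilon>>0. \<forall>\<^sub>F n in sequentially. f n \<ge> (a - \<epsilon>) * real n ^ d)"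

lemma tendsto_shift_ratio: "(\<lambda>n. (real (n - c) / real n) ^ d) \<longlonglongrightarrow> 1"
proof -
  have "(\<lambda>n. 1 - real c / real n) \<longlonglongrightarrow> 1 - 0"
    by (intro tendsto_diff tendsto_const lim_const_over_n)
  then have "(\<lambda>n. 1 - real c / real n) \<longlonglongrightarrow> 1" by simp
  moreover have "\<forall>\<^sub>F n in sequentially. 1 - real c / real n = real (n - c) / real n"
    using eventually_gt_at_top[of "max c 1"] by eventually_elim (auto simp: of_nat_diff field_simps)
  ultimately have "(\<lambda>n. real (n - c) / real n) \<longlonglongrightarrow> 1"
    by (rule Lim_transform_eventually)
  then have "(\<lambda>n. (real (n - c) / real n) ^ d) \<longlonglongrightarrow> 1 ^ d" by (rule tendsto_power)
  then show ?thesis by simp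
qed

lemma growth_at_least_tendsto:
  assumes "g \<longlonglongrightarrow> a" "\<forall>\<^sub>F n in sequentially. f n \<ge> g n * real n ^ d"
  shows "growth_at_least d f a"
  unfolding growth_at_least_def
proof (intro allI impI)
  fix \<epsilon> :: real assume "\<epsilon> > 0"
  then have "\<forall>\<^sub>F n in sequentially. g n > a - \<epsilon>" using order_tendstoD(1)[OF assms(1)] by auto
  with assms(2) show "\<forall>\<^sub>F n in sequentially. f n \<ge> (a - \<epsilon>) * real n ^ d"
  proof eventually_elim
    case (elim n)
    have "(a - \<epsilon>) * real n ^ d \<le> g n * real n ^ d" using elim by (intro mult_right_mono) auto
    with elim show ?case by linarith
  qed
qed

lemma growth_at_least_shift:
  assumes "growth_at_least d f a"
  shows "growth_at_least d (\<lambda>n. f (n - c)) a"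
  unfolding growth_at_least_def
proof (intro allI impI)
  fix \<epsilon> :: real assume e: "\<epsilon> > 0"
  have "(\<lambda>n. (a - \<epsilon>/2) * (real (n - c) / real n) ^ d) \<longlonglongrightarrow> (a - \<epsilon>/2) * 1"
    by (intro tendsto_mult tendsto_const tendsto_shift_ratio)
  then have 1: "\<forall>\<^sub>F n in sequentially. (a - \<epsilon>/2) * (real (n - c) / real n) ^ d > a - \<epsilon>"
    using e by (intro order_tendstoD(1)) auto
  have "\<forall>\<^sub>F n in sequentially. f n \<ge> (a - \<epsilon>/2) * real n ^ d"
    using assms e unfolding growth_at_least_def by (auto dest: spec[of _ "\<epsilon>/2"])
  then obtain n0 where n0: "\<And>n. n \<ge> n0 \<Longrightarrow> f n \<ge> (a - \<epsilon>/2) * real n ^ d"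
    by (auto simp: eventually_sequentially)
  have 2: "\<forall>\<^sub>F n in sequentially. n \<ge> n0 + c + 1" by (rule eventually_ge_at_top)
  from 1 2 show "\<forall>\<^sub>F n in sequentially. f (n - c) \<ge> (a - \<epsilon>) * real n ^ d"
  proof eventually_elim
    case (elim n)
    have "(a - \<epsilon>) * real n ^ d \<le> (a - \<epsilon>/2) * (real (n - c) / real n) ^ d * real n ^ d"
      using elim by (intro mult_right_mono) auto
    also have "\<dots> = (a - \<epsilon>/2) * real (n - c) ^ d" using elim by (simp add: power_divide)
    also have "\<dots> \<le> f (n - c)" using elim by (intro n0) auto
    finally show ?case .
  qed
qed

lemma growth_at_least_mono:
  assumes "growth_at_least d f a" "\<forall>\<^sub>F n in sequentially. f n \<le> g n"
  shows "growth_at_least d g a"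
  unfolding growth_at_least_def
proof (intro allI impI)
  fix \<epsilon> :: real assume "\<epsilon> > 0"
  then have "\<forall>\<^sub>F n in sequentially. f n \<ge> (a - \<epsilon>) * real n ^ d"
    using assms unfolding growth_at_least_def by auto
  with assms(2) show "\<forall>\<^sub>F n in sequentially. g n \<ge> (a - \<epsilon>) * real n ^ d"
    by eventually_elim linarith
qed

lemma growth_at_least_weaken:
  assumes "growth_at_least d f a" "b \<le> a"
  shows "growth_at_least d f b"
  unfolding growth_at_least_def
proof (intro allI impI)
  fix \<epsilon> :: real assume "\<epsilon> > 0"
  then have "\<forall>\<^sub>F n in sequentially. f n \<ge> (a - \<epsilon>) * real n ^ d"
    using assms(1) unfolding growth_at_least_def by auto
  then show "\<forall>\<^sub>F n in sequentially. f n \<ge> (b - \<epsilon>) * real n ^ d"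
  proof eventually_elim
    case (elim n)
    have "(b - \<epsilon>) * real n ^ d \<le> (a - \<epsilon>) * real n ^ d" using assms(2) by (intro mult_right_mono) auto
    with elim show ?case by linarith
  qed
qed

lemma growth_at_least_mult:
  assumes "growth_at_least d f a" "b > 0"
  shows "growth_at_least d (\<lambda>n. b * f n) (b * a)"
  unfolding growth_at_least_def
proof (intro allI impI)
  fix \<epsilon> :: real assume "\<epsilon> > 0"
  then have "\<forall>\<^sub>F n in sequentially. f n \<ge> (a - \<epsilon> / b) * real n ^ d"
    using assms unfolding growth_at_least_def by (auto dest: spec[of _ "\<epsilon>/b"])
  then show "\<forall>\<^sub>F n in sequentially. b * f n \<ge> (b * a - \<epsilon>) * real n ^ d"
  proof eventually_elim
    case (elim n)
    then have "b * ((a - \<epsilon> / b) * real n ^ d) \<le> b * f n" using assms(2) by (intro mult_left_mono) auto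
    moreover have "b * ((a - \<epsilon> / b) * real n ^ d) = (b * a - \<epsilon>) * real n ^ d"
      using assms(2) by (simp add: right_diff_distrib left_diff_distrib)
    ultimately show ?case by simp
  qed
qed

text \<open>The factor \<open>d\<close> in the error keeps the statement right for \<open>d = 0\<close>, where \<open>d - 1\<close> is truncated:
  there the error vanishes instead of being a constant.\<close>

lemma growth_at_least_minus:
  assumes "growth_at_least d f a"
  shows "growth_at_least d (\<lambda>n. f n - real d * K * real n ^ (d - 1)) a"
  unfolding growth_at_least_def
proof (intro allI impI)
  fix \<epsilon> :: real assume e: "\<epsilon> > 0"
  have 1: "\<forall>\<^sub>F n in sequentially. f n \<ge> (a - \<epsilon>/2) * real n ^ d"
    using assms e unfolding growth_at_least_def by (auto dest: spec[of _ "\<epsilon>/2"])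
  have "(\<lambda>n. real d * K / real n) \<longlonglongrightarrow> 0" by (rule lim_const_over_n)
  then have 2: "\<forall>\<^sub>F n in sequentially. real d * K / real n < \<epsilon>/2"
    using e by (intro order_tendstoD(2)) auto
  from 1 2 eventually_gt_at_top[of 0]
  show "\<forall>\<^sub>F n in sequentially. f n - real d * K * real n ^ (d - 1) \<ge> (a - \<epsilon>) * real n ^ d"
  proof eventually_elim
    case (elim n)
    have "real d * K * real n ^ (d - 1) \<le> \<epsilon>/2 * real n ^ d"
    proof (cases "d = 0")
      case False
      then obtain e where d: "d = Suc e" by (cases d) auto
      have "real d * K * real n ^ (d - 1) = real d * K / real n * real n ^ d"
        using elim d by (simp add: field_simps)
      also have "\<dots> \<le> \<epsilon>/2 * real n ^ d" using elim by (intro mult_right_mono) auto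
      finally show ?thesis .
    qed (use e in auto)
    with elim show ?case by (simp add: algebra_simps)
  qed
qed

text \<open>A graded semigroup whose degree \<open>n\<close> part lies in \<open>\<int>\<^sup>I\<close> and in a box of size proportional to \<open>n\<close>, so that
  the cone it generates has bounded sections.\<close>

locale bounded_semigroup =
  fixes I :: "'i set" and \<Gamma> :: "nat \<Rightarrow> ('i \<Rightarrow> int) set" and C :: nat
  assumes finite_I: "finite I"
    and zero_mem: "0 \<in> \<Gamma> 0"
    and add_mem: "x \<in> \<Gamma> m \<Longrightarrow> y \<in> \<Gamma> n \<Longrightarrow> x + y \<in> \<Gamma> (m + n)"
    and supp: "z \<in> \<Gamma> n \<Longrightarrow> i \<notin> I \<Longrightarrow> z i = 0"
    and bound: "z \<in> \<Gamma> n \<Longrightarrow> \<bar>z i\<bar> \<le> int (C * n)"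
begin

abbreviation boundary_term :: "real \<Rightarrow> nat \<Rightarrow> real" where
  "boundary_term K n \<equiv> real (card I) * K * real n ^ (card I - 1)"

text \<open>The lattice points of the cone generated by \<open>\<Gamma>\<close>: these play the role of the integer points of the
  multiples of a Newton-Okounkov body. All of \<open>\<int>\<^sup>I\<close> is admitted here, not only the group generated by
  \<open>\<Gamma>\<close>, so that the coordinate directions are available for counting.\<close>

definition sat :: "nat \<Rightarrow> ('i \<Rightarrow> int) set" where
  "sat n = {z. (\<forall>i. i \<notin> I \<longrightarrow> z i = 0) \<and> (\<exists>j\<ge>1. (\<lambda>i. int j * z i) \<in> \<Gamma> (j * n))}"

lemma multiple_mem:
  assumes "z \<in> \<Gamma> n" shows "(\<lambda>i. int j * z i) \<in> \<Gamma> (j * n)"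
proof (induction j)
  case 0
  then show ?case using zero_mem by (simp add: zero_fun_def)
next
  case (Suc j)
  have "z + (\<lambda>i. int j * z i) \<in> \<Gamma> (n + j * n)" using assms Suc by (rule add_mem)
  moreover have "z + (\<lambda>i. int j * z i) = (\<lambda>i. int (Suc j) * z i)"
    by (auto simp: fun_eq_iff algebra_simps)
  ultimately show ?case by simp
qed

lemma subset_sat: "\<Gamma> n \<subseteq> sat n"
proof
  fix z assume z: "z \<in> \<Gamma> n"
  then have "(\<lambda>i. int 1 * z i) \<in> \<Gamma> (1 * n)" by simp
  moreover have "\<forall>i. i \<notin> I \<longrightarrow> z i = 0" using supp z by blast
  ultimately show "z \<in> sat n" unfolding sat_def by blast
qed

lemma sat_supp: "z \<in> sat n \<Longrightarrow> i \<notin> I \<Longrightarrow> z i = 0"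
  unfolding sat_def by blast

lemma sat_divide:
  assumes "k \<ge> 1" "(\<lambda>i. int k * z i) \<in> sat (k * n)" shows "z \<in> sat n"
proof -
  obtain j where j: "j \<ge> 1" "(\<lambda>i. int j * (int k * z i)) \<in> \<Gamma> (j * (k * n))"
    using assms(2) unfolding sat_def by blast
  have "\<forall>i. i \<notin> I \<longrightarrow> int k * z i = 0" using assms(2) unfolding sat_def by blast
  then have "\<forall>i. i \<notin> I \<longrightarrow> z i = 0" using assms(1) by simp
  moreover have "(\<lambda>i. int (j * k) * z i) \<in> \<Gamma> ((j * k) * n)" using j by (simp add: mult.assoc)
  moreover have "j * k \<ge> 1" using j assms(1) by simp
  ultimately show ?thesis unfolding sat_def by blast
qed

lemma sat_add:
  assumes "x \<in> sat m" "y \<in> sat n" shows "x + y \<in> sat (m + n)"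
proof -
  obtain j where j: "j \<ge> 1" "(\<lambda>i. int j * x i) \<in> \<Gamma> (j * m)" using assms unfolding sat_def by blast
  obtain k where k: "k \<ge> 1" "(\<lambda>i. int k * y i) \<in> \<Gamma> (k * n)" using assms unfolding sat_def by blast
  have "(\<lambda>i. int k * (int j * x i)) + (\<lambda>i. int j * (int k * y i)) \<in> \<Gamma> (k * (j * m) + j * (k * n))"
    using multiple_mem[OF j(2), of k] multiple_mem[OF k(2), of j] by (rule add_mem)
  moreover have "(\<lambda>i. int k * (int j * x i)) + (\<lambda>i. int j * (int k * y i)) =
      (\<lambda>i. int (j * k) * (x + y) i)"
    by (auto simp: fun_eq_iff algebra_simps)
  moreover have "k * (j * m) + j * (k * n) = (j * k) * (m + n)" by (simp add: algebra_simps)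
  ultimately have "(\<lambda>i. int (j * k) * (x + y) i) \<in> \<Gamma> ((j * k) * (m + n))" by simp
  moreover have "j * k \<ge> 1" using j k by simp
  moreover have "\<forall>i. i \<notin> I \<longrightarrow> (x + y) i = 0" using assms by (auto simp: sat_def)
  ultimately show ?thesis unfolding sat_def by blast
qed

lemma sat_zero: "0 \<in> sat 0" using subset_sat zero_mem by auto

lemma sat_multiple:
  assumes "z \<in> sat n" shows "(\<lambda>i. int j * z i) \<in> sat (j * n)"
proof (induction j)
  case 0
  then show ?case using sat_zero by (simp add: zero_fun_def)
next
  case (Suc j)
  have "z + (\<lambda>i. int j * z i) \<in> sat (n + j * n)" using assms Suc by (rule sat_add)
  moreover have "z + (\<lambda>i. int j * z i) = (\<lambda>i. int (Suc j) * z i)"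
    by (auto simp: fun_eq_iff algebra_simps)
  ultimately show ?case by simp
qed

lemma sat_bound: assumes "z \<in> sat n" shows "\<bar>z i\<bar> \<le> int (C * n)"
proof -
  obtain j where j: "j \<ge> 1" "(\<lambda>i. int j * z i) \<in> \<Gamma> (j * n)" using assms unfolding sat_def by blast
  have "\<bar>int j * z i\<bar> \<le> int (C * (j * n))" using bound[OF j(2)] .
  then have "int j * \<bar>z i\<bar> \<le> int j * int (C * n)" by (simp add: abs_mult algebra_simps)
  then show ?thesis using j(1) by (subst (asm) mult_le_cancel_left_pos) auto
qed

lemma sat_subset_box: "sat n \<subseteq> funs_into I (\<lambda>_. {- int (C * n)..int (C * n)})"
proof
  fix z assume "z \<in> sat n"
  then show "z \<in> funs_into I (\<lambda>_. {- int (C * n)..int (C * n)})"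
    using sat_bound[of z n] by (auto simp: funs_into_def sat_def abs_le_iff minus_le_iff)
qed

lemma finite_sat [simp]: "finite (sat n)"
  by (rule finite_subset[OF sat_subset_box card_funs_into(1)]) (use finite_I in auto)

lemma finite_level [simp]: "finite (\<Gamma> n)"
  by (rule finite_subset[OF subset_sat finite_sat])

lemma card_sat_le: "real (card (sat n)) \<le> real (2 * C * n + 1) ^ card I"
proof -
  have "card (sat n) \<le> card (funs_into I (\<lambda>_. {- int (C * n)..int (C * n)}))"
    by (intro card_mono sat_subset_box card_funs_into) (use finite_I in auto)
  also have "\<dots> = (2 * C * n + 1) ^ card I"
    using finite_I by (subst card_funs_into) (auto simp: nat_add_distrib nat_mult_distrib mult.assoc)
  finally show ?thesis by (metis of_nat_le_iff of_nat_power)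
qed

text \<open>Convexity, in the only form that is needed: along the lattice points of a line.\<close>

lemma sat_between:
  assumes x: "x \<in> sat n" and y: "(\<lambda>i. x i + int k * c i) \<in> sat n" and l: "l \<le> k"
  shows "(\<lambda>i. x i + int l * c i) \<in> sat n"
proof (cases "k = 0")
  case True
  then show ?thesis using l y by simp
next
  case False
  have "(\<lambda>i. int (k - l) * x i) + (\<lambda>i. int l * (x i + int k * c i)) \<in> sat ((k - l) * n + l * n)"
    using sat_multiple[OF x] sat_multiple[OF y] by (rule sat_add)
  moreover have "(\<lambda>i. int (k - l) * x i) + (\<lambda>i. int l * (x i + int k * c i)) =
      (\<lambda>i. int k * (x i + int l * c i))"
    using l by (auto simp: fun_eq_iff of_nat_diff algebra_simps)
  moreover have "(k - l) * n + l * n = k * n" using l by (simp flip: add_mult_distrib)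
  ultimately show ?thesis using False sat_divide[of k "\<lambda>i. x i + int l * c i" n] by simp
qed

lemma line_boundary_inj:
  assumes "x \<in> sat n" "y \<in> sat n" "x + c \<notin> sat n" "x + (\<lambda>i. int k * c i) = y" shows "x = y"
proof (cases "k = 0")
  case True
  then show ?thesis using assms(4) by (auto simp: fun_eq_iff)
next
  case False
  have "(\<lambda>i. x i + int k * c i) = x + (\<lambda>i. int k * c i)" by (rule ext) simp
  then have "(\<lambda>i. x i + int k * c i) \<in> sat n" using assms(2,4) by simp
  then have "(\<lambda>i. x i + int 1 * c i) \<in> sat n" using False sat_between[OF assms(1), of k c 1] by simp
  moreover have "(\<lambda>i. x i + int 1 * c i) = x + c" by (rule ext) simp
  ultimately show ?thesis using assms(3) by simp
qed

text \<open>By convexity each line in direction \<open>c\<close> has at most one point from which a step by \<open>c\<close> leaves the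
  level, and the number of lines that meet a box of side \<open>O(n)\<close> is \<open>O(n\<^bsup>|I| - 1\<^esup>)\<close>.\<close>

lemma line_boundary_count:
  assumes c: "\<And>i. i \<notin> I \<Longrightarrow> c i = 0"
  obtains K :: real where "K \<ge> 0"
    "\<And>n. n \<ge> 1 \<Longrightarrow> real (card {x \<in> sat n. x + c \<notin> sat n}) \<le> boundary_term K n"
proof (cases "c = 0")
  case True
  show ?thesis by (rule that[of 0]) (use True in auto)
next
  case False
  then obtain i0 where i0: "c i0 \<noteq> 0" by (auto simp: fun_eq_iff)
  with c have i0I: "i0 \<in> I" by auto
  define M where "M = (\<Sum>i\<in>I. \<bar>c i\<bar>)"
  have M: "\<bar>c i\<bar> \<le> M" for i
  proof (cases "i \<in> I")
    case True then show ?thesis unfolding M_def using finite_I by (intro member_le_sum) auto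
  next
    case False then show ?thesis using c unfolding M_def by (simp add: sum_nonneg)
  qed
  define b where "b = nat \<bar>c i0\<bar>"
  define a where "a = nat (4 * int C * M + 1)"
  have M0: "M \<ge> 0" using M[of i0] by simp
  \<comment> \<open>\<open>\<phi>\<close> records the line through \<open>x\<close> by the quantities \<open>x\<^sub>i c\<^sub>i\<^sub>0 - x\<^sub>i\<^sub>0 c\<^sub>i\<close>, and \<open>x\<close> modulo \<open>c\<close> by its coordinate \<open>i0\<close>.\<close>
  define \<phi> where "\<phi> x = (\<lambda>i. if i = i0 then x i0 mod \<bar>c i0\<bar> else x i * c i0 - x i0 * c i)" for x
  have bnd: "real (card {x \<in> sat n. x + c \<notin> sat n}) \<le> boundary_term (real b * real a ^ (card I - 1)) n"
    if n: "n \<ge> 1" for n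
  proof -
    define X where "X = {x \<in> sat n. x + c \<notin> sat n}"
    define A where "A = (\<lambda>i. if i = i0 then {0..<\<bar>c i0\<bar>} else {- (2 * int (C * n) * M)..2 * int (C * n) * M})"
    have "inj_on \<phi> X"
    proof (rule inj_onI)
      fix x y assume xy: "x \<in> X" "y \<in> X" "\<phi> x = \<phi> y"
      have "x i0 mod \<bar>c i0\<bar> = y i0 mod \<bar>c i0\<bar>" using xy(3) by (auto simp: \<phi>_def dest: fun_cong[of _ _ i0])
      then have "c i0 dvd x i0 - y i0" by (simp add: mod_eq_dvd_iff)
      then obtain l where l: "x i0 - y i0 = c i0 * l" by auto
      have "x i - y i = c i * l" for i
      proof (cases "i = i0")
        case False
        have "x i * c i0 - x i0 * c i = y i * c i0 - y i0 * c i"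
          using xy(3) False by (auto simp: \<phi>_def dest: fun_cong[of _ _ i])
        then have "c i0 * (x i - y i) = (x i0 - y i0) * c i" by (simp add: algebra_simps)
        also have "\<dots> = c i0 * (c i * l)" by (simp only: l ac_simps)
        finally show ?thesis using i0 by (simp only: mult_cancel_left) simp
      qed (use l in auto)
      then have xl: "x i = y i + l * c i" for i by (metis add.commute diff_add_cancel mult.commute)
      show "x = y"
      proof (cases "l \<ge> 0")
        case True
        have "y + (\<lambda>i. int (nat l) * c i) = x" using True xl by (auto simp: fun_eq_iff)
        then show ?thesis using line_boundary_inj[of y n x c "nat l"] xy by (auto simp: X_def)
      next
        case False
        have "x + (\<lambda>i. int (nat (-l)) * c i) = y" using False xl by (auto simp: fun_eq_iff)
        then show ?thesis using line_boundary_inj[of x n y c "nat (-l)"] xy by (auto simp: X_def)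
      qed
    qed
    moreover have "\<phi> ` X \<subseteq> funs_into I A"
    proof
      fix f assume "f \<in> \<phi> ` X"
      then obtain x where x: "x \<in> sat n" "f = \<phi> x" by (auto simp: X_def)
      have "\<bar>x i * c i0 - x i0 * c i\<bar> \<le> 2 * int (C * n) * M" for i
      proof -
        have "\<bar>x i * c i0\<bar> \<le> int (C * n) * M" "\<bar>x i0 * c i\<bar> \<le> int (C * n) * M"
          unfolding abs_mult using sat_bound[OF x(1)] M by (auto intro!: mult_mono)
        then show ?thesis by linarith
      qed
      then have "f i \<in> A i" for i
        using x(2) i0 by (auto simp: \<phi>_def A_def abs_le_iff minus_le_iff)
      moreover have "f i = 0" if "i \<notin> I" for i
        using that i0I c x by (auto simp: \<phi>_def sat_def)
      ultimately show "f \<in> funs_into I A" by (auto simp: funs_into_def)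
    qed
    moreover have fin: "finite (funs_into I A)"
      using finite_I by (intro card_funs_into) (auto simp: A_def)
    ultimately have "card X \<le> card (funs_into I A)" by (rule card_inj_on_le)
    also have "\<dots> = (\<Prod>i\<in>I. card (A i))" using finite_I by (intro card_funs_into) (auto simp: A_def)
    also have "\<dots> = card (A i0) * (\<Prod>i\<in>I - {i0}. card (A i))"
      using finite_I i0I by (rule prod.remove)
    also have "card (A i0) = b" by (simp add: A_def b_def)
    also have "(\<Prod>i\<in>I - {i0}. card (A i)) = (\<Prod>i\<in>I - {i0}. nat (4 * int (C * n) * M + 1))"
      by (intro prod.cong) (auto simp: A_def algebra_simps)
    also have "\<dots> = nat (4 * int (C * n) * M + 1) ^ (card I - 1)"
      using finite_I i0I by simp
    also have "b * nat (4 * int (C * n) * M + 1) ^ (card I - 1) \<le> b * (a * n) ^ (card I - 1)"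
    proof (intro mult_left_mono power_mono)
      have "4 * int (C * n) * M + 1 \<le> (4 * int C * M + 1) * int n" using n by (simp add: algebra_simps)
      then have "nat (4 * int (C * n) * M + 1) \<le> nat ((4 * int C * M + 1) * int n)" by (rule nat_mono)
      also have "\<dots> = a * n" using M0 by (simp add: a_def nat_mult_distrib)
      finally show "nat (4 * int (C * n) * M + 1) \<le> a * n" .
    qed auto
    finally have "real (card X) \<le> real (b * (a * n) ^ (card I - 1))" by (simp only: of_nat_le_iff)
    also have "\<dots> = 1 * (real b * real a ^ (card I - 1) * real n ^ (card I - 1))" by (simp add: power_mult_distrib)
    also have "\<dots> \<le> real (card I) * (real b * real a ^ (card I - 1) * real n ^ (card I - 1))"
    proof (rule mult_right_mono)
      have "card I \<ge> 1" using finite_I i0I by (metis One_nat_def Suc_leI card_gt_0_iff empty_iff)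
      then show "1 \<le> real (card I)" by simp
    qed auto
    finally show ?thesis by (simp add: X_def mult.assoc)
  qed
  show ?thesis by (rule that[of "real b * real a ^ (card I - 1)"]) (use bnd in auto)
qed

text \<open>The points whose unit cube in the positive directions stays in the level; this is what can be
  dilated without leaving the cone.\<close>

definition interior :: "nat \<Rightarrow> ('i \<Rightarrow> int) set" where
  "interior n = {x. \<forall>E\<subseteq>I. x + (\<lambda>i. of_bool (i \<in> E)) \<in> sat n}"

lemma interior_subset: "interior n \<subseteq> sat n"
proof
  fix x assume "x \<in> interior n"
  then have "x + (\<lambda>i. of_bool (i \<in> {})) \<in> sat n" unfolding interior_def by blast
  moreover have "x + (\<lambda>i. of_bool (i \<in> {})) = x" by (rule ext) simp
  ultimately show "x \<in> sat n" by simp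
qed

lemma finite_interior [simp]: "finite (interior n)"
  by (rule finite_subset[OF interior_subset finite_sat])

lemma card_sat_interior:
  obtains K :: real where "K \<ge> 0"
    "\<And>n. n \<ge> 1 \<Longrightarrow> real (card (sat n)) \<le> real (card (interior n)) + boundary_term K n"
proof -
  define c :: "'i set \<Rightarrow> 'i \<Rightarrow> int" where "c E = (\<lambda>i. of_bool (i \<in> E))" for E
  have "\<exists>K::real. K \<ge> 0 \<and> (\<forall>n\<ge>1. real (card {x \<in> sat n. x + c E \<notin> sat n}) \<le> boundary_term K n)"
    if "E \<subseteq> I" for E
  proof -
    have "c E i = 0" if "i \<notin> I" for i using that \<open>E \<subseteq> I\<close> by (auto simp: c_def)
    then show ?thesis by (rule line_boundary_count[of "c E"]) blast+
  qed
  then have "\<forall>E\<in>Pow I. \<exists>K::real. K \<ge> 0 \<and> (\<forall>n\<ge>1. real (card {x \<in> sat n. x + c E \<notin> sat n}) \<le> boundary_term K n)"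
    by simp
  from bchoice[OF this] obtain K where "\<forall>E\<in>Pow I. K E \<ge> 0 \<and> (\<forall>n\<ge>1. real (card {x \<in> sat n. x + c E \<notin> sat n}) \<le> boundary_term (K E) n)"
    by (rule exE)
  then have K: "\<And>E. E \<subseteq> I \<Longrightarrow> K E \<ge> 0" "\<And>E n. E \<subseteq> I \<Longrightarrow> n \<ge> 1 \<Longrightarrow>
     real (card {x \<in> sat n. x + c E \<notin> sat n}) \<le> boundary_term (K E) n"
    by simp_all
  show ?thesis
  proof (rule that[of "\<Sum>E\<in>Pow I. K E"])
    show "(\<Sum>E\<in>Pow I. K E) \<ge> 0" using K by (intro sum_nonneg) auto
    fix n :: nat assume n: "n \<ge> 1"
    have "sat n \<subseteq> interior n \<union> (\<Union>E\<in>Pow I. {x \<in> sat n. x + c E \<notin> sat n})"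
      by (auto simp: interior_def c_def)
    then have "card (sat n) \<le> card (interior n \<union> (\<Union>E\<in>Pow I. {x \<in> sat n. x + c E \<notin> sat n}))"
      using finite_I by (intro card_mono) auto
    also have "\<dots> \<le> card (interior n) + card (\<Union>E\<in>Pow I. {x \<in> sat n. x + c E \<notin> sat n})"
      by (rule card_Un_le)
    also have "\<dots> \<le> card (interior n) + (\<Sum>E\<in>Pow I. card {x \<in> sat n. x + c E \<notin> sat n})"
      using finite_I by (intro add_left_mono card_UN_le) auto
    finally have "real (card (sat n)) \<le> real (card (interior n) + (\<Sum>E\<in>Pow I. card {x \<in> sat n. x + c E \<notin> sat n}))"
      by (simp only: of_nat_le_iff)
    also have "\<dots> \<le> real (card (interior n)) + (\<Sum>E\<in>Pow I. boundary_term (K E) n)"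
      using K(2) n by (auto intro!: sum_mono)
    also have "\<dots> = real (card (interior n)) + boundary_term (\<Sum>E\<in>Pow I. K E) n"
      by (simp add: sum_distrib_left sum_distrib_right)
    finally show "real (card (sat n)) \<le> real (card (interior n)) + boundary_term (\<Sum>E\<in>Pow I. K E) n" .
  qed
qed

text \<open>A vector of \<open>{0..p}\<^sup>I\<close> is a sum of \<open>p\<close> vertices of the unit cube, so the point is a sum of \<open>p\<close> elements of
  level \<open>n\<close>.\<close>

lemma interior_dilate:
  assumes x: "x \<in> interior n" and y: "\<And>i. i \<in> I \<Longrightarrow> 0 \<le> y i \<and> y i \<le> int p" "\<And>i. i \<notin> I \<Longrightarrow> y i = 0"
  shows "(\<lambda>i. int p * x i + y i) \<in> sat (p * n)"
  using y
proof (induction p arbitrary: y)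
  case 0
  then have "y i = 0" for i by (cases "i \<in> I") force+
  then have eq: "(\<lambda>i. int 0 * x i + y i) = 0" by (intro ext) simp
  show ?case by (simp only: eq mult_0 sat_zero)
next
  case (Suc p)
  define E where "E = {i\<in>I. y i \<ge> 1}"
  have "(\<lambda>i. int p * x i + (y i - of_bool (i \<in> E))) \<in> sat (p * n)"
  proof (rule Suc.IH)
    show "0 \<le> y i - of_bool (i \<in> E) \<and> y i - of_bool (i \<in> E) \<le> int p" if "i \<in> I" for i
      using Suc.prems(1)[OF that] that by (auto simp: E_def)
    show "y i - of_bool (i \<in> E) = 0" if "i \<notin> I" for i
      using Suc.prems(2)[OF that] that by (auto simp: E_def)
  qed
  moreover have "x + (\<lambda>i. of_bool (i \<in> E)) \<in> sat n"
    proof -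
    have "E \<subseteq> I" by (auto simp: E_def)
    then show ?thesis using x unfolding interior_def by blast
  qed
  ultimately have "(\<lambda>i. int p * x i + (y i - of_bool (i \<in> E))) + (x + (\<lambda>i. of_bool (i \<in> E))) \<in> sat (p * n + n)"
    by (rule sat_add)
  moreover have "(\<lambda>i. int p * x i + (y i - of_bool (i \<in> E))) + (x + (\<lambda>i. of_bool (i \<in> E))) =
      (\<lambda>i. int (Suc p) * x i + y i)"
    by (rule ext) (simp add: algebra_simps)
  ultimately show ?case by (simp add: add.commute)
qed

text \<open>The cubes of side \<open>p\<close> at the dilated interior points are disjoint.\<close>

lemma card_interior_dilate: "p ^ card I * card (interior n) \<le> card (sat (p * n))"
proof -
  define Y where "Y = funs_into I (\<lambda>_. {0..<int p})"
  have Y: "finite Y" "card Y = p ^ card I"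
    using card_funs_into[of I "\<lambda>_. {0..<int p}"] finite_I by (auto simp: Y_def)
  define g where "g = (\<lambda>(x :: 'i \<Rightarrow> int, y) i. int p * x i + y i)"
  have "inj_on g (interior n \<times> Y)"
  proof (rule inj_onI)
    fix a b assume "a \<in> interior n \<times> Y" "b \<in> interior n \<times> Y" "g a = g b"
    then obtain x y x' y' where ab: "a = (x, y)" "b = (x', y')" "x \<in> interior n" "x' \<in> interior n" "y \<in> Y" "y' \<in> Y"
      and eq: "\<And>i. int p * x i + y i = int p * x' i + y' i"
      by (auto simp: g_def fun_eq_iff)
    have "x i = x' i \<and> y i = y' i" for i
    proof (cases "i \<in> I")
      case True
      then have "y i \<in> {0..<int p}" "y' i \<in> {0..<int p}" using ab by (auto simp: Y_def funs_into_def)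
      then have "(int p * x i + y i) div int p = x i" "(int p * x' i + y' i) div int p = x' i"
        by simp_all
      then have "x i = x' i" using eq[of i] by simp
      then show ?thesis using eq[of i] by simp
    next
      case False
      then have "x i = 0" "x' i = 0" using ab(3,4) interior_subset sat_supp by blast+
      moreover have "y i = 0" "y' i = 0" using False ab(5,6) by (auto simp: Y_def funs_into_def)
      ultimately show ?thesis by simp
    qed
    then show "a = b" using ab by (auto simp: fun_eq_iff)
  qed
  moreover have "g ` (interior n \<times> Y) \<subseteq> sat (p * n)"
  proof
    fix z assume "z \<in> g ` (interior n \<times> Y)"
    then obtain x y where "x \<in> interior n" "y \<in> Y" "z = (\<lambda>i. int p * x i + y i)" by (auto simp: g_def)
    then show "z \<in> sat (p * n)"
      using interior_dilate[of x n y p] by (simp add: Y_def funs_into_def less_imp_le)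
  qed
  ultimately have "card (interior n \<times> Y) \<le> card (sat (p * n))" by (intro card_inj_on_le) auto
  then show ?thesis by (simp add: card_cartesian_product Y mult.commute)
qed

text \<open>Adding a fixed point of level \<open>l\<close> embeds one level of the saturation into another.\<close>

lemma card_sat_add:
  assumes "\<Gamma> l \<noteq> {}" shows "card (sat n) \<le> card (sat (n + l))"
proof -
  obtain g where g: "g \<in> \<Gamma> l" using assms by auto
  show ?thesis
  proof (rule card_inj_on_le)
    show "inj_on (\<lambda>z. z + g) (sat n)" by (rule inj_onI) simp
    show "(\<lambda>z. z + g) ` sat n \<subseteq> sat (n + l)" using sat_add g subset_sat by blast
  qed simp
qed

lemma consecutive_levels_nonempty:
  assumes "\<Gamma> s \<noteq> {}" "\<Gamma> (Suc s) \<noteq> {}" "m \<ge> s * s"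
  shows "\<Gamma> m \<noteq> {}"
proof -
  obtain x y where x: "x \<in> \<Gamma> s" and y: "y \<in> \<Gamma> (Suc s)" using assms by auto
  define a b where "a = (if s = 0 then 0 else m div s)" and "b = (if s = 0 then m else m mod s)"
  have "a \<ge> b \<or> s = 0"
  proof (cases "s = 0")
    case False
    then have "m div s \<ge> s" using assms(3) by (simp add: less_eq_div_iff_mult_less_eq)
    moreover have "m mod s < s" using False by simp
    ultimately have "m mod s \<le> m div s" by linarith
    then show ?thesis using False by (simp add: a_def b_def)
  qed simp
  then have "(a - b) * s + b * Suc s = m"
  proof
    assume ab: "a \<ge> b"
    have "(a - b) * s + b * Suc s = ((a - b) + b) * s + b" by (simp only: add_mult_distrib mult_Suc_right add.assoc add.commute[of b])
    also have "\<dots> = a * s + b" using ab by simp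
    also have "\<dots> = m" by (simp add: a_def b_def)
    finally show ?thesis .
  qed (simp add: a_def b_def)
  moreover have "(\<lambda>i. int (a - b) * x i) + (\<lambda>i. int b * y i) \<in> \<Gamma> ((a - b) * s + b * Suc s)"
    using multiple_mem[OF x] multiple_mem[OF y] by (rule add_mem)
  ultimately show ?thesis by auto
qed

text \<open>A single level with many interior points forces growth of all later levels: write the level
  as a large multiple of the given one plus a level at which the semigroup is nonempty.\<close>

lemma sat_growth:
  assumes "\<Gamma> s \<noteq> {}" "\<Gamma> (Suc s) \<noteq> {}" "n \<ge> 1"
  shows "growth_at_least (card I) (\<lambda>k. real (card (sat k))) (real (card (interior n)) / real n ^ card I)"
proof -
  define c where "c = s * s + n"
  have le: "real (card (interior n)) / real n ^ card I * (real (k - c) / real k) ^ card I * real k ^ card I \<le> real (card (sat k))"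
    if k: "k > c" for k
  proof -
    define p where "p = (k - s * s) div n"
    have pn: "p * n \<le> k - s * s" by (simp add: p_def)
    have "(k - s * s) mod n < n" using assms(3) by simp
    then have "k - s * s < p * n + n" unfolding p_def by (metis add_less_cancel_left div_mult_mod_eq)
    then have kp: "k - c \<le> p * n" using k by (simp add: c_def)
    have "k - p * n \<ge> s * s" using pn k by (simp add: c_def)
    then have ne: "\<Gamma> (k - p * n) \<noteq> {}" using consecutive_levels_nonempty assms by blast
    have "real (card (interior n)) / real n ^ card I * (real (k - c) / real k) ^ card I * real k ^ card I
       = real (card (interior n)) * (real (k - c) ^ card I / real n ^ card I)"
      using k by (simp add: power_divide)
    also have "\<dots> \<le> real (card (interior n)) * (real (p * n) ^ card I / real n ^ card I)"
      using kp by (intro mult_left_mono divide_right_mono power_mono) (auto simp del: of_nat_mult)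
    also have "\<dots> = real (p ^ card I * card (interior n))"
      using assms(3) by (simp add: power_mult_distrib)
    also have "\<dots> \<le> real (card (sat (p * n)))" using card_interior_dilate by (simp only: of_nat_le_iff)
    also have "\<dots> \<le> real (card (sat (p * n + (k - p * n))))" using card_sat_add[OF ne] by simp
    also have "p * n + (k - p * n) = k" using pn by simp
    finally show ?thesis .
  qed
  show ?thesis
  proof (rule growth_at_least_tendsto)
    have "(\<lambda>k. real (card (interior n)) / real n ^ card I * (real (k - c) / real k) ^ card I) \<longlonglongrightarrow>
        real (card (interior n)) / real n ^ card I * 1"
      by (intro tendsto_mult tendsto_const tendsto_shift_ratio)
    then show "(\<lambda>k. real (card (interior n)) / real n ^ card I * (real (k - c) / real k) ^ card I) \<longlonglongrightarrow>
        real (card (interior n)) / real n ^ card I" by simp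
    show "\<forall>\<^sub>F k in sequentially. real (card (interior n)) / real n ^ card I * (real (k - c) / real k) ^ card I * real k ^ card I \<le> real (card (sat k))"
      using eventually_gt_at_top[of c] by eventually_elim (rule le)
  qed
qed

lemma interior_density_bounded: "bdd_above ((\<lambda>n. real (card (interior n)) / real n ^ card I) ` {1..})"
proof (rule bdd_aboveI2)
  fix n :: nat assume n: "n \<in> {1..}"
  have "real (card (interior n)) \<le> real (card (sat n))" by (simp add: card_mono interior_subset)
  also have "\<dots> \<le> real (2 * C * n + 1) ^ card I" by (rule card_sat_le)
  also have "\<dots> \<le> (real (2 * C + 1) * real n) ^ card I"
    using n by (intro power_mono) (auto simp: algebra_simps)
  finally have "real (card (interior n)) \<le> real (2 * C + 1) ^ card I * real n ^ card I"
    by (simp only: power_mult_distrib)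
  then show "real (card (interior n)) / real n ^ card I \<le> real (2 * C + 1) ^ card I"
    using n by (intro mult_imp_div_pos_le) auto
qed

text \<open>Once all large degrees occur, this is the limit of \<open>card (sat n) / n\<^bsup>|I|\<^esup>\<close>. Taking the supremum over the interiors
  makes the upper bound, with a boundary term, available in every single degree, while the lower bound
  is \<open>sat_growth\<close>.\<close>

definition density :: real where
  "density = (SUP n\<in>{1..}. real (card (interior n)) / real n ^ card I)"

lemma interior_le_density: "n \<ge> 1 \<Longrightarrow> real (card (interior n)) \<le> density * real n ^ card I"
  using cSUP_upper[OF _ interior_density_bounded, of n] by (simp add: density_def field_simps)

lemma density_approx:
  assumes "\<epsilon> > 0"
  obtains n where "n \<ge> 1" "real (card (interior n)) / real n ^ card I > density - \<epsilon>"
proof -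
  have "density - \<epsilon> < (SUP n\<in>{1..}. real (card (interior n)) / real n ^ card I)"
    using assms by (simp add: density_def)
  then obtain n where "n \<in> {1..}" "density - \<epsilon> < real (card (interior n)) / real n ^ card I"
    using less_cSUP_iff[OF _ interior_density_bounded] by auto
  then show ?thesis by (intro that[of n]) auto
qed

definition differences :: "('i \<Rightarrow> int) set" where
  "differences = {x - y | x y n. x \<in> \<Gamma> n \<and> y \<in> \<Gamma> n}"

lemma differences_zero: "0 \<in> differences"
  using zero_mem unfolding differences_def by force

lemma differences_add: "a \<in> differences \<Longrightarrow> b \<in> differences \<Longrightarrow> a + b \<in> differences"
proof -
  assume "a \<in> differences" "b \<in> differences"
  then obtain x y m x' y' n where *: "x \<in> \<Gamma> m" "y \<in> \<Gamma> m" "a = x - y" "x' \<in> \<Gamma> n" "y' \<in> \<Gamma> n" "b = x' - y'"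
    unfolding differences_def by blast
  have "x + x' \<in> \<Gamma> (m + n)" "y + y' \<in> \<Gamma> (m + n)" using * add_mem by auto
  moreover have "a + b = (x + x') - (y + y')" using * by simp
  ultimately show ?thesis unfolding differences_def by blast
qed

lemma differences_uminus: "a \<in> differences \<Longrightarrow> - a \<in> differences"
  unfolding differences_def by clarsimp (metis minus_diff_eq)

lemma differences_diff: "a \<in> differences \<Longrightarrow> b \<in> differences \<Longrightarrow> a - b \<in> differences"
  using differences_add[of a "- b"] differences_uminus by simp

lemma differences_supp: "a \<in> differences \<Longrightarrow> i \<notin> I \<Longrightarrow> a i = 0"
  by (auto simp: differences_def dest!: supp[of _ _ i])

lemma differences_multiple: "a \<in> differences \<Longrightarrow> (\<lambda>i. int j * a i) \<in> differences"
proof (induction j)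
  case 0
  then show ?case using differences_zero by (simp add: zero_fun_def)
next
  case (Suc j)
  then have "a + (\<lambda>i. int j * a i) \<in> differences" by (intro differences_add) auto
  moreover have "a + (\<lambda>i. int j * a i) = (\<lambda>i. int (Suc j) * a i)" by (rule ext) (simp add: algebra_simps)
  ultimately show ?case by simp
qed

text \<open>If the group contains \<open>N\<close> times each basis vector, it contains \<open>N \<int>\<^sup>I\<close> and so has finite index.\<close>

lemma steps_imp_multiples:
  assumes step: "\<And>i. i \<in> I \<Longrightarrow> (\<lambda>j. if j = i then int N else 0) \<in> differences"
    and z: "\<And>i. i \<notin> I \<Longrightarrow> z i = 0"
  shows "(\<lambda>i. int N * z i) \<in> differences"
proof -
  have single: "(\<lambda>j. if j = i then int N * a else 0) \<in> differences" if i: "i \<in> I" for i and a :: int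
  proof (cases "a \<ge> 0")
    case True
    have "(\<lambda>j. int (nat a) * (if j = i then int N else 0)) \<in> differences"
      using step[OF i] by (rule differences_multiple)
    moreover have "(\<lambda>j. int (nat a) * (if j = i then int N else 0)) = (\<lambda>j. if j = i then int N * a else 0)"
      using True by (intro ext) simp
    ultimately show ?thesis by simp
  next
    case False
    have "- (\<lambda>j. int (nat (- a)) * (if j = i then int N else 0)) \<in> differences"
      using step[OF i] by (intro differences_uminus differences_multiple)
    moreover have "- (\<lambda>j. int (nat (- a)) * (if j = i then int N else 0)) = (\<lambda>j. if j = i then int N * a else 0)"
      using False by (intro ext) simp
    ultimately show ?thesis by simp
  qed
  have "finite J \<Longrightarrow> J \<subseteq> I \<Longrightarrow> (\<lambda>i. if i \<in> J then int N * z i else 0) \<in> differences" for J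
  proof (induction J rule: finite_induct)
    case empty
    then show ?case using differences_zero by (simp add: zero_fun_def)
  next
    case (insert i J)
    then have "(\<lambda>j. if j = i then int N * z i else 0) + (\<lambda>i. if i \<in> J then int N * z i else 0) \<in> differences"
      by (intro differences_add single) auto
    moreover have "(\<lambda>j. if j = i then int N * z i else 0) + (\<lambda>i. if i \<in> J then int N * z i else 0)
        = (\<lambda>j. if j \<in> insert i J then int N * z j else 0)"
      using insert(2) by (intro ext) auto
    ultimately show ?case by simp
  qed
  from this[OF finite_I] have "(\<lambda>i. if i \<in> I then int N * z i else 0) \<in> differences" by simp
  moreover have "(\<lambda>i. if i \<in> I then int N * z i else 0) = (\<lambda>i. int N * z i)"
    using z by (intro ext) simp
  ultimately show ?thesis by simp
qed

definition coset_rep :: "('i \<Rightarrow> int) \<Rightarrow> 'i \<Rightarrow> int" where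
  "coset_rep z = (SOME c. (\<forall>i. i \<notin> I \<longrightarrow> c i = 0) \<and> z - c \<in> differences)"

definition coset_reps :: "('i \<Rightarrow> int) set" where
  "coset_reps = coset_rep ` {z. \<forall>i. i \<notin> I \<longrightarrow> z i = 0}"

lemma coset_rep:
  assumes "\<And>i. i \<notin> I \<Longrightarrow> z i = 0"
  shows "i \<notin> I \<Longrightarrow> coset_rep z i = 0" "z - coset_rep z \<in> differences"
proof -
  have "(\<forall>i. i \<notin> I \<longrightarrow> coset_rep z i = 0) \<and> z - coset_rep z \<in> differences"
    unfolding coset_rep_def by (rule someI[of _ z]) (use assms differences_zero in \<open>simp add: zero_fun_def\<close>)
  then show "i \<notin> I \<Longrightarrow> coset_rep z i = 0" "z - coset_rep z \<in> differences" by auto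
qed

lemma coset_rep_eq: assumes "z - w \<in> differences" shows "coset_rep z = coset_rep w"
proof -
  have "z - c \<in> differences \<longleftrightarrow> w - c \<in> differences" for c
    using differences_diff[OF _ assms, of "z - c"] differences_add[OF _ assms, of "w - c"] by auto
  then show ?thesis unfolding coset_rep_def by simp
qed

end

text \<open>Semigroups for which the counting is governed by the cone: the group of differences has finite index
  in \<open>\<int>\<^sup>I\<close>, consecutive degrees occur, and every element is itself a difference of two elements of
  equal degree, so that \<open>\<Gamma>\<close> lies in that group.\<close>

locale full_semigroup = bounded_semigroup I \<Gamma> C
  for I :: "'i set" and \<Gamma> C +
  fixes N :: nat
  assumes N_pos: "N \<ge> 1"
    and step: "i \<in> I \<Longrightarrow> (\<lambda>j. if j = i then int N else 0) \<in> differences"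
    and levels: "\<exists>s. \<Gamma> s \<noteq> {} \<and> \<Gamma> (Suc s) \<noteq> {}"
    and in_differences: "z \<in> \<Gamma> n \<Longrightarrow> z \<in> differences"
begin

lemma multiples: "(\<And>i. i \<notin> I \<Longrightarrow> z i = 0) \<Longrightarrow> (\<lambda>i. int N * z i) \<in> differences"
  using steps_imp_multiples step by blast

lemma mod_N_difference:
  assumes "\<And>i. i \<notin> I \<Longrightarrow> z i = 0"
  shows "z - (\<lambda>i. z i mod int N) \<in> differences"
proof -
  have "(\<lambda>i. int N * (z i div int N)) \<in> differences" using assms by (intro multiples) simp
  moreover have "(\<lambda>i. int N * (z i div int N)) = z - (\<lambda>i. z i mod int N)"
    by (intro ext) (simp add: minus_mod_eq_mult_div)
  ultimately show ?thesis by simp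
qed

lemma finite_coset_reps: "finite coset_reps"
proof (rule finite_subset)
  show "coset_reps \<subseteq> coset_rep ` funs_into I (\<lambda>_. {0..<int N})"
  proof
    fix c assume "c \<in> coset_reps"
    then obtain z where z: "\<And>i. i \<notin> I \<Longrightarrow> z i = 0" "c = coset_rep z" by (auto simp: coset_reps_def)
    have "c = coset_rep (\<lambda>i. z i mod int N)" using coset_rep_eq mod_N_difference z by blast
    moreover have "(\<lambda>i. z i mod int N) \<in> funs_into I (\<lambda>_. {0..<int N})"
      using z N_pos by (auto simp: funs_into_def)
    ultimately show "c \<in> coset_rep ` funs_into I (\<lambda>_. {0..<int N})" by blast
  qed
  show "finite (coset_rep ` funs_into I (\<lambda>_. {0..<int N}))"
    using finite_I by (intro finite_imageI card_funs_into) auto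
qed

lemma card_coset_reps_pos: "card coset_reps > 0"
proof -
  have "coset_rep 0 \<in> coset_reps" by (auto simp: coset_reps_def)
  then show ?thesis using finite_coset_reps by (auto simp: card_gt_0_iff)
qed

lemma coset_reps_supp: "c \<in> coset_reps \<Longrightarrow> i \<notin> I \<Longrightarrow> c i = 0"
  using coset_rep(1) by (auto simp: coset_reps_def)

lemma in_coset_iff:
  assumes "\<And>i. i \<notin> I \<Longrightarrow> z i = 0" "c \<in> coset_reps"
  shows "z - c \<in> differences \<longleftrightarrow> c = coset_rep z"
proof
  obtain w where w: "\<And>i. i \<notin> I \<Longrightarrow> w i = 0" "c = coset_rep w" using assms(2) by (auto simp: coset_reps_def)
  assume "z - c \<in> differences"
  then have "coset_rep z = coset_rep c" by (rule coset_rep_eq)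
  also have "\<dots> = coset_rep w"
  proof -
    have "w - c \<in> differences" using coset_rep(2)[of w] w by simp
    then show ?thesis using coset_rep_eq[of w c] by simp
  qed
  finally show "c = coset_rep z" using w by simp
next
  assume "c = coset_rep z"
  then show "z - c \<in> differences" using coset_rep(2) assms(1) by simp
qed

text \<open>The part of the saturation that \<open>\<Gamma>\<close> can fill.\<close>

definition lattice_sat :: "nat \<Rightarrow> ('i \<Rightarrow> int) set" where
  "lattice_sat n = sat n \<inter> differences"

lemma finite_lattice_sat [simp]: "finite (lattice_sat n)"
  by (simp add: lattice_sat_def)

lemma card_sat_cosets: "card (sat n) = (\<Sum>c\<in>coset_reps. card {z \<in> sat n. z - c \<in> differences})"
proof -
  have "sat n = (\<Union>c\<in>coset_reps. {z \<in> sat n. z - c \<in> differences})"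
  proof (intro equalityI subsetI)
    fix z assume z: "z \<in> sat n"
    then have "coset_rep z \<in> coset_reps" using sat_supp by (auto simp: coset_reps_def)
    moreover have "z - coset_rep z \<in> differences" using z sat_supp coset_rep(2) by blast
    ultimately show "z \<in> (\<Union>c\<in>coset_reps. {z \<in> sat n. z - c \<in> differences})" using z by blast
  qed auto
  also have "card \<dots> = (\<Sum>c\<in>coset_reps. card {z \<in> sat n. z - c \<in> differences})"
  proof (rule card_UN_disjoint[OF finite_coset_reps])
    show "\<forall>c\<in>coset_reps. \<forall>c'\<in>coset_reps. c \<noteq> c' \<longrightarrow> {z \<in> sat n. z - c \<in> differences} \<inter> {z \<in> sat n. z - c' \<in> differences} = {}"
      using in_coset_iff sat_supp by blast
  qed auto
  finally show ?thesis .
qed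

text \<open>Translation by a coset representative is a bijection between two cosets up to points near the
  boundary, so all cosets meet a level of the saturation equally often up to lower order.\<close>

lemma coset_equidistribution:
  obtains K :: real where "K \<ge> 0"
    "\<And>n. n \<ge> 1 \<Longrightarrow> \<bar>real (card coset_reps) * real (card (lattice_sat n)) - real (card (sat n))\<bar> \<le> boundary_term K n"
proof -
  define bd where "bd c n = real (card {x \<in> sat n. x + c \<notin> sat n})" for c n
  have bd: "\<exists>K::real. K \<ge> 0 \<and> (\<forall>n\<ge>1. bd c n \<le> boundary_term K n)"
    if "\<And>i. i \<notin> I \<Longrightarrow> c i = 0" for c
    unfolding bd_def by (rule line_boundary_count[of c, OF that]) blast+
  have "\<exists>K::real. K \<ge> 0 \<and> (\<forall>n\<ge>1. bd c n + bd (- c) n \<le> boundary_term K n)"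
    if c: "c \<in> coset_reps" for c
  proof -
    obtain K where K: "K \<ge> 0" "\<And>n. n \<ge> 1 \<Longrightarrow> bd c n \<le> boundary_term K n"
      using bd[of c] coset_reps_supp[OF c] by blast
    obtain K' where K': "K' \<ge> 0" "\<And>n. n \<ge> 1 \<Longrightarrow> bd (- c) n \<le> boundary_term K' n"
      using bd[of "- c"] coset_reps_supp[OF c] by auto
    show ?thesis
    proof (intro exI conjI allI impI)
      show "K + K' \<ge> 0" using K K' by simp
      fix n :: nat assume "n \<ge> 1"
      then show "bd c n + bd (- c) n \<le> boundary_term (K + K') n"
        using K(2)[of n] K'(2)[of n] by (simp add: algebra_simps)
    qed
  qed
  then have "\<forall>c\<in>coset_reps. \<exists>K::real. K \<ge> 0 \<and> (\<forall>n\<ge>1. bd c n + bd (- c) n \<le> boundary_term K n)"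
    by blast
  from bchoice[OF this] obtain K where K: "\<forall>c\<in>coset_reps. K c \<ge> 0 \<and> (\<forall>n\<ge>1. bd c n + bd (- c) n \<le> boundary_term (K c) n)"
    by (rule exE)
  show ?thesis
  proof (rule that[of "\<Sum>c\<in>coset_reps. K c"])
    show "(\<Sum>c\<in>coset_reps. K c) \<ge> 0" using K by (intro sum_nonneg) auto
    fix n :: nat assume n: "n \<ge> 1"
    have one: "\<bar>real (card (lattice_sat n)) - real (card {z \<in> sat n. z - c \<in> differences})\<bar> \<le> boundary_term (K c) n"
      if c: "c \<in> coset_reps" for c
    proof -
      define Z where "Z = {z \<in> sat n. z - c \<in> differences}"
      have "card (lattice_sat n) \<le> card ((\<lambda>z. z - c) ` Z \<union> {x \<in> sat n. x + c \<notin> sat n})"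
      proof (rule card_mono)
        show "lattice_sat n \<subseteq> (\<lambda>z. z - c) ` Z \<union> {x \<in> sat n. x + c \<notin> sat n}"
        proof
          fix x assume x: "x \<in> lattice_sat n"
          show "x \<in> (\<lambda>z. z - c) ` Z \<union> {x \<in> sat n. x + c \<notin> sat n}"
          proof (cases "x + c \<in> sat n")
            case True
            then have "x + c \<in> Z" "x = (x + c) - c" using x by (auto simp: Z_def lattice_sat_def)
            then show ?thesis by blast
          qed (use x in \<open>auto simp: lattice_sat_def\<close>)
        qed
      qed (simp add: Z_def)
      also have "\<dots> \<le> card ((\<lambda>z. z - c) ` Z) + card {x \<in> sat n. x + c \<notin> sat n}" by (rule card_Un_le)
      also have "\<dots> \<le> card Z + card {x \<in> sat n. x + c \<notin> sat n}"
        by (intro add_right_mono card_image_le) (simp add: Z_def)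
      finally have 1: "real (card (lattice_sat n)) \<le> real (card Z) + bd c n" unfolding bd_def by linarith
      have "card Z \<le> card ((\<lambda>z. z + c) ` lattice_sat n \<union> {x \<in> sat n. x + - c \<notin> sat n})"
      proof (rule card_mono)
        show "Z \<subseteq> (\<lambda>z. z + c) ` lattice_sat n \<union> {x \<in> sat n. x + - c \<notin> sat n}"
        proof
          fix x assume x: "x \<in> Z"
          show "x \<in> (\<lambda>z. z + c) ` lattice_sat n \<union> {x \<in> sat n. x + - c \<notin> sat n}"
          proof (cases "x + - c \<in> sat n")
            case True
            then have "x - c \<in> lattice_sat n" "x = (x - c) + c" using x by (auto simp: Z_def lattice_sat_def)
            then show ?thesis by blast
          qed (use x in \<open>auto simp: Z_def\<close>)
        qed
      qed simp
      also have "\<dots> \<le> card ((\<lambda>z. z + c) ` lattice_sat n) + card {x \<in> sat n. x + - c \<notin> sat n}" by (rule card_Un_le)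
      also have "\<dots> \<le> card (lattice_sat n) + card {x \<in> sat n. x + - c \<notin> sat n}"
        by (intro add_right_mono card_image_le) simp
      finally have 2: "real (card Z) \<le> real (card (lattice_sat n)) + bd (- c) n" unfolding bd_def by linarith
      have "bd c n \<ge> 0" "bd (- c) n \<ge> 0" by (auto simp: bd_def)
      then have "\<bar>real (card (lattice_sat n)) - real (card Z)\<bar> \<le> bd c n + bd (- c) n" using 1 2 by linarith
      also have "\<dots> \<le> boundary_term (K c) n" using K c n by blast
      finally show ?thesis by (simp add: Z_def)
    qed
    have "real (card coset_reps) * real (card (lattice_sat n)) - real (card (sat n)) =
        (\<Sum>c\<in>coset_reps. real (card (lattice_sat n)) - real (card {z \<in> sat n. z - c \<in> differences}))"
      by (simp add: card_sat_cosets sum_subtractf)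
    also have "\<bar>\<dots>\<bar> \<le> (\<Sum>c\<in>coset_reps. boundary_term (K c) n)"
      using one by (intro order_trans[OF sum_abs] sum_mono) auto
    also have "\<dots> = boundary_term (\<Sum>c\<in>coset_reps. K c) n"
      by (simp add: sum_distrib_left sum_distrib_right)
    finally show "\<bar>real (card coset_reps) * real (card (lattice_sat n)) - real (card (sat n))\<bar> \<le> boundary_term (\<Sum>c\<in>coset_reps. K c) n" .
  qed
qed

text \<open>Summing differences \<open>N e\<^sub>i = x\<^sub>i - y\<^sub>i\<close> over all \<open>i\<close>, one level contains the vertices of a cube of side \<open>N\<close>.\<close>

lemma cube_in_level:
  assumes "finite J" "J \<subseteq> I"
  shows "\<exists>n y. \<forall>E\<subseteq>J. y + (\<lambda>i. int N * of_bool (i \<in> E)) \<in> \<Gamma> n"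
  using assms
proof (induction J rule: finite_induct)
  case empty
  have eq: "0 + (\<lambda>i. int N * of_bool (i \<in> {})) = 0" by (rule ext) simp
  have "0 + (\<lambda>i. int N * of_bool (i \<in> {})) \<in> \<Gamma> 0" unfolding eq by (rule zero_mem)
  then show ?case by (intro exI[of _ 0] allI impI) (simp only: subset_empty)
next
  case (insert i J)
  then obtain n y where y: "\<And>E. E \<subseteq> J \<Longrightarrow> y + (\<lambda>i. int N * of_bool (i \<in> E)) \<in> \<Gamma> n" by blast
  obtain u v m where uv: "u \<in> \<Gamma> m" "v \<in> \<Gamma> m" "(\<lambda>j. if j = i then int N else 0) = u - v"
    using step[of i] insert.prems by (auto simp: differences_def)
  show ?case
  proof (intro exI allI impI)
    fix E assume E: "E \<subseteq> insert i J"
    show "y + v + (\<lambda>i. int N * of_bool (i \<in> E)) \<in> \<Gamma> (n + m)"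
    proof (cases "i \<in> E")
      case True
      have "(y + (\<lambda>j. int N * of_bool (j \<in> E - {i}))) + u \<in> \<Gamma> (n + m)"
        using y[of "E - {i}"] E uv by (intro add_mem) auto
      moreover have "(y + (\<lambda>j. int N * of_bool (j \<in> E - {i}))) + u = y + v + (\<lambda>i. int N * of_bool (i \<in> E))"
      proof
        fix j
        have "u j = v j + (if j = i then int N else 0)" using fun_cong[OF uv(3), of j] by simp
        then show "((y + (\<lambda>j. int N * of_bool (j \<in> E - {i}))) + u) j = (y + v + (\<lambda>i. int N * of_bool (i \<in> E))) j"
          using True by simp
      qed
      ultimately show ?thesis by (simp only:)
    next
      case False
      have "(y + (\<lambda>j. int N * of_bool (j \<in> E))) + v \<in> \<Gamma> (n + m)"
        using y[of E] E False uv by (intro add_mem) auto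
      then show ?thesis by (simp add: ac_simps)
    qed
  qed
qed

lemma density_pos: "density > 0"
proof -
  obtain n y where y: "\<And>E. E \<subseteq> I \<Longrightarrow> y + (\<lambda>i. int N * of_bool (i \<in> E)) \<in> \<Gamma> n"
    using cube_in_level[OF finite_I order.refl] by blast
  obtain s g where g: "g \<in> \<Gamma> (Suc s)" using levels by blast
  have "y + g \<in> interior (n + Suc s)"
    unfolding interior_def
  proof (intro CollectI allI impI)
    fix E assume E: "E \<subseteq> I"
    have mem: "(y + (\<lambda>i. int N * of_bool (i \<in> E'))) + g \<in> sat (n + Suc s)" if "E' \<subseteq> I" for E'
      using add_mem[OF y[OF that] g] subset_sat by blast
    have "(y + (\<lambda>i. int N * of_bool (i \<in> {}))) + g = y + g" by (rule ext) simp
    then have 1: "y + g \<in> sat (n + Suc s)" using mem[of "{}"] by simp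
    have "(y + (\<lambda>i. int N * of_bool (i \<in> E))) + g = (\<lambda>i. (y + g) i + int N * of_bool (i \<in> E))"
      by (rule ext) simp
    then have 2: "(\<lambda>i. (y + g) i + int N * of_bool (i \<in> E)) \<in> sat (n + Suc s)" using mem[OF E] by simp
    have "(\<lambda>i. (y + g) i + int 1 * of_bool (i \<in> E)) \<in> sat (n + Suc s)"
      by (rule sat_between[OF 1 2 N_pos])
    moreover have "(\<lambda>i. (y + g) i + int 1 * of_bool (i \<in> E)) = (y + g) + (\<lambda>i. of_bool (i \<in> E))"
      by (rule ext) simp
    ultimately show "(y + g) + (\<lambda>i. of_bool (i \<in> E)) \<in> sat (n + Suc s)" by simp
  qed
  then have "card (interior (n + Suc s)) > 0" by (auto simp: card_gt_0_iff)
  then have "0 < real (card (interior (n + Suc s)))" by simp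
  also have "\<dots> \<le> density * real (n + Suc s) ^ card I" by (rule interior_le_density) simp
  finally show ?thesis by (simp add: zero_less_mult_iff)
qed

text \<open>The bound holds in every degree, not only asymptotically: \<open>\<Gamma> n\<close> lies in one of the equally filled cosets of
  the saturation, and the saturation differs from its interior by a boundary of lower order.\<close>

theorem card_level_le:
  obtains K :: real where "K \<ge> 0" "\<And>n. n \<ge> 1 \<Longrightarrow> real (card (\<Gamma> n)) \<le>
      density / real (card coset_reps) * real n ^ card I + boundary_term K n"
proof -
  obtain K1 where K1: "K1 \<ge> 0" "\<And>n. n \<ge> 1 \<Longrightarrow> real (card (sat n)) \<le> real (card (interior n)) + boundary_term K1 n"
    using card_sat_interior by blast
  obtain K2 where K2: "K2 \<ge> 0" "\<And>n. n \<ge> 1 \<Longrightarrow> \<bar>real (card coset_reps) * real (card (lattice_sat n)) - real (card (sat n))\<bar> \<le> boundary_term K2 n"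
    using coset_equidistribution by blast
  define q where "q = real (card coset_reps)"
  have q: "q > 0" using card_coset_reps_pos by (simp add: q_def)
  show ?thesis
  proof (rule that[of "(K1 + K2) / q"])
    show "(K1 + K2) / q \<ge> 0" using K1 K2 q by simp
    fix n :: nat assume n: "n \<ge> 1"
    have "card (\<Gamma> n) \<le> card (lattice_sat n)"
      using subset_sat in_differences by (intro card_mono) (auto simp: lattice_sat_def)
    then have "q * real (card (\<Gamma> n)) \<le> q * real (card (lattice_sat n))" using q by simp
    also have "\<dots> \<le> real (card (sat n)) + boundary_term K2 n"
      using K2(2)[OF n] by (simp add: q_def abs_le_iff)
    also have "\<dots> \<le> density * real n ^ card I + boundary_term (K1 + K2) n"
      using K1(2)[OF n] interior_le_density[OF n] by (simp add: algebra_simps)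
    finally have *: "real (card (\<Gamma> n)) \<le> (density * real n ^ card I + boundary_term (K1 + K2) n) / q"
      using q by (simp add: field_simps)
    have "(a * x + b * k * y) / q = a / q * x + b * (k / q) * y" for a b k x y :: real
      by (simp add: add_divide_distrib)
    with * show "real (card (\<Gamma> n)) \<le> density / real (card coset_reps) * real n ^ card I + boundary_term ((K1 + K2) / q) n"
      by (simp only: q_def[symmetric])
  qed
qed

end

definition generated :: "(nat \<times> ('i \<Rightarrow> int)) set \<Rightarrow> nat \<Rightarrow> ('i \<Rightarrow> int) set" where
  "generated F n = {z. \<exists>a. n = (\<Sum>g\<in>F. a g * fst g) \<and> z = (\<lambda>i. \<Sum>g\<in>F. int (a g) * snd g i)}"

lemma generated_generator:
  assumes "finite F" "(l, z) \<in> F" shows "z \<in> generated F l"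
proof -
  define a :: "nat \<times> ('a \<Rightarrow> int) \<Rightarrow> nat" where "a g = of_bool (g = (l, z))" for g
  have "(\<Sum>g\<in>F. a g * fst g) = (\<Sum>g\<in>F. if g = (l, z) then fst g else 0)"
    by (intro sum.cong) (auto simp: a_def)
  moreover have "(\<Sum>g\<in>F. int (a g) * snd g i) = (\<Sum>g\<in>F. if g = (l, z) then snd g i else 0)" for i
    by (intro sum.cong) (auto simp: a_def)
  ultimately show ?thesis
    using assms by (auto simp: generated_def intro!: exI[of _ a])
qed

lemma generated_zero: "0 \<in> generated F 0"
  by (auto simp: generated_def zero_fun_def intro!: exI[of _ "\<lambda>_. 0"])

lemma generated_add:
  assumes "x \<in> generated F m" "y \<in> generated F n" shows "x + y \<in> generated F (m + n)"
proof -
  obtain a b where "m = (\<Sum>g\<in>F. a g * fst g)" "x = (\<lambda>i. \<Sum>g\<in>F. int (a g) * snd g i)"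
    "n = (\<Sum>g\<in>F. b g * fst g)" "y = (\<lambda>i. \<Sum>g\<in>F. int (b g) * snd g i)"
    using assms unfolding generated_def by blast
  then have "m + n = (\<Sum>g\<in>F. (a g + b g) * fst g)"
    "x + y = (\<lambda>i. \<Sum>g\<in>F. int (a g + b g) * snd g i)"
    by (auto simp: sum.distrib algebra_simps fun_eq_iff)
  then show ?thesis unfolding generated_def by (intro CollectI exI[of _ "\<lambda>g. a g + b g"]) auto
qed

lemma (in bounded_semigroup) generated_subset:
  assumes "finite F" "\<And>l z. (l, z) \<in> F \<Longrightarrow> z \<in> G l"
    "0 \<in> G 0" "\<And>x y m n. x \<in> G m \<Longrightarrow> y \<in> G n \<Longrightarrow> x + y \<in> G (m + n)" "\<And>n. G n \<subseteq> \<Gamma> n"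
  shows "generated F n \<subseteq> G n"
proof
  interpret G: bounded_semigroup I G C
    using assms(3-) supp bound finite_I by unfold_locales blast+
  fix z assume "z \<in> generated F n"
  then obtain a where n: "n = (\<Sum>g\<in>F. a g * fst g)" and z: "z = (\<lambda>i. \<Sum>g\<in>F. int (a g) * snd g i)"
    unfolding generated_def by blast
  have "(\<lambda>i. \<Sum>g\<in>F. int (a g) * snd g i) \<in> G (\<Sum>g\<in>F. a g * fst g)"
    using assms(1,2)
  proof (induction F rule: finite_induct)
    case empty
    then show ?case using assms(3) by (simp add: zero_fun_def)
  next
    case (insert g F)
    have "snd g \<in> G (fst g)" using insert(4)[of "fst g" "snd g"] by simp
    then have "(\<lambda>i. int (a g) * snd g i) + (\<lambda>i. \<Sum>g\<in>F. int (a g) * snd g i) \<in> G (a g * fst g + (\<Sum>g\<in>F. a g * fst g))"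
      using insert by (intro assms(4) G.multiple_mem) auto
    moreover have "(\<lambda>i. int (a g) * snd g i) + (\<lambda>i. \<Sum>g\<in>F. int (a g) * snd g i) = (\<lambda>i. \<Sum>g\<in>insert g F. int (a g) * snd g i)"
      using insert(1,2) by (intro ext) simp
    ultimately show ?case using insert(1,2) by simp
  qed
  then show "z \<in> G n" using n z by simp
qed

lemma (in full_semigroup) translate_into:
  assumes w: "w \<in> differences"
  shows "\<exists>n. \<exists>\<gamma>\<in>\<Gamma> n. \<gamma> + w \<in> \<Gamma> (n + r)"
proof -
  obtain s p q where pq: "q \<in> \<Gamma> s" "p \<in> \<Gamma> (Suc s)" using levels by blast
  have "p - q \<in> differences" using pq in_differences differences_diff by blast
  then have "w - (\<lambda>i. int r * (p - q) i) \<in> differences" using w differences_diff differences_multiple by blast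
  then obtain x y m where xy: "x \<in> \<Gamma> m" "y \<in> \<Gamma> m" "w - (\<lambda>i. int r * (p - q) i) = x - y"
    unfolding differences_def by blast
  have 1: "y + (\<lambda>i. int r * q i) \<in> \<Gamma> (m + r * s)" using xy multiple_mem[OF pq(1)] by (intro add_mem)
  have "x + (\<lambda>i. int r * p i) \<in> \<Gamma> (m + r * Suc s)" using xy multiple_mem[OF pq(2)] by (intro add_mem)
  moreover have "x + (\<lambda>i. int r * p i) = (y + (\<lambda>i. int r * q i)) + w"
  proof
    fix i
    have "w i - int r * (p i - q i) = x i - y i" using fun_cong[OF xy(3), of i] by simp
    then show "(x + (\<lambda>i. int r * p i)) i = ((y + (\<lambda>i. int r * q i)) + w) i" by (simp add: algebra_simps)
  qed
  ultimately have "(y + (\<lambda>i. int r * q i)) + w \<in> \<Gamma> ((m + r * s) + r)" by (simp add: ac_simps)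
  with 1 show ?thesis by blast
qed

lemma (in full_semigroup) translate_finite_into:
  assumes "finite Q" "\<And>r w. (r, w) \<in> Q \<Longrightarrow> w \<in> differences"
  shows "\<exists>n. \<exists>\<gamma>\<in>\<Gamma> n. \<forall>(r, w)\<in>Q. \<gamma> + w \<in> \<Gamma> (n + r)"
  using assms
proof (induction Q rule: finite_induct)
  case empty
  then show ?case using zero_mem by auto
next
  case (insert q Q)
  then obtain n \<gamma> where 1: "\<gamma> \<in> \<Gamma> n" "\<And>r w. (r, w) \<in> Q \<Longrightarrow> \<gamma> + w \<in> \<Gamma> (n + r)" by blast
  obtain r w where q: "q = (r, w)" by (cases q)
  then have "w \<in> differences" using insert.prems[of r w] by simp
  from translate_into[OF this, of r] obtain m \<delta> where 2: "\<delta> \<in> \<Gamma> m" "\<delta> + w \<in> \<Gamma> (m + r)" by (elim exE bexE)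
  have "\<gamma> + \<delta> \<in> \<Gamma> (n + m)" using 1 2 add_mem by blast
  moreover have "\<forall>(r, w)\<in>insert q Q. \<gamma> + \<delta> + w \<in> \<Gamma> (n + m + r)"
  proof (clarify)
    fix r' w' assume "(r', w') \<in> insert q Q"
    then consider "r' = r" "w' = w" | "(r', w') \<in> Q" using q by auto
    then show "\<gamma> + \<delta> + w' \<in> \<Gamma> (n + m + r')"
    proof cases
      case a: 1
      show ?thesis using add_mem[OF 1(1) 2(2)] unfolding a by (simp only: ac_simps)
    next
      case a: 2
      show ?thesis using add_mem[OF 1(2)[OF a] 2(1)] by (simp only: ac_simps)
    qed
  qed
  ultimately show ?case by blast
qed

text \<open>Division with remainder: a lattice point of the cone is a combination of generators with coefficients
  \<open>a / j\<close>. Its integral part lies in the semigroup, and the remainder is one of finitely many lattice points.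
  A single element can be chosen that translates all of these into the semigroup.\<close>

lemma (in full_semigroup) conductor:
  assumes F: "finite F" and gen: "\<And>n. \<Gamma> n = generated F n"
  shows "\<exists>n0. \<forall>k. card (lattice_sat k) \<le> card (\<Gamma> (k + n0))"
proof -
  define M where "M = (\<Sum>g\<in>F. fst g)"
  define B where "B = C * M"
  define Q where "Q = {..M} \<times> (funs_into I (\<lambda>_. {- int B..int B}) \<inter> differences)"
  have "finite Q" unfolding Q_def using finite_I by (intro finite_cartesian_product finite_Int disjI1 card_funs_into) auto
  then obtain n0 \<gamma> where g: "\<gamma> \<in> \<Gamma> n0" "\<And>r w. (r, w) \<in> Q \<Longrightarrow> \<gamma> + w \<in> \<Gamma> (n0 + r)"
    using translate_finite_into[of Q] unfolding Q_def by blast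
  have shift: "z + \<gamma> \<in> \<Gamma> (k + n0)" if z: "z \<in> lattice_sat k" for z k
  proof -
    obtain j where j: "j \<ge> 1" "(\<lambda>i. int j * z i) \<in> \<Gamma> (j * k)"
      using z unfolding lattice_sat_def sat_def by blast
    then obtain a where a1: "j * k = (\<Sum>g\<in>F. a g * fst g)"
      and "(\<lambda>i. int j * z i) = (\<lambda>i. \<Sum>g\<in>F. int (a g) * snd g i)"
      unfolding gen generated_def by blast
    then have a2: "int j * z i = (\<Sum>g\<in>F. int (a g) * snd g i)" for i by meson
    define l where "l = (\<Sum>g\<in>F. (a g div j) * fst g)"
    define b where "b = (\<lambda>i. \<Sum>g\<in>F. int (a g div j) * snd g i)"
    have b: "b \<in> \<Gamma> l" unfolding gen generated_def b_def l_def by (intro CollectI exI[of _ "\<lambda>g. a g div j"] conjI refl)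
    have "(\<Sum>g\<in>F. a g * fst g) = (\<Sum>g\<in>F. j * ((a g div j) * fst g) + (a g mod j) * fst g)"
      by (intro sum.cong refl) (metis add_mult_distrib div_mult_mod_eq mult.assoc mult.commute)
    then have 1: "j * k = j * l + (\<Sum>g\<in>F. (a g mod j) * fst g)"
      unfolding a1 by (simp add: sum.distrib l_def sum_distrib_left)
    then have "j * l \<le> j * k" by simp
    then have lk: "l \<le> k" using j by simp
    have "(\<Sum>g\<in>F. (a g mod j) * fst g) \<le> (\<Sum>g\<in>F. j * fst g)"
      using j by (intro sum_mono mult_right_mono) (auto simp: less_imp_le)
    also have "\<dots> = j * M" by (simp add: M_def sum_distrib_left)
    finally have "j * k \<le> j * (l + M)" using 1 by (simp add: algebra_simps)
    then have kM: "k - l \<le> M" using j lk by simp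
    have zb: "int j * (z - b) i = (\<Sum>g\<in>F. int (a g mod j) * snd g i)" for i
    proof -
      have "int (a g) * snd g i = int j * (int (a g div j) * snd g i) + int (a g mod j) * snd g i" for g
      proof -
        have "int (a g) = int j * int (a g div j) + int (a g mod j)"
          by (metis mult_div_mod_eq of_nat_add of_nat_mult)
        then show ?thesis by (simp add: algebra_simps)
      qed
      then have "int j * z i = int j * b i + (\<Sum>g\<in>F. int (a g mod j) * snd g i)"
        unfolding a2 b_def by (simp add: sum.distrib sum_distrib_left)
      then show ?thesis by (simp add: algebra_simps)
    qed
    have "\<bar>(z - b) i\<bar> \<le> int B" for i
    proof -
      have "int j * \<bar>(z - b) i\<bar> = \<bar>\<Sum>g\<in>F. int (a g mod j) * snd g i\<bar>"
        using zb[of i] by (simp add: abs_mult flip: zb)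
      also have "\<dots> \<le> (\<Sum>g\<in>F. \<bar>int (a g mod j) * snd g i\<bar>)" by (rule sum_abs)
      also have "\<dots> \<le> (\<Sum>g\<in>F. int j * int (C * fst g))"
      proof (intro sum_mono)
        fix g assume "g \<in> F"
        then have "snd g \<in> \<Gamma> (fst g)" unfolding gen using generated_generator[OF F, of "fst g" "snd g"] by simp
        then have "\<bar>snd g i\<bar> \<le> int (C * fst g)" by (rule bound)
        moreover have "int (a g mod j) \<le> int j" using j by (simp add: less_imp_le)
        ultimately show "\<bar>int (a g mod j) * snd g i\<bar> \<le> int j * int (C * fst g)"
          unfolding abs_mult by (intro mult_mono) auto
      qed
      also have "\<dots> = int j * int B" by (simp add: B_def M_def sum_distrib_left)
      finally show ?thesis using j by (subst (asm) mult_le_cancel_left_pos) auto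
    qed
    moreover have "z - b \<in> differences"
      using z b in_differences differences_diff by (auto simp: lattice_sat_def)
    moreover have "(z - b) i = 0" if "i \<notin> I" for i
      using calculation(2) that by (rule differences_supp)
    ultimately have "(k - l, z - b) \<in> Q"
      using kM by (auto simp: Q_def funs_into_def abs_le_iff minus_le_iff)
    then have "\<gamma> + (z - b) \<in> \<Gamma> (n0 + (k - l))" by (rule g(2))
    from add_mem[OF b this] show ?thesis using lk by (simp add: ac_simps)
  qed
  show ?thesis
  proof (intro exI allI)
    fix k
    show "card (lattice_sat k) \<le> card (\<Gamma> (k + n0))"
      by (rule card_inj_on_le[of "\<lambda>z. z + \<gamma>"]) (use shift in \<open>auto intro: inj_onI\<close>)
  qed
qed

lemma finite_bounded_choice:
  assumes "finite X" "\<And>x. x \<in> X \<Longrightarrow> \<exists>l::nat. P x l"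
  shows "\<exists>m. \<forall>x\<in>X. \<exists>l\<le>m. P x l"
proof -
  have "\<forall>x\<in>X. \<exists>l. P x l" using assms(2) by blast
  from bchoice[OF this] obtain f where f: "\<forall>x\<in>X. P x (f x)" by (rule exE)
  have "\<forall>x\<in>X. \<exists>l\<le>Max (f ` X). P x l" using f assms(1) by (intro ballI) (metis Max_ge finite_imageI imageI)
  then show ?thesis by blast
qed

text \<open>Approximation from inside: pick a level \<open>n\<close> whose interior nearly attains the density. Finitely many
  elements suffice to witness that its points lie in the saturation and to generate the same group.
  The subsemigroup they generate then has nearly the same density, and since it is finitely generated
  its levels fill the lattice points of its cone up to a translation.\<close>

theorem (in full_semigroup) subsemigroup_growth:
  assumes "\<epsilon> > 0"
  shows "\<exists>M. \<forall>\<Gamma>'. 0 \<in> \<Gamma>' 0 \<and> (\<forall>m n. \<forall>x\<in>\<Gamma>' m. \<forall>y\<in>\<Gamma>' n. x + y \<in> \<Gamma>' (m + n)) \<and>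
     (\<forall>n. \<Gamma>' n \<subseteq> \<Gamma> n) \<and> (\<forall>n\<le>M. \<Gamma> n \<subseteq> \<Gamma>' n) \<longrightarrow>
     growth_at_least (card I) (\<lambda>n. real (card (\<Gamma>' n))) (density / real (card coset_reps) - \<epsilon>)"
proof -
  define q where "q = real (card coset_reps)"
  have q: "q > 0" using card_coset_reps_pos by (simp add: q_def)
  obtain n where n: "n \<ge> 1" "real (card (interior n)) / real n ^ card I > density - \<epsilon> * q"
    using density_approx[of "\<epsilon> * q"] assms q by auto
  obtain s where s: "\<Gamma> s \<noteq> {}" "\<Gamma> (Suc s) \<noteq> {}" using levels by blast
  define D where "D = (\<lambda>i j. if j = i then int N else 0) ` I \<union> (funs_into I (\<lambda>_. {0..<int N}) \<inter> differences)"
  have "finite D" unfolding D_def using finite_I by (intro finite_UnI finite_imageI finite_Int disjI1 card_funs_into) auto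
  then have "\<exists>m1. \<forall>h\<in>D. \<exists>l\<le>m1. \<exists>x\<in>\<Gamma> l. \<exists>y\<in>\<Gamma> l. h = x - y"
  proof (rule finite_bounded_choice)
    fix h assume "h \<in> D"
    then have "h \<in> differences" using step by (auto simp: D_def)
    then show "\<exists>l. \<exists>x\<in>\<Gamma> l. \<exists>y\<in>\<Gamma> l. h = x - y" unfolding differences_def by blast
  qed
  then obtain m1 where m1: "\<And>h. h \<in> D \<Longrightarrow> \<exists>l\<le>m1. \<exists>x\<in>\<Gamma> l. \<exists>y\<in>\<Gamma> l. h = x - y" by blast
  have "\<exists>m2. \<forall>z\<in>sat n. \<exists>j\<le>m2. j \<ge> 1 \<and> (\<lambda>i. int j * z i) \<in> \<Gamma> (j * n)"
    by (rule finite_bounded_choice[OF finite_sat]) (auto simp: sat_def)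
  then obtain m2 where m2: "\<And>z. z \<in> sat n \<Longrightarrow> \<exists>j\<le>m2. j \<ge> 1 \<and> (\<lambda>i. int j * z i) \<in> \<Gamma> (j * n)" by blast
  define m where "m = m1 + m2 * n + Suc s"
  define F where "F = (SIGMA l:{..m}. \<Gamma> l)"
  have F: "finite F" by (auto simp: F_def)
  have G_sub: "generated F k \<subseteq> \<Gamma> k" for k
    by (rule generated_subset[OF F]) (auto simp: F_def zero_mem add_mem)
  have G_sup: "\<Gamma> l \<subseteq> generated F l" if "l \<le> m" for l
    using that generated_generator[OF F] by (auto simp: F_def)
  interpret G: bounded_semigroup I "generated F" C
  proof
    fix z k i assume z: "z \<in> generated F k"
    then have "z \<in> \<Gamma> k" using G_sub by blast
    then show "i \<notin> I \<Longrightarrow> z i = 0" "\<bar>z i\<bar> \<le> int (C * k)" using supp bound by blast+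
  qed (use finite_I generated_zero generated_add in blast)+
  have D_G: "h \<in> G.differences" if h: "h \<in> D" for h
  proof -
    obtain l x y where l: "l \<le> m1" "x \<in> \<Gamma> l" "y \<in> \<Gamma> l" "h = x - y" using m1[OF h] by blast
    then have "l \<le> m" by (simp add: m_def)
    then show ?thesis using l G_sup unfolding G.differences_def by blast
  qed
  have diff_eq: "G.differences = differences"
  proof (intro equalityI subsetI)
    fix h assume "h \<in> G.differences"
    then show "h \<in> differences" using G_sub unfolding G.differences_def differences_def by blast
  next
    fix h assume h: "h \<in> differences"
    have supp_h: "h i = 0" if "i \<notin> I" for i using h that by (rule differences_supp)
    define r where "r = (\<lambda>i. h i mod int N)"
    have "h - r \<in> differences" unfolding r_def using supp_h by (rule mod_N_difference)
    then have "h - (h - r) \<in> differences" using h differences_diff by blast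
    then have "r \<in> differences" by simp
    moreover have "r \<in> funs_into I (\<lambda>_. {0..<int N})" using supp_h N_pos by (auto simp: r_def funs_into_def)
    ultimately have "r \<in> G.differences" by (intro D_G) (simp add: D_def)
    moreover have "(\<lambda>i. int N * (h i div int N)) \<in> G.differences"
      by (rule G.steps_imp_multiples) (use D_G supp_h in \<open>auto simp: D_def\<close>)
    moreover have "r + (\<lambda>i. int N * (h i div int N)) = h" by (rule ext) (simp add: r_def)
    ultimately show "h \<in> G.differences" using G.differences_add by metis
  qed
  interpret G: full_semigroup I "generated F" C N
  proof
    show "\<exists>s. generated F s \<noteq> {} \<and> generated F (Suc s) \<noteq> {}"
      using s G_sup[of s] G_sup[of "Suc s"] by (auto simp: m_def)
  qed (use N_pos step diff_eq G_sub in_differences in blast)+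
  have reps_eq: "G.coset_reps = coset_reps"
    unfolding G.coset_reps_def coset_reps_def G.coset_rep_def coset_rep_def diff_eq ..
  have "sat n \<subseteq> G.sat n"
  proof
    fix z assume z: "z \<in> sat n"
    then obtain j where j: "j \<le> m2" "j \<ge> 1" "(\<lambda>i. int j * z i) \<in> \<Gamma> (j * n)" using m2 by blast
    have "j * n \<le> m" using mult_le_mono1[OF j(1), of n] unfolding m_def by linarith
    then have "(\<lambda>i. int j * z i) \<in> generated F (j * n)" using G_sup j by blast
    then show "z \<in> G.sat n" unfolding G.sat_def using j sat_supp[OF z] by blast
  qed
  then have "interior n \<subseteq> G.interior n" unfolding interior_def G.interior_def by blast
  then have "card (interior n) \<le> card (G.interior n)" by (intro card_mono) auto
  then have "real (card (interior n)) / real n ^ card I \<le> real (card (G.interior n)) / real n ^ card I"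
    by (intro divide_right_mono) auto
  then have a: "density - \<epsilon> * q \<le> real (card (G.interior n)) / real n ^ card I" using n by linarith
  have ne: "generated F s \<noteq> {}" "generated F (Suc s) \<noteq> {}"
    using s G_sup[of s] G_sup[of "Suc s"] by (auto simp: m_def)
  have g1: "growth_at_least (card I) (\<lambda>k. real (card (G.sat k))) (density - \<epsilon> * q)"
    using growth_at_least_weaken[OF G.sat_growth[OF ne n(1)] a] .
  obtain K where K: "K \<ge> 0" "\<And>n. n \<ge> 1 \<Longrightarrow> \<bar>q * real (card (G.lattice_sat n)) - real (card (G.sat n))\<bar> \<le> boundary_term K n"
    using G.coset_equidistribution unfolding reps_eq q_def by blast
  have "growth_at_least (card I) (\<lambda>k. q * real (card (G.lattice_sat k))) (density - \<epsilon> * q)"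
  proof (rule growth_at_least_mono[OF growth_at_least_minus[OF g1, of K]])
    show "\<forall>\<^sub>F k in sequentially. real (card (G.sat k)) - boundary_term K k \<le> q * real (card (G.lattice_sat k))"
      using eventually_ge_at_top[of 1]
    proof eventually_elim
      case (elim k)
      then show ?case using K(2)[of k] by (simp add: abs_le_iff)
    qed
  qed
  from growth_at_least_mult[OF this, of "1 / q"] q
  have "growth_at_least (card I) (\<lambda>k. real (card (G.lattice_sat k))) (1 / q * (density - \<epsilon> * q))" by simp
  moreover have "1 / q * (density - \<epsilon> * q) = density / q - \<epsilon>" using q by (simp add: field_simps)
  ultimately have g2: "growth_at_least (card I) (\<lambda>k. real (card (G.lattice_sat k))) (density / q - \<epsilon>)" by simp
  obtain n0 where n0: "\<And>k. card (G.lattice_sat k) \<le> card (generated F (k + n0))"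
    using G.conductor[OF F refl] by blast
  have g3: "growth_at_least (card I) (\<lambda>k. real (card (generated F k))) (density / q - \<epsilon>)"
  proof (rule growth_at_least_mono[OF growth_at_least_shift[OF g2, of n0]])
    show "\<forall>\<^sub>F k in sequentially. real (card (G.lattice_sat (k - n0))) \<le> real (card (generated F k))"
      using eventually_ge_at_top[of n0]
    proof eventually_elim
      case (elim k)
      then show ?case using n0[of "k - n0"] by simp
    qed
  qed
  show ?thesis
  proof (intro exI[of _ m] allI impI)
    fix \<Gamma>' :: "nat \<Rightarrow> ('i \<Rightarrow> int) set"
    assume "0 \<in> \<Gamma>' 0 \<and> (\<forall>m n. \<forall>x\<in>\<Gamma>' m. \<forall>y\<in>\<Gamma>' n. x + y \<in> \<Gamma>' (m + n)) \<and>
      (\<forall>n. \<Gamma>' n \<subseteq> \<Gamma> n) \<and> (\<forall>n\<le>m. \<Gamma> n \<subseteq> \<Gamma>' n)"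
    then have \<Gamma>': "0 \<in> \<Gamma>' 0" "\<And>x y m n. x \<in> \<Gamma>' m \<Longrightarrow> y \<in> \<Gamma>' n \<Longrightarrow> x + y \<in> \<Gamma>' (m + n)"
      "\<And>n. \<Gamma>' n \<subseteq> \<Gamma> n" "\<And>n. n \<le> m \<Longrightarrow> \<Gamma> n \<subseteq> \<Gamma>' n" by simp_all
    have "z \<in> \<Gamma>' l" if "(l, z) \<in> F" for l z using that \<Gamma>'(4)[of l] by (auto simp: F_def)
    then have "generated F k \<subseteq> \<Gamma>' k" for k
      using generated_subset[of F \<Gamma>', OF F _ \<Gamma>'(1) \<Gamma>'(2) \<Gamma>'(3)] by blast
    then have "card (generated F k) \<le> card (\<Gamma>' k)" for k
      using finite_subset[OF \<Gamma>'(3) finite_level] by (intro card_mono) auto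
    then show "growth_at_least (card I) (\<lambda>n. real (card (\<Gamma>' n))) (density / real (card coset_reps) - \<epsilon>)"
      using g3 by (intro growth_at_least_mono[OF g3[unfolded q_def]]) simp
  qed
qed

section \<open>Field extensions and Laurent monomials\<close>

locale field_ext =
  fixes \<iota> :: "'k::field \<Rightarrow> 'K::field"
  assumes emb: "field_embedding \<iota>"

sublocale field_ext \<subseteq> vs: vector_space "ext_scale \<iota>"
  by (rule vector_space_ext_scale[OF emb])

context field_ext
begin

lemma emb_simps [simp]:
  "\<iota> 1 = 1" "\<iota> 0 = 0" "\<iota> (x + y) = \<iota> x + \<iota> y" "\<iota> (x * y) = \<iota> x * \<iota> y" "\<iota> (- x) = - \<iota> x"
proof -
  show add: "\<iota> (x + y) = \<iota> x + \<iota> y" for x y using emb by (simp add: field_embedding_def)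
  show "\<iota> 1 = 1" "\<iota> (x * y) = \<iota> x * \<iota> y" using emb by (auto simp: field_embedding_def)
  show zero: "\<iota> 0 = 0" using add[of 0 0] by (simp only: add_0_left add_cancel_right_right)
  show "\<iota> (- x) = - \<iota> x" using add[of x "- x"] zero by (simp add: eq_neg_iff_add_eq_0 add.commute)
qed

lemma emb_eq_0_iff [simp]: "\<iota> x = 0 \<longleftrightarrow> x = 0"
proof
  assume "\<iota> x = 0"
  then have "\<iota> (x * inverse x) = 0" by simp
  then show "x = 0" by (cases "x = 0") auto
qed simp

lemma emb_inverse [simp]: "\<iota> (inverse x) = inverse (\<iota> x)"
proof (cases "x = 0")
  case False
  then have "\<iota> (x * inverse x) = 1" by simp
  then show ?thesis by (metis emb_simps(4) inverse_unique)
qed simp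

lemma scale_mult: "ext_scale \<iota> c x * y = ext_scale \<iota> c (x * y)" "x * ext_scale \<iota> c y = ext_scale \<iota> c (x * y)"
  by (simp_all add: ext_scale_def mult.left_commute mult.assoc)

lemma span_mult:
  assumes "x \<in> vs.span S" "y \<in> vs.span T"
  shows "x * y \<in> vs.span {s * t | s t. s \<in> S \<and> t \<in> T}"
proof -
  let ?U = "vs.span {s * t | s t. s \<in> S \<and> t \<in> T}"
  have 1: "s * y \<in> ?U" if s: "s \<in> S" for s
    using assms(2)
  proof (induction rule: vs.span_induct_alt)
    case base
    show ?case by (simp add: vs.span_zero)
  next
    case (step c t z)
    have "s * t \<in> ?U" using s step(1) by (intro vs.span_base) blast
    then have "ext_scale \<iota> c (s * t) + s * z \<in> ?U" using step(2) by (intro vs.span_add vs.span_scale)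
    then show ?case by (simp add: scale_mult distrib_left)
  qed
  show ?thesis using assms(1)
  proof (induction rule: vs.span_induct_alt)
    case base
    show ?case by (simp add: vs.span_zero)
  next
    case (step c s z)
    then have "ext_scale \<iota> c (s * y) + z * y \<in> ?U" using 1 by (intro vs.span_add vs.span_scale) auto
    then show ?case by (simp add: scale_mult distrib_right)
  qed
qed

text \<open>Families rather than sets, so that a repetition counts as a dependence; only finite subfamilies with
  nonzero coefficients are tested.\<close>

definition independent_family :: "'i set \<Rightarrow> ('i \<Rightarrow> 'K) \<Rightarrow> bool" where
  "independent_family F g \<longleftrightarrow>
     (\<forall>X c. X \<subseteq> F \<and> X \<noteq> {} \<and> (\<forall>i\<in>X. c i \<noteq> 0) \<longrightarrow> (\<Sum>i\<in>X. \<iota> (c i) * g i) \<noteq> 0)"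

lemma independent_familyI:
  assumes "\<And>X c. X \<subseteq> F \<Longrightarrow> X \<noteq> {} \<Longrightarrow> (\<And>i. i \<in> X \<Longrightarrow> c i \<noteq> 0) \<Longrightarrow> (\<Sum>i\<in>X. \<iota> (c i) * g i) \<noteq> 0"
  shows "independent_family F g"
  using assms unfolding independent_family_def by simp

lemma independent_familyD:
  assumes "independent_family F g" "X \<subseteq> F" "X \<noteq> {}" "\<And>i. i \<in> X \<Longrightarrow> c i \<noteq> 0"
  shows "(\<Sum>i\<in>X. \<iota> (c i) * g i) \<noteq> 0"
  using assms unfolding independent_family_def by simp

lemma independent_family_card_le:
  assumes "finite F" "finite T" "\<And>i. i \<in> F \<Longrightarrow> g i \<in> vs.span T" "independent_family F g"
  shows "card F \<le> card T"
proof -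
  note indep = independent_familyD[OF assms(4)]
  have inj: "inj_on g F"
  proof (rule inj_onI, rule ccontr)
    fix i j assume ij: "i \<in> F" "j \<in> F" "g i = g j" "i \<noteq> j"
    have "(\<Sum>l\<in>{i, j}. \<iota> (if l = i then 1 else - 1) * g l) \<noteq> 0"
      using ij by (intro indep) auto
    then show False using ij by simp
  qed
  have "vs.independent (g ` F)"
  proof (rule vs.independent_if_scalars_zero)
    show "finite (g ` F)" using assms(1) by simp
    fix f x assume sum0: "(\<Sum>x\<in>g ` F. ext_scale \<iota> (f x) x) = 0" and x: "x \<in> g ` F"
    have "(\<Sum>i\<in>F. \<iota> (f (g i)) * g i) = 0"
      using sum0 by (simp add: sum.reindex[OF inj] ext_scale_def)
    then have 0: "(\<Sum>i\<in>{i\<in>F. f (g i) \<noteq> 0}. \<iota> (f (g i)) * g i) = 0"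
      using assms(1) by (subst (asm) sum.mono_neutral_right[of F "{i\<in>F. f (g i) \<noteq> 0}"]) auto
    show "f x = 0"
    proof (rule ccontr)
      assume "f x \<noteq> 0"
      then have "{i\<in>F. f (g i) \<noteq> 0} \<noteq> {}" using x by auto
      then have "(\<Sum>i\<in>{i\<in>F. f (g i) \<noteq> 0}. \<iota> (f (g i)) * g i) \<noteq> 0"
        by (intro indep[of "{i\<in>F. f (g i) \<noteq> 0}" "\<lambda>i. f (g i)"]) simp_all
      then show False using 0 by (rule notE)
    qed
  qed
  then have "card (g ` F) \<le> card T"
    using vs.independent_span_bound[OF assms(2)] assms(3) by blast
  then show ?thesis using card_image[OF inj] by simp
qed

end

text \<open>Exponent vectors of Laurent monomials in the elements of \<open>B\<close>, indexed by the elements themselves.\<close>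

definition exponents :: "'a set \<Rightarrow> ('a \<Rightarrow> int) set" where
  "exponents B = {a. \<forall>x. x \<notin> B \<longrightarrow> a x = 0}"

lemma exponents_add [intro]: "a \<in> exponents B \<Longrightarrow> b \<in> exponents B \<Longrightarrow> a + b \<in> exponents B"
  and exponents_diff [intro]: "a \<in> exponents B \<Longrightarrow> b \<in> exponents B \<Longrightarrow> a - b \<in> exponents B"
  and exponents_uminus [intro]: "a \<in> exponents B \<Longrightarrow> - a \<in> exponents B"
  and exponents_zero [intro, simp]: "0 \<in> exponents B"
  by (auto simp: exponents_def)

lemma exponents_mono: "B \<subseteq> B' \<Longrightarrow> exponents B \<subseteq> exponents B'"
  by (auto simp: exponents_def)

definition laurent :: "'K::field set \<Rightarrow> ('K \<Rightarrow> int) \<Rightarrow> 'K" where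
  "laurent B a = (\<Prod>b\<in>B. b powi a b)"

lemma laurent_zero [simp]: "laurent B 0 = 1"
  by (simp add: laurent_def)

lemma laurent_add: "0 \<notin> B \<Longrightarrow> laurent B (a + b) = laurent B a * laurent B b"
  unfolding laurent_def prod.distrib[symmetric] by (intro prod.cong refl) (simp, subst power_int_add, auto)

lemma laurent_uminus: "laurent B (- a) = inverse (laurent B a)"
proof -
  have "(\<Prod>b\<in>B. b powi (- a b)) = (\<Prod>b\<in>B. inverse (b powi a b))"
    by (intro prod.cong refl) (simp add: power_int_minus)
  then show ?thesis by (simp add: laurent_def prod_inversef[unfolded comp_def])
qed

lemma laurent_diff: "0 \<notin> B \<Longrightarrow> laurent B (a - b) = laurent B a / laurent B b"
  using laurent_add[of B a "- b"] by (simp add: laurent_uminus divide_inverse)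

lemma laurent_nonzero [simp]: "finite B \<Longrightarrow> 0 \<notin> B \<Longrightarrow> laurent B a \<noteq> 0"
  by (auto simp: laurent_def)

lemma laurent_multiple: "laurent B (\<lambda>x. int n * a x) = laurent B a ^ n"
  unfolding laurent_def prod_power_distrib
  by (intro prod.cong refl) (metis mult.commute power_int_mult power_int_of_nat)

lemma laurent_extend:
  assumes "finite B'" "B \<subseteq> B'" "a \<in> exponents B"
  shows "laurent B' a = laurent B a"
  unfolding laurent_def
  by (rule prod.mono_neutral_right) (use assms in \<open>auto simp: exponents_def\<close>)

definition exponent_fun :: "('a \<Rightarrow>\<^sub>0 nat) \<Rightarrow> 'a \<Rightarrow> int" where
  "exponent_fun m = (\<lambda>x. int (Poly_Mapping.lookup m x))"

lemma inj_exponent_fun: "inj exponent_fun"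
  by (rule injI, rule poly_mapping_eqI) (auto simp: exponent_fun_def fun_eq_iff)

lemma laurent_exponent_fun:
  assumes "finite B" "Poly_Mapping.keys m \<subseteq> B"
  shows "laurent B (exponent_fun m) = (\<Prod>x\<in>Poly_Mapping.keys m. x ^ Poly_Mapping.lookup m x)"
  unfolding laurent_def exponent_fun_def power_int_of_nat
  using assms by (intro prod.mono_neutral_right) (auto simp: in_keys_iff)

context field_ext
begin

lemma eval_mpoly_laurent:
  assumes "finite B" "\<forall>m\<in>Poly_Mapping.keys p. Poly_Mapping.keys m \<subseteq> B"
  shows "eval_mpoly \<iota> p = (\<Sum>m\<in>Poly_Mapping.keys p. \<iota> (Poly_Mapping.lookup p m) * laurent B (exponent_fun m))"
  unfolding eval_mpoly_def using assms by (intro sum.cong refl) (simp add: laurent_exponent_fun)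

text \<open>Polynomials in the sense of the definition of algebraic independence become sums of monomials with
  distinct exponents, with which all later arguments work.\<close>

lemma alg_dependent_relation:
  assumes "finite B" "\<not> alg_independent \<iota> B"
  obtains X c where "finite X" "X \<noteq> {}" "X \<subseteq> exponents B" "\<And>a x. a \<in> X \<Longrightarrow> a x \<ge> 0"
    "\<And>a. a \<in> X \<Longrightarrow> c a \<noteq> 0" "(\<Sum>a\<in>X. \<iota> (c a) * laurent B a) = 0"
proof -
  obtain p where p: "\<forall>m\<in>Poly_Mapping.keys p. Poly_Mapping.keys m \<subseteq> B" "eval_mpoly \<iota> p = 0" "p \<noteq> 0"
    using assms(2) unfolding alg_independent_def by blast
  define c where "c = (\<lambda>a. Poly_Mapping.lookup p (inv exponent_fun a))"
  have c: "c (exponent_fun m) = Poly_Mapping.lookup p m" for m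
    by (simp add: c_def inv_f_f[OF inj_exponent_fun])
  show ?thesis
  proof (rule that[of "exponent_fun ` Poly_Mapping.keys p" c])
    show "exponent_fun ` Poly_Mapping.keys p \<noteq> {}" using p(3) by simp
    show "exponent_fun ` Poly_Mapping.keys p \<subseteq> exponents B"
      using p(1) by (force simp: exponent_fun_def exponents_def in_keys_iff)
    have "(\<Sum>a\<in>exponent_fun ` Poly_Mapping.keys p. \<iota> (c a) * laurent B a) =
        (\<Sum>m\<in>Poly_Mapping.keys p. \<iota> (Poly_Mapping.lookup p m) * laurent B (exponent_fun m))"
      using inj_exponent_fun by (subst sum.reindex) (auto simp: c intro: inj_on_subset)
    then show "(\<Sum>a\<in>exponent_fun ` Poly_Mapping.keys p. \<iota> (c a) * laurent B a) = 0"
      using eval_mpoly_laurent[OF assms(1) p(1)] p(2) by simp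
    show "\<And>a. a \<in> exponent_fun ` Poly_Mapping.keys p \<Longrightarrow> c a \<noteq> 0"
      by (auto simp: c in_keys_iff)
  qed (auto simp: exponent_fun_def)
qed

lemma alg_independent_natural:
  assumes "finite B" "alg_independent \<iota> B" "finite X" "X \<noteq> {}" "X \<subseteq> exponents B"
    "\<And>a x. a \<in> X \<Longrightarrow> a x \<ge> 0" "\<And>a. a \<in> X \<Longrightarrow> c a \<noteq> 0"
  shows "(\<Sum>a\<in>X. \<iota> (c a) * laurent B a) \<noteq> 0"
proof
  assume sum0: "(\<Sum>a\<in>X. \<iota> (c a) * laurent B a) = 0"
  have X: "X \<subseteq> range exponent_fun"
  proof
    fix a assume a: "a \<in> X"
    have "finite {x. nat (a x) \<noteq> 0}"
      by (rule finite_subset[OF _ assms(1)]) (use a assms(5) in \<open>force simp: exponents_def\<close>)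
    then have "Poly_Mapping.lookup (Abs_poly_mapping (\<lambda>x. nat (a x))) = (\<lambda>x. nat (a x))"
      by (simp add: Abs_poly_mapping_inverse)
    then have "exponent_fun (Abs_poly_mapping (\<lambda>x. nat (a x))) = a"
      using assms(6)[OF a] by (auto simp: exponent_fun_def fun_eq_iff)
    then show "a \<in> range exponent_fun" by (metis rangeI)
  qed
  define Y where "Y = exponent_fun -` X"
  have XY: "X = exponent_fun ` Y" using X by (auto simp: Y_def)
  have finY: "finite Y" unfolding Y_def by (rule finite_vimageI[OF assms(3) inj_exponent_fun])
  define f where "f = (\<lambda>m. if m \<in> Y then c (exponent_fun m) else 0)"
  define p where "p = Abs_poly_mapping f"
  have "{m. f m \<noteq> 0} = Y" using assms(7) by (auto simp: f_def Y_def)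
  then have lookup: "Poly_Mapping.lookup p = f" using finY by (simp add: p_def Abs_poly_mapping_inverse)
  have keys: "Poly_Mapping.keys p = Y"
    using \<open>{m. f m \<noteq> 0} = Y\<close> lookup by (auto simp: in_keys_iff)
  have kB: "\<forall>m\<in>Poly_Mapping.keys p. Poly_Mapping.keys m \<subseteq> B"
  proof (intro ballI subsetI)
    fix m x assume m: "m \<in> Poly_Mapping.keys p" "x \<in> Poly_Mapping.keys m"
    have "exponent_fun m \<in> exponents B" using m(1) keys assms(5) by (auto simp: Y_def)
    then show "x \<in> B" using m(2) by (auto simp: exponents_def exponent_fun_def in_keys_iff)
  qed
  have "eval_mpoly \<iota> p = (\<Sum>m\<in>Y. \<iota> (c (exponent_fun m)) * laurent B (exponent_fun m))"
    unfolding eval_mpoly_laurent[OF assms(1) kB] keys lookup by (intro sum.cong) (auto simp: f_def)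
  also have "\<dots> = (\<Sum>a\<in>X. \<iota> (c a) * laurent B a)"
    unfolding XY using inj_exponent_fun by (subst sum.reindex) (auto intro: inj_on_subset)
  finally have "eval_mpoly \<iota> p = 0" using sum0 by simp
  then have "p = 0" using assms(2) kB unfolding alg_independent_def by blast
  then show False using keys XY assms(4) by simp
qed

lemma alg_independent_nonzero:
  assumes "finite B" "alg_independent \<iota> B" shows "0 \<notin> B"
proof
  assume "0 \<in> B"
  define a :: "'K \<Rightarrow> int" where "a = (\<lambda>x. if x = 0 then 1 else 0)"
  have "laurent B a = 0" using \<open>0 \<in> B\<close> assms(1) by (auto simp: laurent_def a_def intro!: bexI[of _ 0])
  moreover have "(\<Sum>a\<in>{a}. \<iota> 1 * laurent B a) \<noteq> 0"
    using \<open>0 \<in> B\<close> by (intro alg_independent_natural assms) (auto simp: a_def exponents_def)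
  ultimately show False by simp
qed

text \<open>Multiplying by a high power of all variables reduces Laurent relations to polynomial ones.\<close>

lemma alg_independent_laurent:
  assumes "finite B" "alg_independent \<iota> B" "finite X" "X \<noteq> {}" "X \<subseteq> exponents B"
    "\<And>a. a \<in> X \<Longrightarrow> c a \<noteq> 0"
  shows "(\<Sum>a\<in>X. \<iota> (c a) * laurent B a) \<noteq> 0"
proof
  assume sum0: "(\<Sum>a\<in>X. \<iota> (c a) * laurent B a) = 0"
  note B0 = alg_independent_nonzero[OF assms(1,2)]
  define s where "s = (\<lambda>x. if x \<in> B then (\<Sum>a\<in>X. \<bar>a x\<bar>) else 0)"
  have s: "s \<in> exponents B" by (auto simp: s_def exponents_def)
  have inj: "inj_on (\<lambda>a. a + s) X" by (rule inj_onI) simp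
  have "(\<Sum>a\<in>(\<lambda>a. a + s) ` X. \<iota> (c (a - s)) * laurent B a) = (\<Sum>a\<in>X. \<iota> (c a) * laurent B (a + s))"
    by (subst sum.reindex[OF inj]) simp
  also have "\<dots> = (\<Sum>a\<in>X. \<iota> (c a) * laurent B a) * laurent B s"
    by (simp add: laurent_add[OF B0] sum_distrib_right mult.assoc)
  finally have "(\<Sum>a\<in>(\<lambda>a. a + s) ` X. \<iota> (c (a - s)) * laurent B a) = 0" using sum0 by simp
  moreover have "(\<Sum>a\<in>(\<lambda>a. a + s) ` X. \<iota> (c (a - s)) * laurent B a) \<noteq> 0"
  proof (rule alg_independent_natural[OF assms(1,2)])
    fix b x assume "b \<in> (\<lambda>a. a + s) ` X"
    then obtain a where a: "a \<in> X" "b = a + s" by auto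
    have "\<bar>a x\<bar> \<le> (\<Sum>a\<in>X. \<bar>a x\<bar>)" using assms(3) a by (intro member_le_sum) auto
    moreover have "a x = 0" if "x \<notin> B" using a assms(5) that by (auto simp: exponents_def)
    ultimately show "b x \<ge> 0" using a by (auto simp: s_def)
  qed (use assms s in auto)
  ultimately show False by simp
qed

end

section \<open>A valuation ring adapted to algebraically independent elements\<close>

text \<open>A lexicographic order on \<open>\<int>\<^sup>B\<close>, given by its set \<open>P\<close> of positive elements.\<close>

lemma total_group_order:
  assumes "finite B"
  shows "\<exists>P. P \<subseteq> exponents B \<and> 0 \<notin> P \<and> (\<forall>a\<in>P. \<forall>b\<in>P. a + b \<in> P) \<and>
    (\<forall>a\<in>exponents B. a = 0 \<or> a \<in> P \<or> - a \<in> P)"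
  using assms
proof (induction B rule: finite_induct)
  case empty
  show ?case by (rule exI[of _ "{}"]) (auto simp: exponents_def fun_eq_iff)
next
  case (insert x B)
  then obtain P where P: "P \<subseteq> exponents B" "0 \<notin> P" "\<And>a b. a \<in> P \<Longrightarrow> b \<in> P \<Longrightarrow> a + b \<in> P"
    "\<And>a. a \<in> exponents B \<Longrightarrow> a = 0 \<or> a \<in> P \<or> - a \<in> P" by blast
  define Q where "Q = {a \<in> exponents (insert x B). a x > 0 \<or> (a x = 0 \<and> a \<in> P)}"
  have "\<forall>a\<in>Q. \<forall>b\<in>Q. a + b \<in> Q"
  proof (intro ballI)
    fix a b assume ab: "a \<in> Q" "b \<in> Q"
    then have "a + b \<in> exponents (insert x B)" by (auto simp: Q_def)
    moreover have "a x + b x > 0 \<or> (a x + b x = 0 \<and> a + b \<in> P)"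
      using ab P(3)[of a b] by (auto simp: Q_def)
    ultimately show "a + b \<in> Q" by (simp add: Q_def)
  qed
  moreover have "a = 0 \<or> a \<in> Q \<or> - a \<in> Q" if a: "a \<in> exponents (insert x B)" for a
  proof (cases "a x = 0")
    case True
    then have "a \<in> exponents B" using a by (auto simp: exponents_def)
    then show ?thesis using P(4)[of a] a True by (auto simp: Q_def)
  next
    case False
    then show ?thesis using a by (auto simp: Q_def)
  qed
  moreover have "Q \<subseteq> exponents (insert x B)" "0 \<notin> Q" using P(2) by (auto simp: Q_def)
  ultimately show ?case by blast
qed

text \<open>A ring \<open>A\<close> containing the base field and, with every nonzero \<open>x\<close>, either \<open>x\<close> or its inverse. The value group
  is not constructed: divisibility in \<open>A\<close> compares values, and \<open>x \<sim>\<^sub>v y\<close> says that they are equal.\<close>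

locale valuation_ring = field_ext \<iota> for \<iota> :: "'k::field \<Rightarrow> 'K::field" +
  fixes A :: "'K set"
  assumes emb_mem: "\<iota> c \<in> A"
    and add_mem: "x \<in> A \<Longrightarrow> y \<in> A \<Longrightarrow> x + y \<in> A"
    and mult_mem: "x \<in> A \<Longrightarrow> y \<in> A \<Longrightarrow> x * y \<in> A"
    and total: "x \<noteq> 0 \<Longrightarrow> x \<in> A \<or> inverse x \<in> A"
begin

definition equiv_val :: "'K \<Rightarrow> 'K \<Rightarrow> bool" (infix "\<sim>\<^sub>v" 50) where
  "x \<sim>\<^sub>v y \<longleftrightarrow> x \<noteq> 0 \<and> y \<noteq> 0 \<and> x / y \<in> A \<and> y / x \<in> A"

lemma one_mem: "1 \<in> A" and zero_mem: "0 \<in> A"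
  using emb_mem[of 1] emb_mem[of 0] by simp_all

lemma uminus_mem: "x \<in> A \<Longrightarrow> - x \<in> A"
  using mult_mem[OF emb_mem[of "- 1"], of x] by simp

lemma power_mem: "x \<in> A \<Longrightarrow> x ^ n \<in> A"
  by (induction n) (auto simp: one_mem mult_mem)

lemma equiv_val_refl: "x \<noteq> 0 \<Longrightarrow> x \<sim>\<^sub>v x"
  by (simp add: equiv_val_def one_mem)

lemma equiv_val_sym: "x \<sim>\<^sub>v y \<Longrightarrow> y \<sim>\<^sub>v x"
  by (auto simp: equiv_val_def)

lemma equiv_val_mult: assumes "x \<sim>\<^sub>v y" "x' \<sim>\<^sub>v y'" shows "x * x' \<sim>\<^sub>v y * y'"
proof -
  have "x / y * (x' / y') \<in> A" "y / x * (y' / x') \<in> A" using assms mult_mem unfolding equiv_val_def by blast+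
  then show ?thesis using assms by (auto simp: equiv_val_def)
qed

lemma equiv_val_trans: assumes "x \<sim>\<^sub>v y" "y \<sim>\<^sub>v z" shows "x \<sim>\<^sub>v z"
proof -
  have "x / y * (y / z) \<in> A" "z / y * (y / x) \<in> A" using assms mult_mem unfolding equiv_val_def by blast+
  then show ?thesis using assms by (auto simp: equiv_val_def)
qed

lemma equiv_val_inverse: assumes "x \<sim>\<^sub>v y" shows "inverse x \<sim>\<^sub>v inverse y"
  using assms by (auto simp: equiv_val_def field_simps)

lemma equiv_val_divide: "x \<sim>\<^sub>v y \<Longrightarrow> x' \<sim>\<^sub>v y' \<Longrightarrow> x / x' \<sim>\<^sub>v y / y'"
  unfolding divide_inverse by (intro equiv_val_mult equiv_val_inverse)

lemma equiv_val_power: "x \<sim>\<^sub>v y \<Longrightarrow> x ^ n \<sim>\<^sub>v y ^ n"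
  by (induction n) (auto intro: equiv_val_mult equiv_val_refl)

text \<open>The value group is torsion free, since \<open>A\<close> is integrally closed.\<close>

lemma equiv_val_powerD:
  assumes "x ^ n \<sim>\<^sub>v y ^ n" "n \<ge> 1" shows "x \<sim>\<^sub>v y"
proof -
  have nz: "x \<noteq> 0" "y \<noteq> 0" using assms by (auto simp: equiv_val_def)
  have un: "(x / y) ^ n \<in> A" "(y / x) ^ n \<in> A" using assms by (auto simp: equiv_val_def power_divide)
  have *: "v \<in> A" if "u * v = 1" "u \<in> A" "v ^ n \<in> A" for u v
  proof -
    have "u ^ (n - 1) * v ^ n = (u * v) ^ (n - 1) * v"
      using assms(2) by (cases n) (auto simp: power_mult_distrib algebra_simps)
    then have "v = u ^ (n - 1) * v ^ n" using that by simp
    then show ?thesis using mult_mem[OF power_mem[OF that(2), of "n - 1"] that(3)] by simp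
  qed
  have inv: "inverse (x / y) = y / x" by simp
  have "x / y \<in> A \<or> y / x \<in> A" using total[of "x / y"] nz inv by auto
  then show ?thesis
    using *[of "x / y" "y / x"] *[of "y / x" "x / y"] un nz by (auto simp: equiv_val_def)
qed

lemma equiv_val_scale: assumes "x \<noteq> 0" "c \<noteq> 0" shows "\<iota> c * x \<sim>\<^sub>v x"
proof -
  have "\<iota> c * x / x = \<iota> c" "x / (\<iota> c * x) = \<iota> (inverse c)"
    using assms by (simp_all add: inverse_eq_divide[of "\<iota> c"])
  then show ?thesis using assms emb_mem unfolding equiv_val_def by (metis emb_eq_0_iff mult_eq_0_iff)
qed

lemma nonunits_add:
  assumes "x \<in> A" "x = 0 \<or> inverse x \<notin> A" "y \<in> A" "y = 0 \<or> inverse y \<notin> A"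
  shows "x + y = 0 \<or> inverse (x + y) \<notin> A"
proof (rule ccontr)
  assume neg: "\<not> ?thesis"
  have nz: "x \<noteq> 0" "y \<noteq> 0" using neg assms by auto
  have *: "inverse v \<in> A" if "u / v \<in> A" "v \<noteq> 0" "u + v \<noteq> 0" "inverse (u + v) \<in> A" for u v
  proof -
    have "(u / v + 1) * inverse (u + v) \<in> A" using that one_mem add_mem mult_mem by blast
    moreover have "(u / v + 1) * inverse (u + v) = inverse v" using that by (simp add: field_simps)
    ultimately show ?thesis by simp
  qed
  have inv: "inverse (x / y) = y / x" by simp
  have "x / y \<in> A \<or> y / x \<in> A" using total[of "x / y"] nz inv by auto
  then show False
  proof
    assume "x / y \<in> A"
    then have "inverse y \<in> A" using nz(2) neg by (intro *[of x y]) auto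
    then show False using assms(4) nz by blast
  next
    assume "y / x \<in> A"
    moreover have "y + x \<noteq> 0" "inverse (y + x) \<in> A" using neg by (auto simp: add.commute)
    ultimately have "inverse x \<in> A" using nz(1) by (intro *[of y x])
    then show False using assms(2) nz by blast
  qed
qed

lemma minimal_element:
  assumes "finite F" "F \<noteq> {}" "\<And>i. i \<in> F \<Longrightarrow> g i \<noteq> 0"
  shows "\<exists>i0\<in>F. \<forall>i\<in>F. g i / g i0 \<in> A"
  using assms
proof (induction F rule: finite_ne_induct)
  case (singleton i)
  then show ?case by (simp add: one_mem)
next
  case (insert j F)
  then obtain i0 where i0: "i0 \<in> F" "\<And>i. i \<in> F \<Longrightarrow> g i / g i0 \<in> A" by auto
  have nz: "g i0 \<noteq> 0" "g j \<noteq> 0" using i0 insert by auto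
  have inv: "inverse (g j / g i0) = g i0 / g j" by simp
  then consider "g j / g i0 \<in> A" | "g i0 / g j \<in> A" using total[of "g j / g i0"] nz by auto
  then show ?case
  proof cases
    case 1
    then show ?thesis using i0 by auto
  next
    case 2
    have "g i / g j \<in> A" if "i \<in> F" for i
    proof -
      have "g i / g i0 * (g i0 / g j) \<in> A" using i0(2)[OF that] 2 mult_mem by blast
      then show ?thesis using nz by simp
    qed
    then show ?thesis using nz one_mem by auto
  qed
qed

text \<open>The term of smallest value cannot be cancelled by the others: after division by it, the remaining
  terms are nonunits, and \<open>- 1\<close> is not a sum of nonunits.\<close>

lemma sum_inequivalent_nonzero:
  assumes "finite F" "F \<noteq> {}" "\<And>i. i \<in> F \<Longrightarrow> g i \<noteq> 0"
    and ineq: "\<And>i j. i \<in> F \<Longrightarrow> j \<in> F \<Longrightarrow> i \<noteq> j \<Longrightarrow> \<not> g i \<sim>\<^sub>v g j"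
  shows "sum g F \<noteq> 0"
proof
  assume sum0: "sum g F = 0"
  obtain i0 where i0: "i0 \<in> F" "\<And>i. i \<in> F \<Longrightarrow> g i / g i0 \<in> A"
    using minimal_element[of F g] assms(1-3) by metis
  have small: "g i / g i0 \<in> A \<and> inverse (g i / g i0) \<notin> A" if "i \<in> F" "i \<noteq> i0" for i
    using ineq[OF that(1) i0(1) that(2)] i0 assms(3) that by (auto simp: equiv_val_def)
  define h where "h = (\<lambda>X. \<Sum>i\<in>X. g i / g i0)"
  have "finite X \<Longrightarrow> X \<subseteq> F - {i0} \<Longrightarrow> h X \<in> A \<and> (h X = 0 \<or> inverse (h X) \<notin> A)" for X
  proof (induction X rule: finite_induct)
    case empty
    then show ?case by (simp add: h_def zero_mem)
  next
    case (insert j X)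
    have "h (insert j X) = g j / g i0 + h X" using insert(1,2) by (simp add: h_def)
    moreover have "g j / g i0 \<in> A" "inverse (g j / g i0) \<notin> A" using small[of j] insert(4) by auto
    ultimately show ?case using insert nonunits_add[of "g j / g i0" "h X"] add_mem by auto
  qed
  from this[of "F - {i0}"] have h: "h (F - {i0}) = 0 \<or> inverse (h (F - {i0})) \<notin> A" using assms(1) by auto
  have "0 = sum g F / g i0" using sum0 by simp
  also have "\<dots> = h F" by (simp add: h_def sum_divide_distrib)
  also have "\<dots> = 1 + h (F - {i0})"
    using sum.remove[OF assms(1) i0(1), of "\<lambda>i. g i / g i0"] assms(3)[OF i0(1)] by (simp add: h_def)
  finally have "h (F - {i0}) = - 1" by (simp add: eq_neg_iff_add_eq_0 add.commute)
  then show False using h uminus_mem[OF one_mem] by simp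
qed

lemma inequivalent_combination_nonzero:
  assumes "finite F" "F \<noteq> {}" "\<And>i. i \<in> F \<Longrightarrow> g i \<noteq> 0" "\<And>i. i \<in> F \<Longrightarrow> c i \<noteq> 0"
    and ineq: "\<And>i j. i \<in> F \<Longrightarrow> j \<in> F \<Longrightarrow> i \<noteq> j \<Longrightarrow> \<not> g i \<sim>\<^sub>v g j"
  shows "(\<Sum>i\<in>F. \<iota> (c i) * g i) \<noteq> 0"
proof (rule sum_inequivalent_nonzero[OF assms(1,2)])
  fix i j assume ij: "i \<in> F" "j \<in> F" "i \<noteq> j"
  show "\<not> \<iota> (c i) * g i \<sim>\<^sub>v \<iota> (c j) * g j"
  proof
    assume "\<iota> (c i) * g i \<sim>\<^sub>v \<iota> (c j) * g j"
    moreover have "\<iota> (c i) * g i \<sim>\<^sub>v g i" "\<iota> (c j) * g j \<sim>\<^sub>v g j"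
      using ij assms by (auto intro: equiv_val_scale)
    ultimately have "g i \<sim>\<^sub>v g j" using equiv_val_sym equiv_val_trans by blast
    then show False using ineq ij by blast
  qed
qed (use assms in auto)

end

text \<open>Subrings containing the base field; negatives come from multiplication by \<open>- 1\<close>.\<close>

definition intermediate_ring :: "('k::field \<Rightarrow> 'K::field) \<Rightarrow> 'K set \<Rightarrow> bool" where
  "intermediate_ring \<iota> R \<longleftrightarrow> range \<iota> \<subseteq> R \<and> (\<forall>x\<in>R. \<forall>y\<in>R. x + y \<in> R \<and> x * y \<in> R)"

text \<open>A subring that is maximal among those containing the monomials of positive exponent but none of
  their inverses. The aim is to show that it is a valuation ring; this is the argument of Chevalley's
  extension theorem. Because the exponents are totally ordered, \<open>1\<close> lies in the ideal generated by
  the positive monomials exactly if the inverse of one of them lies in the ring.\<close>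

locale maximal_ring = field_ext \<iota> for \<iota> :: "'k::field \<Rightarrow> 'K::field" +
  fixes B :: "'K set" and P :: "('K \<Rightarrow> int) set" and A :: "'K set"
  assumes finite_B: "finite B" and zero_B: "0 \<notin> B"
    and P_exponents: "P \<subseteq> exponents B" and P_zero: "0 \<notin> P"
    and P_add: "a \<in> P \<Longrightarrow> b \<in> P \<Longrightarrow> a + b \<in> P"
    and P_total: "a \<in> exponents B \<Longrightarrow> a = 0 \<or> a \<in> P \<or> - a \<in> P"
    and ring_A: "intermediate_ring \<iota> A"
    and P_mem: "a \<in> P \<Longrightarrow> laurent B a \<in> A"
    and P_inverse: "a \<in> P \<Longrightarrow> inverse (laurent B a) \<notin> A"
    and maximal: "intermediate_ring \<iota> R \<Longrightarrow> A \<subseteq> R \<Longrightarrow> (\<And>a. a \<in> P \<Longrightarrow> inverse (laurent B a) \<notin> R) \<Longrightarrow> R = A"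
begin

lemma A_emb: "\<iota> c \<in> A" and A_add: "x \<in> A \<Longrightarrow> y \<in> A \<Longrightarrow> x + y \<in> A"
  and A_mult: "x \<in> A \<Longrightarrow> y \<in> A \<Longrightarrow> x * y \<in> A"
  using ring_A by (auto simp: intermediate_ring_def)

lemma A_one: "1 \<in> A" and A_zero: "0 \<in> A"
  using A_emb[of 1] A_emb[of 0] by simp_all

lemma A_uminus: "x \<in> A \<Longrightarrow> - x \<in> A"
  using A_mult[OF A_emb[of "- 1"], of x] by simp

lemma A_power: "x \<in> A \<Longrightarrow> x ^ n \<in> A"
  by (induction n) (auto simp: A_one A_mult)

text \<open>The ideal generated by the monomials of positive exponent; one monomial suffices for each element.\<close>

definition small :: "'K set" where
  "small = {x. \<exists>a\<in>P. x / laurent B a \<in> A}"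

lemma laurent_nz [simp]: "laurent B a \<noteq> 0"
  by (rule laurent_nonzero[OF finite_B zero_B])

lemma smallI: "a \<in> P \<Longrightarrow> x \<in> A \<Longrightarrow> laurent B a * x \<in> small"
  unfolding small_def by (auto intro!: bexI[of _ a])

lemma small_subset: "x \<in> small \<Longrightarrow> x \<in> A"
  unfolding small_def using A_mult P_mem by (force simp: field_simps)

lemma small_mult: "x \<in> small \<Longrightarrow> y \<in> A \<Longrightarrow> x * y \<in> small"
  unfolding small_def using A_mult by force

lemma one_not_small: "1 \<notin> small"
  unfolding small_def using P_inverse by (auto simp: divide_inverse)

lemma small_zero: "P \<noteq> {} \<Longrightarrow> 0 \<in> small"
  unfolding small_def using A_zero by auto

lemma small_add: assumes "x \<in> small" "y \<in> small" shows "x + y \<in> small"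
proof -
  have *: "u + v \<in> small" if "a \<in> P" "b \<in> P" "u / laurent B a \<in> A" "v / laurent B b \<in> A" "a - b \<in> P \<or> a = b"
    for u v a b
  proof -
    have "laurent B (a - b) \<in> A" using that P_mem A_one by auto
    then have "u / laurent B a * laurent B (a - b) \<in> A" using that A_mult by blast
    then have "u / laurent B b \<in> A" by (simp add: laurent_diff[OF zero_B])
    then have "u / laurent B b + v / laurent B b \<in> A" using that A_add by blast
    then show ?thesis using that(2) by (auto simp: small_def add_divide_distrib)
  qed
  obtain a b where ab: "a \<in> P" "b \<in> P" "x / laurent B a \<in> A" "y / laurent B b \<in> A"
    using assms by (auto simp: small_def)
  have "a - b \<in> exponents B" using ab P_exponents by blast
  then have "a - b = 0 \<or> a - b \<in> P \<or> - (a - b) \<in> P" by (rule P_total)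
  then have "(a - b \<in> P \<or> a = b) \<or> (b - a \<in> P \<or> b = a)" by auto
  then show ?thesis
  proof
    assume "a - b \<in> P \<or> a = b"
    then show ?thesis using *[of a b x y] ab by blast
  next
    assume "b - a \<in> P \<or> b = a"
    then have "y + x \<in> small" using *[of b a y x] ab by blast
    then show ?thesis by (simp add: add.commute)
  qed
qed

text \<open>Inverting \<open>1 - i\<close> does not bring \<open>1\<close> into the ideal, so by maximality the inverse is already present.\<close>

lemma inverse_one_minus_small:
  assumes i: "i \<in> small" shows "inverse (1 - i) \<in> A"
proof -
  define w where "w = 1 - i"
  have w: "w \<noteq> 0" using i one_not_small by (auto simp: w_def)
  have wA: "w \<in> A" using A_add[OF A_one A_uminus[OF small_subset[OF i]]] by (simp add: w_def)
  have wn: "1 - w ^ n \<in> small" for n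
  proof (induction n)
    case 0
    have "P \<noteq> {}" using i by (auto simp: small_def)
    then show ?case using small_zero by simp
  next
    case (Suc n)
    have "(1 - w ^ n) * w + i \<in> small" using Suc i wA by (intro small_add small_mult)
    then show ?case by (simp add: w_def algebra_simps)
  qed
  define R where "R = {x / w ^ n | x n. x \<in> A}"
  have "intermediate_ring \<iota> R"
    unfolding intermediate_ring_def
  proof (intro conjI ballI subsetI)
    fix x assume "x \<in> range \<iota>"
    then have "x = x / w ^ 0" "x \<in> A" using A_emb by auto
    then show "x \<in> R" unfolding R_def by blast
  next
    fix x y assume "x \<in> R" "y \<in> R"
    then obtain x' y' m n where xy: "x = x' / w ^ m" "y = y' / w ^ n" "x' \<in> A" "y' \<in> A"
      unfolding R_def by blast
    have "x + y = (x' * w ^ n + y' * w ^ m) / w ^ (m + n)"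
      unfolding xy(1,2) using w by (simp add: add_frac_eq power_add)
    moreover have "x' * w ^ n + y' * w ^ m \<in> A" using xy wA A_add A_mult A_power by auto
    ultimately show "x + y \<in> R" unfolding R_def by blast
    have "x * y = (x' * y') / w ^ (m + n)" using xy by (simp add: power_add)
    then show "x * y \<in> R" using xy A_mult unfolding R_def by blast
  qed
  moreover have "A \<subseteq> R"
  proof
    fix x assume "x \<in> A"
    moreover have "x = x / w ^ 0" by simp
    ultimately show "x \<in> R" unfolding R_def by blast
  qed
  moreover have "inverse (laurent B a) \<notin> R" if a: "a \<in> P" for a
  proof
    assume "inverse (laurent B a) \<in> R"
    then obtain x n where x: "x \<in> A" "inverse (laurent B a) = x / w ^ n" unfolding R_def by blast
    then have "w ^ n = laurent B a * x" using w by (simp add: field_simps)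
    then have "w ^ n \<in> small" using smallI[OF a x(1)] by simp
    then have "(1 - w ^ n) + w ^ n \<in> small" using wn small_add by blast
    then show False using one_not_small by simp
  qed
  ultimately have "R = A" by (rule maximal)
  moreover have "inverse w = 1 / w ^ 1" by (simp add: divide_inverse)
  then have "inverse w \<in> R" using A_one unfolding R_def by blast
  ultimately show ?thesis by (simp add: w_def)
qed

text \<open>Values at \<open>x\<close> of polynomials of degree below \<open>n\<close> with coefficients in the ideal. If \<open>x\<close> cannot be adjoined,
  then \<open>1\<close> is such a value.\<close>

definition small_polys :: "'K \<Rightarrow> nat \<Rightarrow> 'K set" where
  "small_polys x n = {\<Sum>i<n. c i * x ^ i | c. \<forall>i<n. c i \<in> small}"

lemma small_polys_add: "y \<in> small_polys x n \<Longrightarrow> z \<in> small_polys x n \<Longrightarrow> y + z \<in> small_polys x n"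
proof -
  assume "y \<in> small_polys x n" "z \<in> small_polys x n"
  then obtain c d where "\<forall>i<n. c i \<in> small" "\<forall>i<n. d i \<in> small" "y = (\<Sum>i<n. c i * x ^ i)" "z = (\<Sum>i<n. d i * x ^ i)"
    unfolding small_polys_def by blast
  then have "\<forall>i<n. c i + d i \<in> small" "y + z = (\<Sum>i<n. (c i + d i) * x ^ i)"
    using small_add by (auto simp: sum.distrib algebra_simps)
  then show ?thesis unfolding small_polys_def by (intro CollectI exI[of _ "\<lambda>i. c i + d i"]) auto
qed

lemma small_polys_mult: "y \<in> small_polys x n \<Longrightarrow> u \<in> A \<Longrightarrow> y * u \<in> small_polys x n"
proof -
  assume "y \<in> small_polys x n" and u: "u \<in> A"
  then obtain c where c: "\<forall>i<n. c i \<in> small" "y = (\<Sum>i<n. c i * x ^ i)"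
    unfolding small_polys_def by blast
  have "\<forall>i<n. c i * u \<in> small" using c u small_mult by auto
  moreover have "y * u = (\<Sum>i<n. (c i * u) * x ^ i)"
    unfolding c(2) sum_distrib_right by (intro sum.cong) (auto simp: ac_simps)
  ultimately show ?thesis unfolding small_polys_def by (intro CollectI exI[of _ "\<lambda>i. c i * u"]) auto
qed

lemma small_polys_monom: "d \<in> small \<Longrightarrow> i < n \<Longrightarrow> d * x ^ i \<in> small_polys x n"
proof -
  assume d: "d \<in> small" and i: "i < n"
  have "0 \<in> small" using small_mult[OF d A_zero] by simp
  then have "\<forall>j<n. (if j = i then d else 0) \<in> small" using d by simp
  moreover have "d * x ^ i = (\<Sum>j<n. (if j = i then d else 0) * x ^ j)"
    using i by (simp add: if_distrib[of "\<lambda>z. z * _"] cong: if_cong)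
  ultimately show ?thesis unfolding small_polys_def by (intro CollectI exI[of _ "\<lambda>j. if j = i then d else 0"]) auto
qed

text \<open>The relation for the inverse of \<open>x\<close>, multiplied by \<open>x ^ n\<close> and by the inverse of \<open>1 - d 0\<close>, expresses \<open>x ^ n\<close> by lower
  powers with coefficients in the ideal.\<close>

lemma small_polys_reduce:
  assumes x: "x \<noteq> 0" and p: "1 \<in> small_polys x (Suc n)" and q: "1 \<in> small_polys (inverse x) (Suc m)" and mn: "m \<le> n"
  shows "1 \<in> small_polys x n"
proof -
  obtain c where c: "\<forall>i<Suc n. c i \<in> small" "1 = (\<Sum>i<Suc n. c i * x ^ i)"
    using p unfolding small_polys_def by blast
  obtain d where d: "\<forall>i<Suc m. d i \<in> small" "1 = (\<Sum>i<Suc m. d i * inverse x ^ i)"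
    using q unfolding small_polys_def by blast
  define u where "u = inverse (1 - d 0)"
  have uA: "u \<in> A" unfolding u_def using d(1) by (intro inverse_one_minus_small) auto
  have d0: "1 - d 0 \<noteq> 0" using d(1) one_not_small by auto
  have small0: "0 \<in> small" using small_mult[OF _ A_zero, of "c 0"] c(1) by simp
  have "1 = d 0 + (\<Sum>j<m. d (Suc j) * inverse x ^ Suc j)"
    using d(2) unfolding sum.lessThan_Suc_shift by simp
  then have "1 - d 0 = (\<Sum>j<m. d (Suc j) * inverse x ^ Suc j)" by (simp add: algebra_simps)
  then have "(1 - d 0) * x ^ n = (\<Sum>j<m. d (Suc j) * inverse x ^ Suc j * x ^ n)"
    by (simp only: sum_distrib_right)
  also have "\<dots> = (\<Sum>j<m. d (Suc j) * x ^ (n - Suc j))"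
  proof (intro sum.cong refl)
    fix j assume "j \<in> {..<m}"
    then have "x ^ n = x ^ Suc j * x ^ (n - Suc j)" using mn by (simp flip: power_add power_Suc)
    then have "inverse x ^ Suc j * x ^ n = (inverse x * x) ^ Suc j * x ^ (n - Suc j)"
      by (simp only: power_mult_distrib mult.assoc)
    then show "d (Suc j) * inverse x ^ Suc j * x ^ n = d (Suc j) * x ^ (n - Suc j)"
      using x by (simp add: mult.assoc)
  qed
  finally have eq: "x ^ n = (\<Sum>j<m. d (Suc j) * x ^ (n - Suc j)) * u"
    using d0 by (simp add: u_def field_simps)
  have z: "0 \<in> small_polys x n"
    unfolding small_polys_def using small0 by (intro CollectI exI[of _ "\<lambda>_. 0"]) auto
  have "(\<Sum>j\<in>J. d (Suc j) * x ^ (n - Suc j)) \<in> small_polys x n" if "finite J" "J \<subseteq> {..<m}" for J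
    using that
  proof (induction J rule: finite_induct)
    case (insert j J)
    then have "d (Suc j) * x ^ (n - Suc j) \<in> small_polys x n" using d(1) mn by (intro small_polys_monom) auto
    then show ?case using insert small_polys_add by auto
  qed (simp add: z)
  then have xn: "x ^ n \<in> small_polys x n" unfolding eq using uA by (intro small_polys_mult) auto
  have "(\<Sum>i<n. c i * x ^ i) \<in> small_polys x n"
    unfolding small_polys_def using c(1) by (intro CollectI exI[of _ c]) auto
  moreover have "x ^ n * c n \<in> small_polys x n" using xn c(1) small_subset by (intro small_polys_mult) auto
  ultimately have "(\<Sum>i<n. c i * x ^ i) + x ^ n * c n \<in> small_polys x n" by (rule small_polys_add)
  then show ?thesis using c(2) by (simp add: mult.commute)
qed

lemma not_mem_imp_small_poly:
  assumes "x \<notin> A" shows "\<exists>n. 1 \<in> small_polys x n"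
proof -
  define R where "R = {poly p x | p. \<forall>i. coeff p i \<in> A}"
  have A_sum: "sum f X \<in> A" if "\<And>i. i \<in> X \<Longrightarrow> f i \<in> A" for f and X :: "nat set"
    using that by (induction X rule: infinite_finite_induct) (auto simp: A_zero A_add)
  have "intermediate_ring \<iota> R"
    unfolding intermediate_ring_def
  proof (intro conjI ballI subsetI)
    fix y assume "y \<in> range \<iota>"
    then have "y = poly [:y:] x" "\<forall>i. coeff [:y:] i \<in> A" using A_emb A_zero by (auto simp: coeff_pCons split: nat.split)
    then show "y \<in> R" unfolding R_def by blast
  next
    fix y z assume "y \<in> R" "z \<in> R"
    then obtain p q where pq: "y = poly p x" "z = poly q x" "\<forall>i. coeff p i \<in> A" "\<forall>i. coeff q i \<in> A"
      unfolding R_def by blast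
    have "y + z = poly (p + q) x" "\<forall>i. coeff (p + q) i \<in> A" using pq A_add by auto
    then show "y + z \<in> R" unfolding R_def by blast
    have "y * z = poly (p * q) x" "\<forall>i. coeff (p * q) i \<in> A" using pq A_mult by (auto simp: coeff_mult intro!: A_sum)
    then show "y * z \<in> R" unfolding R_def by blast
  qed
  moreover have "A \<subseteq> R"
  proof
    fix y assume "y \<in> A"
    then have "y = poly [:y:] x" "\<forall>i. coeff [:y:] i \<in> A" using A_zero by (auto simp: coeff_pCons split: nat.split)
    then show "y \<in> R" unfolding R_def by blast
  qed
  moreover have "R \<noteq> A"
  proof
    assume "R = A"
    have "x = poly [:0, 1:] x" "\<forall>i. coeff [:0, 1:] i \<in> A" using A_zero A_one by (auto simp: coeff_pCons split: nat.split)
    then have "x \<in> R" unfolding R_def by blast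
    then show False using assms \<open>R = A\<close> by simp
  qed
  ultimately obtain a where a: "a \<in> P" "inverse (laurent B a) \<in> R" using maximal by blast
  then obtain p where p: "inverse (laurent B a) = poly p x" "\<forall>i. coeff p i \<in> A" unfolding R_def by blast
  have "1 = laurent B a * poly p x" by (simp flip: p(1))
  also have "\<dots> = (\<Sum>i<Suc (degree p). (laurent B a * coeff p i) * x ^ i)"
    by (simp add: poly_altdef sum_distrib_left mult.assoc lessThan_Suc_atMost)
  finally have "1 \<in> small_polys x (Suc (degree p))"
    unfolding small_polys_def using smallI[OF a(1)] p(2)
    by (intro CollectI exI[of _ "\<lambda>i. laurent B a * coeff p i"]) auto
  then show ?thesis by blast
qed

text \<open>If neither \<open>x\<close> nor its inverse could be adjoined, relations of minimal degree for both would exist, and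
  the one of larger degree could be shortened.\<close>

lemma total_A: assumes x: "x \<noteq> 0" shows "x \<in> A \<or> inverse x \<in> A"
proof (rule ccontr)
  assume "\<not> ?thesis"
  then have ex: "\<exists>n. 1 \<in> small_polys x n" "\<exists>n. 1 \<in> small_polys (inverse x) n"
    using not_mem_imp_small_poly by auto
  define n where "n = (LEAST n. 1 \<in> small_polys x n)"
  define m where "m = (LEAST n. 1 \<in> small_polys (inverse x) n)"
  have n: "1 \<in> small_polys x n" and n_min: "\<And>k. k < n \<Longrightarrow> 1 \<notin> small_polys x k"
    unfolding n_def using LeastI_ex[OF ex(1)] not_less_Least by blast+
  have m: "1 \<in> small_polys (inverse x) m" and m_min: "\<And>k. k < m \<Longrightarrow> 1 \<notin> small_polys (inverse x) k"
    unfolding m_def using LeastI_ex[OF ex(2)] not_less_Least by blast+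
  have empty: "1 \<notin> small_polys y 0" for y by (auto simp: small_polys_def)
  obtain n' m' where nm: "n = Suc n'" "m = Suc m'" using n m empty by (metis not0_implies_Suc)
  show False
  proof (cases "m' \<le> n'")
    case True
    then have "1 \<in> small_polys x n'" using small_polys_reduce[of x n' m'] x n m nm by simp
    then show False using n_min nm by simp
  next
    case False
    then have "1 \<in> small_polys (inverse x) m'" using small_polys_reduce[of "inverse x" m' n'] x n m nm by simp
    then show False using m_min nm by simp
  qed
qed

sublocale valuation_ring \<iota> A
  by unfold_locales (auto simp: A_emb A_add A_mult total_A)

lemma laurent_equiv_one:
  assumes "a \<in> exponents B" "laurent B a \<sim>\<^sub>v 1" shows "a = 0"
proof (rule ccontr)
  assume "a \<noteq> 0"
  then have "a \<in> P \<or> - a \<in> P" using P_total assms(1) by blast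
  then show False
    using P_inverse[of a] P_inverse[of "- a"] assms(2)
    by (auto simp: equiv_val_def laurent_uminus inverse_eq_divide)
qed

end

text \<open>Zorn's lemma applies to the span of the monomials of nonnegative exponent: it contains no inverse of
  a positive monomial because distinct Laurent monomials are linearly independent.\<close>

theorem (in field_ext) adapted_valuation_ring:
  assumes B: "finite B" "alg_independent \<iota> B"
  obtains A where "valuation_ring \<iota> A"
    "\<And>a. a \<in> exponents B \<Longrightarrow> valuation_ring.equiv_val A (laurent B a) 1 \<Longrightarrow> a = 0"
proof -
  note B0 = alg_independent_nonzero[OF B]
  obtain P where P: "P \<subseteq> exponents B" "0 \<notin> P" "\<And>a b. a \<in> P \<Longrightarrow> b \<in> P \<Longrightarrow> a + b \<in> P"
    "\<And>a. a \<in> exponents B \<Longrightarrow> a = 0 \<or> a \<in> P \<or> - a \<in> P"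
    using total_group_order[OF B(1)] by blast
  define good where "good = {R. intermediate_ring \<iota> R \<and> (\<forall>a\<in>P. laurent B a \<in> R \<and> inverse (laurent B a) \<notin> R)}"
  define R0 where "R0 = vs.span (laurent B ` insert 0 P)"
  have "R0 \<in> good"
    unfolding good_def intermediate_ring_def
  proof (intro CollectI conjI subsetI ballI)
    have 1: "1 \<in> R0" unfolding R0_def by (rule vs.span_base) (auto intro: image_eqI[of _ _ 0])
    fix x assume "x \<in> range \<iota>"
    then obtain c where "x = ext_scale \<iota> c 1" by (auto simp: ext_scale_def)
    then show "x \<in> R0" using 1 unfolding R0_def by (simp add: vs.span_scale)
  next
    fix x y assume xy: "x \<in> R0" "y \<in> R0"
    then show "x + y \<in> R0" unfolding R0_def by (rule vs.span_add)
    have "{s * t | s t. s \<in> laurent B ` insert 0 P \<and> t \<in> laurent B ` insert 0 P} \<subseteq> laurent B ` insert 0 P"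
      using P(3) by (force simp flip: laurent_add[OF B0])
    then show "x * y \<in> R0" using span_mult[of x _ y] xy vs.span_mono unfolding R0_def by blast
  next
    fix a assume a: "a \<in> P"
    show "laurent B a \<in> R0" unfolding R0_def using a by (intro vs.span_base) auto
    show "inverse (laurent B a) \<notin> R0"
    proof
      assume "inverse (laurent B a) \<in> R0"
      then obtain T r where T: "finite T" "T \<subseteq> laurent B ` insert 0 P" "inverse (laurent B a) = (\<Sum>x\<in>T. ext_scale \<iota> (r x) x)"
        unfolding R0_def vs.span_explicit by blast
      obtain X where X: "X \<subseteq> insert 0 P" "inj_on (laurent B) X" "T = laurent B ` X"
        using T(2) by (meson subset_image_inj)
      have finX: "finite X" using T(1) X(2,3) by (simp add: finite_image_iff)
      have sum: "laurent B (- a) = (\<Sum>b\<in>X. \<iota> (r (laurent B b)) * laurent B b)"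
        using T(3) X by (simp add: sum.reindex laurent_uminus ext_scale_def)
      have aX: "- a \<notin> X"
      proof
        assume "- a \<in> X"
        then have "- a = 0 \<or> - a \<in> P" using X by auto
        then show False using P(2) P(3)[OF a, of "- a"] a by auto
      qed
      define Y where "Y = insert (- a) {b\<in>X. r (laurent B b) \<noteq> 0}"
      define c where "c b = (if b = - a then - 1 else r (laurent B b))" for b
      have "(\<Sum>b\<in>Y. \<iota> (c b) * laurent B b) = - laurent B (- a) + (\<Sum>b\<in>{b\<in>X. r (laurent B b) \<noteq> 0}. \<iota> (c b) * laurent B b)"
        unfolding Y_def using finX aX by (subst sum.insert) (auto simp: c_def)
      also have "(\<Sum>b\<in>{b\<in>X. r (laurent B b) \<noteq> 0}. \<iota> (c b) * laurent B b) = (\<Sum>b\<in>X. \<iota> (r (laurent B b)) * laurent B b)"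
        using finX aX by (intro sum.mono_neutral_cong_left) (auto simp: c_def)
      also note sum[symmetric]
      finally have "(\<Sum>b\<in>Y. \<iota> (c b) * laurent B b) = 0" by (simp only: add.left_inverse)
      moreover have "(\<Sum>b\<in>Y. \<iota> (c b) * laurent B b) \<noteq> 0"
      proof (rule alg_independent_laurent[OF B])
        show "Y \<subseteq> exponents B" using a P(1) X(1) by (auto simp: Y_def)
      qed (use finX in \<open>auto simp: Y_def c_def\<close>)
      ultimately show False by simp
    qed
  qed
  have "\<exists>M\<in>good. \<forall>X\<in>good. M \<subseteq> X \<longrightarrow> X = M"
  proof (rule subset_Zorn_nonempty)
    show "good \<noteq> {}" using \<open>R0 \<in> good\<close> by auto
    fix C assume C: "C \<noteq> {}" "subset.chain good C"
    show "\<Union>C \<in> good"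
      unfolding good_def intermediate_ring_def
    proof (intro CollectI conjI ballI subsetI)
      have good: "R \<in> good" if "R \<in> C" for R using C that by (auto simp: subset_chain_def)
      obtain R where R: "R \<in> C" using C by auto
      { fix x assume "x \<in> range \<iota>"
        then show "x \<in> \<Union>C" using good[OF R] R by (auto simp: good_def intermediate_ring_def) }
      { fix a assume a: "a \<in> P"
        then show "laurent B a \<in> \<Union>C" using good[OF R] R by (auto simp: good_def)
        show "inverse (laurent B a) \<notin> \<Union>C" using good a by (auto simp: good_def) }
      { fix x y assume "x \<in> \<Union>C" "y \<in> \<Union>C"
        then obtain R1 R2 where R12: "R1 \<in> C" "R2 \<in> C" "x \<in> R1" "y \<in> R2" by blast
        then have "R1 \<subseteq> R2 \<or> R2 \<subseteq> R1" using C(2) by (auto simp: subset_chain_def)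
        then obtain R where "R \<in> C" "x \<in> R" "y \<in> R" using R12 by blast
        then show "x + y \<in> \<Union>C" "x * y \<in> \<Union>C"
          using good[of R] unfolding good_def intermediate_ring_def by blast+ }
    qed
  qed
  then obtain A where A: "A \<in> good" "\<And>R. R \<in> good \<Longrightarrow> A \<subseteq> R \<Longrightarrow> R = A" by blast
  interpret maximal_ring \<iota> B P A
  proof
    fix R assume R: "intermediate_ring \<iota> R" "A \<subseteq> R" "\<And>a. a \<in> P \<Longrightarrow> inverse (laurent B a) \<notin> R"
    then have "R \<in> good" using A(1) by (auto simp: good_def)
    then show "R = A" using A(2) R by blast
  qed (use P B B0 A(1) in \<open>auto simp: good_def\<close>)
  show ?thesis using that[OF valuation_ring_axioms] laurent_equiv_one by blast
qed

section \<open>Growth of finitely generated algebras\<close>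

primrec products_upto :: "'K::field set \<Rightarrow> nat \<Rightarrow> 'K set" where
  "products_upto S 0 = {1}"
| "products_upto S (Suc n) = products_upto S n \<union> {s * x | s x. s \<in> S \<and> x \<in> products_upto S n}"

lemma one_products_upto: "1 \<in> products_upto S n"
  by (induction n) auto

lemma products_upto_mult:
  "x \<in> products_upto S m \<Longrightarrow> y \<in> products_upto S n \<Longrightarrow> x * y \<in> products_upto S (m + n)"
proof (induction m arbitrary: x)
  case (Suc m)
  then consider "x \<in> products_upto S m" | s z where "s \<in> S" "z \<in> products_upto S m" "x = s * z" by auto
  then show ?case
  proof cases
    case 2
    then have "s * (z * y) \<in> products_upto S (Suc (m + n))" using Suc by auto
    then show ?thesis using 2 by (simp add: mult.assoc)
  qed (use Suc in auto)
qed simp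

lemma generator_products_upto: "s \<in> S \<Longrightarrow> s \<in> products_upto S (Suc 0)"
  by force

lemma power_products_upto: "s \<in> S \<Longrightarrow> s ^ n \<in> products_upto S n"
proof (induction n)
  case (Suc n)
  then show ?case using products_upto_mult[OF generator_products_upto, of s S "s ^ n" n] by simp
qed simp

lemma products_upto_mono: "m \<le> n \<Longrightarrow> products_upto S m \<subseteq> products_upto S n"
  by (induction n rule: nat_induct_at_least) auto

abbreviation exponent_box :: "'a set \<Rightarrow> nat \<Rightarrow> ('a \<Rightarrow> int) set" where
  "exponent_box B c \<equiv> funs_into B (\<lambda>_. {0..int c})"

lemma card_exponent_box: "finite B \<Longrightarrow> card (exponent_box B c) = (c + 1) ^ card B"
  by (subst card_funs_into) (auto simp: nat_add_distrib)

lemma finite_exponent_box: "finite B \<Longrightarrow> finite (exponent_box B c)"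
  by (rule card_funs_into) auto

lemma exponent_box_subset: "exponent_box B c \<subseteq> exponents B"
  by (auto simp: funs_into_def exponents_def)

lemma exponent_boxD: assumes "a \<in> exponent_box B c" shows "0 \<le> a x" "a x \<le> int c"
  using assms by (cases "x \<in> B"; auto simp: funs_into_def)+

lemma exponent_box_add: "a \<in> exponent_box B c \<Longrightarrow> b \<in> exponent_box B c' \<Longrightarrow> a + b \<in> exponent_box B (c + c')"
  by (fastforce simp: funs_into_def)

lemma exponent_box_mono: "c \<le> c' \<Longrightarrow> exponent_box B c \<subseteq> exponent_box B c'"
  by (force simp: funs_into_def)

lemma zero_exponent_box: "0 \<in> exponent_box B c"
  by (auto simp: funs_into_def)

lemma laurent_products_upto:
  assumes "finite B" "B \<subseteq> S" "a \<in> exponent_box B c"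
  shows "laurent B a \<in> products_upto S (card B * c)"
proof -
  have "B' \<subseteq> B \<Longrightarrow> (\<Prod>b\<in>B'. b powi a b) \<in> products_upto S (card B' * c)" if "finite B'" for B'
    using that
  proof (induction B' rule: finite_induct)
    case (insert b B')
    have "b powi a b = b ^ nat (a b)"
      using exponent_boxD(1)[OF assms(3), of b] by (metis int_nat_eq power_int_of_nat)
    moreover have "b ^ nat (a b) \<in> products_upto S (nat (a b))" using insert assms by (intro power_products_upto) auto
    moreover have "nat (a b) \<le> c" using exponent_boxD(2)[OF assms(3), of b] by simp
    ultimately have "b powi a b \<in> products_upto S c" using products_upto_mono by fastforce
    then have "b powi a b * (\<Prod>b\<in>B'. b powi a b) \<in> products_upto S (c + card B' * c)"
      using insert by (intro products_upto_mult) auto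
    then show ?case using insert by simp
  qed simp
  from this[OF assms(1) order.refl] show ?thesis by (simp add: laurent_def)
qed

context field_ext
begin

lemma span_products_upto_mult:
  assumes "x \<in> vs.span (products_upto S m)" "y \<in> vs.span (products_upto S n)"
  shows "x * y \<in> vs.span (products_upto S (m + n))"
proof -
  have "x * y \<in> vs.span {s * t | s t. s \<in> products_upto S m \<and> t \<in> products_upto S n}"
    using assms by (rule span_mult)
  moreover have "{s * t | s t. s \<in> products_upto S m \<and> t \<in> products_upto S n} \<subseteq> products_upto S (m + n)"
    using products_upto_mult by blast
  ultimately show ?thesis using vs.span_mono by blast
qed

text \<open>The elements of degree at most \<open>c\<close> in each variable of the module generated by \<open>E\<close> over the polynomials in \<open>B\<close>.\<close>

definition bounded_module :: "'K set \<Rightarrow> 'K set \<Rightarrow> nat \<Rightarrow> 'K set" where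
  "bounded_module B E c = vs.span {laurent B a * e | a e. a \<in> exponent_box B c \<and> e \<in> E}"

lemma bounded_module_base: "a \<in> exponent_box B c \<Longrightarrow> e \<in> E \<Longrightarrow> laurent B a * e \<in> bounded_module B E c"
  unfolding bounded_module_def by (rule vs.span_base) blast

lemma bounded_module_member: "e \<in> E \<Longrightarrow> e \<in> bounded_module B E c"
  using bounded_module_base[OF zero_exponent_box, of e E B c] by (simp only: laurent_zero mult_1_left)

lemma bounded_module_mono:
  assumes "c \<le> c'" "E \<subseteq> E'" shows "bounded_module B E c \<subseteq> bounded_module B E' c'"
  unfolding bounded_module_def using exponent_box_mono[OF assms(1), of B] assms(2) by (intro vs.span_mono) blast

lemma bounded_module_mult:
  assumes "0 \<notin> B" "x \<in> bounded_module B E c" "y \<in> bounded_module B E' c'"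
    and "\<And>e e'. e \<in> E \<Longrightarrow> e' \<in> E' \<Longrightarrow> e * e' \<in> E''"
  shows "x * y \<in> bounded_module B E'' (c + c')"
proof -
  let ?G = "\<lambda>E c. {laurent B a * e | a e. a \<in> exponent_box B c \<and> e \<in> E}"
  have "x * y \<in> vs.span {s * t | s t. s \<in> ?G E c \<and> t \<in> ?G E' c'}"
    using assms(2,3) unfolding bounded_module_def by (rule span_mult)
  moreover have "{s * t | s t. s \<in> ?G E c \<and> t \<in> ?G E' c'} \<subseteq> ?G E'' (c + c')"
  proof
    fix z assume "z \<in> {s * t | s t. s \<in> ?G E c \<and> t \<in> ?G E' c'}"
    then obtain a e b e' where *: "z = (laurent B a * e) * (laurent B b * e')" "a \<in> exponent_box B c" "e \<in> E"
      "b \<in> exponent_box B c'" "e' \<in> E'" by blast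
    then have "z = laurent B (a + b) * (e * e')" by (simp only: laurent_add[OF assms(1)] ac_simps)
    then show "z \<in> ?G E'' (c + c')" using exponent_box_add[OF *(2,4)] assms(4)[OF *(3,5)] by blast
  qed
  ultimately show ?thesis unfolding bounded_module_def using vs.span_mono by blast
qed

lemma bounded_module_scalar_mult:
  assumes "0 \<notin> B" "x \<in> bounded_module B {1} c" "y \<in> bounded_module B E c'"
  shows "x * y \<in> bounded_module B E (c + c')"
  by (rule bounded_module_mult[OF assms]) auto

text \<open>A polynomial relation is collected by powers of \<open>s\<close>; the leading coefficient is nonzero because \<open>B\<close> is
  independent.\<close>

lemma algebraic_relation:
  assumes B: "finite B" "alg_independent \<iota> B" and s: "s \<notin> B" "\<not> alg_independent \<iota> (insert s B)"
  obtains l c p where "l \<ge> 1" "\<And>i. p i \<in> bounded_module B {1} c" "p l \<noteq> 0" "(\<Sum>i\<le>l. p i * s ^ i) = 0"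
proof -
  obtain X r where X: "finite X" "X \<noteq> {}" "X \<subseteq> exponents (insert s B)" "\<And>a x. a \<in> X \<Longrightarrow> a x \<ge> 0"
    "\<And>a. a \<in> X \<Longrightarrow> r a \<noteq> 0" "(\<Sum>a\<in>X. \<iota> (r a) * laurent (insert s B) a) = 0"
    using alg_dependent_relation[of "insert s B"] B s by auto
  define res where "res a = a(s := 0)" for a :: "'K \<Rightarrow> int"
  define c where "c = nat (\<Sum>a\<in>X. \<Sum>b\<in>B. a b)"
  define p where "p i = (\<Sum>a\<in>{a\<in>X. nat (a s) = i}. \<iota> (r a) * laurent B (res a))" for i
  define l where "l = Max ((\<lambda>a. nat (a s)) ` X)"
  have split: "laurent (insert s B) a = laurent B (res a) * s ^ nat (a s)" if a: "a \<in> X" for a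
  proof -
    have "laurent (insert s B) a = s powi a s * (\<Prod>b\<in>B. b powi a b)"
      using s B by (simp add: laurent_def)
    also have "s powi a s = s ^ nat (a s)" using X(4)[OF a, of s] by (metis int_nat_eq power_int_of_nat)
    also have "(\<Prod>b\<in>B. b powi a b) = laurent B (res a)"
      unfolding laurent_def using s by (intro prod.cong) (auto simp: res_def)
    finally show ?thesis by (simp add: mult.commute)
  qed
  have resB: "res a \<in> exponents B" if "a \<in> X" for a
    using X(3) that by (auto simp: exponents_def res_def)
  have box: "res a \<in> exponent_box B c" if a: "a \<in> X" for a
  proof -
    have "a b \<le> int c" if b: "b \<in> B" for b
    proof -
      have "a b \<le> (\<Sum>b\<in>B. a b)" using X(4)[OF a] B b by (intro member_le_sum) auto
      also have "\<dots> \<le> (\<Sum>a\<in>X. \<Sum>b\<in>B. a b)"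
        using X(1,4) a by (intro member_le_sum sum_nonneg) auto
      finally show ?thesis by (simp add: c_def)
    qed
    then show ?thesis using X(4)[OF a] resB[OF a] s by (auto simp: funs_into_def res_def exponents_def)
  qed
  have le: "nat (a s) \<le> l" if "a \<in> X" for a unfolding l_def using X(1) that by (intro Max_ge) auto
  have "l \<in> (\<lambda>a. nat (a s)) ` X" unfolding l_def using X(1,2) by (intro Max_in) auto
  then obtain a0 where a0: "a0 \<in> X" "nat (a0 s) = l" by auto
  have "inj_on res {a\<in>X. nat (a s) = l}"
  proof (rule inj_onI)
    fix a b assume ab: "a \<in> {a\<in>X. nat (a s) = l}" "b \<in> {a\<in>X. nat (a s) = l}" "res a = res b"
    have "a s = b s" using ab X(4)[of a s] X(4)[of b s] by (auto simp: nat_eq_iff)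
    then show "a = b" using ab(3) unfolding res_def by (metis fun_upd_triv fun_upd_upd)
  qed
  then have pl: "p l = (\<Sum>b\<in>res ` {a\<in>X. nat (a s) = l}. \<iota> (r (the_inv_into {a\<in>X. nat (a s) = l} res b)) * laurent B b)"
    unfolding p_def by (subst sum.reindex) (auto simp: the_inv_into_f_f)
  have "p l \<noteq> 0"
    unfolding pl
  proof (rule alg_independent_natural[OF B])
    fix b assume "b \<in> res ` {a\<in>X. nat (a s) = l}"
    then obtain a where a: "a \<in> X" "nat (a s) = l" "b = res a" by auto
    show "b x \<ge> 0" for x using X(4)[OF a(1)] a(3) by (simp add: res_def)
    have "the_inv_into {a\<in>X. nat (a s) = l} res b = a"
      unfolding a(3) using \<open>inj_on res _\<close> a by (intro the_inv_into_f_f) auto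
    then show "r (the_inv_into {a\<in>X. nat (a s) = l} res b) \<noteq> 0" using X(5)[OF a(1)] by simp
  qed (use X(1) a0 resB in auto)
  moreover have rel: "(\<Sum>i\<le>l. p i * s ^ i) = 0"
  proof -
    have "(\<Sum>i\<le>l. p i * s ^ i) = (\<Sum>i\<le>l. \<Sum>a\<in>{a\<in>X. nat (a s) = i}. \<iota> (r a) * laurent (insert s B) a)"
      unfolding p_def sum_distrib_right by (intro sum.cong refl) (auto simp: split mult.assoc)
    also have "\<dots> = (\<Sum>a\<in>X. \<iota> (r a) * laurent (insert s B) a)"
      using X(1) le by (intro sum.group) auto
    finally show ?thesis using X(6) by simp
  qed
  moreover have "l \<ge> 1"
  proof (rule ccontr)
    assume "\<not> l \<ge> 1"
    then have "l = 0" by simp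
    then show False using rel \<open>p l \<noteq> 0\<close> by simp
  qed
  moreover have "p i \<in> bounded_module B {1} c" for i
  proof -
    have "\<iota> (r a) * laurent B (res a) \<in> bounded_module B {1} c" if "a \<in> X" for a
    proof -
      have "laurent B (res a) * 1 \<in> bounded_module B {1} c" using box[OF that] by (intro bounded_module_base) auto
      then have "ext_scale \<iota> (r a) (laurent B (res a)) \<in> bounded_module B {1} c"
        unfolding bounded_module_def by (simp add: vs.span_scale)
      then show ?thesis by (simp only: ext_scale_def)
    qed
    then show ?thesis unfolding p_def bounded_module_def by (intro vs.span_sum) blast
  qed
  ultimately show ?thesis by (intro that[of l p c])
qed

text \<open>After multiplication by a common denominator \<open>D\<close>, multiplication by each algebraic generator
  preserves the module spanned by a fixed finite set over the polynomials, raising degrees by at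
  most a constant.\<close>

lemma common_denominator:
  assumes B: "finite B" "alg_independent \<iota> B"
    and S: "finite S" "S \<inter> B = {}" "\<And>s. s \<in> S \<Longrightarrow> \<not> alg_independent \<iota> (insert s B)"
  shows "\<exists>E D c. finite E \<and> 1 \<in> E \<and> D \<noteq> 0 \<and> D \<in> bounded_module B {1} c \<and>
    (\<forall>s\<in>S. \<forall>e\<in>E. D * s * e \<in> bounded_module B E c)"
  using S
proof (induction S rule: finite_induct)
  case empty
  show ?case by (rule exI[of _ "{1}"], rule exI[of _ 1]) (auto intro: bounded_module_member)
next
  case (insert s S)
  note B0 = alg_independent_nonzero[OF B]
  have "\<exists>E D c. finite E \<and> 1 \<in> E \<and> D \<noteq> 0 \<and> D \<in> bounded_module B {1} c \<and>
    (\<forall>s\<in>S. \<forall>e\<in>E. D * s * e \<in> bounded_module B E c)"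
    using insert.prems by (intro insert.IH) auto
  then obtain E D c where E: "finite E" "1 \<in> E" "D \<noteq> 0" "D \<in> bounded_module B {1} c"
    "\<And>s e. s \<in> S \<Longrightarrow> e \<in> E \<Longrightarrow> D * s * e \<in> bounded_module B E c" by blast
  have "s \<notin> B" "\<not> alg_independent \<iota> (insert s B)" using insert.prems by auto
  then obtain l c1 p where p: "l \<ge> 1" "\<And>i. p i \<in> bounded_module B {1} c1" "p l \<noteq> 0" "(\<Sum>i\<le>l. p i * s ^ i) = 0"
    using algebraic_relation[OF B] by metis
  define E' where "E' = {e * s ^ i | e i. e \<in> E \<and> i < l}"
  define D' where "D' = D * p l"
  have Dp: "D * p i \<in> bounded_module B {1} (c + c1)" for i
    using E(4) p(2) by (rule bounded_module_scalar_mult[OF B0])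
  have DpE: "D * p i * e' \<in> bounded_module B E' (c + c1)" if "e' \<in> E'" for i e'
    using bounded_module_scalar_mult[OF B0 Dp bounded_module_member[OF that, of B 0]] by simp
  have "finite E'"
  proof -
    have "E' = (\<lambda>(e, i). e * s ^ i) ` (E \<times> {..<l})" by (auto simp: E'_def)
    then show ?thesis using E(1) by simp
  qed
  moreover have "1 \<in> E'"
  proof -
    have "1 = 1 * s ^ 0" by simp
    then show ?thesis unfolding E'_def using E(2) p(1) by fastforce
  qed
  moreover have "D' \<noteq> 0" using E(3) p(3) by (simp add: D'_def)
  moreover have "D' \<in> bounded_module B {1} (c + c1)" unfolding D'_def by (rule Dp)
  moreover have "D' * t * e' \<in> bounded_module B E' (c + c1)" if t: "t \<in> insert s S" and e': "e' \<in> E'" for t e'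
  proof -
    obtain e i where ei: "e \<in> E" "i < l" "e' = e * s ^ i" using e' unfolding E'_def by blast
    show ?thesis
    proof (cases "t = s")
      case True
      show ?thesis
      proof (cases "Suc i = l")
        case False
        then have "e * s ^ Suc i \<in> E'" unfolding E'_def using ei by (intro CollectI exI[of _ e] exI[of _ "Suc i"]) auto
        then have "D * p l * (e * s ^ Suc i) \<in> bounded_module B E' (c + c1)" by (rule DpE)
        moreover have "D * p l * (e * s ^ Suc i) = D' * t * e'" using ei True by (simp add: D'_def ac_simps)
        ultimately show ?thesis by (simp only:)
      next
        case l: True
        have "p l * s ^ l + (\<Sum>i<l. p i * s ^ i) = 0" using p(4) by (simp add: lessThan_Suc_atMost[symmetric] add.commute)
        then have pl: "p l * s ^ l = (\<Sum>i<l. - (p i * s ^ i))" by (simp add: sum_negf eq_neg_iff_add_eq_0)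
        have "D' * t * e' = D * e * (p l * s ^ l)" using ei True by (simp add: D'_def ac_simps flip: l)
        also have "\<dots> = (\<Sum>i<l. - (D * p i * (e * s ^ i)))"
          unfolding pl sum_distrib_left by (intro sum.cong refl) (simp add: ac_simps)
        also have "\<dots> \<in> bounded_module B E' (c + c1)"
        proof -
          have "D * p i * (e * s ^ i) \<in> bounded_module B E' (c + c1)" if "i < l" for i
            using ei(1) that by (intro DpE) (auto simp: E'_def)
          then show ?thesis unfolding bounded_module_def by (intro vs.span_sum vs.span_neg) auto
        qed
        finally show ?thesis .
      qed
    next
      case False
      then have "D * t * e \<in> bounded_module B E c" using t ei E(5) by blast
      moreover have "p l * s ^ i \<in> bounded_module B {s ^ i} (c1 + 0)"
        using p(2) by (rule bounded_module_scalar_mult[OF B0]) (simp add: bounded_module_member)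
      ultimately have "D * t * e * (p l * s ^ i) \<in> bounded_module B E' (c + (c1 + 0))"
        using ei(2) by (rule_tac bounded_module_mult[OF B0]) (auto simp: E'_def)
      moreover have "D * t * e * (p l * s ^ i) = D' * t * e'" using ei by (simp add: D'_def ac_simps)
      ultimately show ?thesis by (simp only: add_0_right)
    qed
  qed
  ultimately show ?case by blast
qed

text \<open>The Hilbert function of a finitely generated algebra grows at most like \<open>n\<close> to the transcendence degree.
  Multiplication by \<open>D ^ n\<close> is injective and carries the products of at most \<open>n\<close> generators into a
  module with \<open>card E\<close> generators, in degrees linear in \<open>n\<close>.\<close>

theorem growth_bound:
  assumes B: "finite B" "alg_independent \<iota> B" and S: "finite S" "B \<subseteq> S"
    and alg: "\<And>s. s \<in> S \<Longrightarrow> s \<notin> B \<Longrightarrow> \<not> alg_independent \<iota> (insert s B)"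
  shows "\<exists>C\<ge>1. \<forall>n F (g :: 'i \<Rightarrow> 'K). finite F \<and> g ` F \<subseteq> vs.span (products_upto S n) \<and>
    independent_family F g \<longrightarrow> card F \<le> C * (n + 1) ^ card B"
proof -
  note B0 = alg_independent_nonzero[OF B]
  obtain E D c where E: "finite E" "1 \<in> E" "D \<noteq> 0" "D \<in> bounded_module B {1} c"
    "\<And>s e. s \<in> S - B \<Longrightarrow> e \<in> E \<Longrightarrow> D * s * e \<in> bounded_module B E c"
  proof -
    have "\<exists>E D c. finite E \<and> 1 \<in> E \<and> D \<noteq> 0 \<and> D \<in> bounded_module B {1} c \<and>
      (\<forall>s\<in>S - B. \<forall>e\<in>E. D * s * e \<in> bounded_module B E c)"
      using S alg by (intro common_denominator[OF B]) auto
    then show ?thesis using that by blast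
  qed
  define c' where "c' = c + 1"
  have gen: "D * s * e \<in> bounded_module B E c'" if s: "s \<in> insert 1 S" and e: "e \<in> E" for s e
  proof -
    have De: "D * e \<in> bounded_module B E c"
      using bounded_module_scalar_mult[OF B0 E(4) bounded_module_member[OF e, of B 0]] by simp
    have mono: "bounded_module B E c \<subseteq> bounded_module B E c'" by (rule bounded_module_mono) (auto simp: c'_def)
    consider "s = 1" | "s \<in> S - B" | "s \<in> B" using s by auto
    then show ?thesis
    proof cases
      case 1
      then show ?thesis using De mono by auto
    next
      case 2
      then show ?thesis using E(5)[OF 2 e] mono by auto
    next
      case 3
      define a :: "'K \<Rightarrow> int" where "a x = (if x = s then 1 else 0)" for x
      have "laurent B a = (\<Prod>b\<in>B. if b = s then s else 1)"
        unfolding laurent_def by (intro prod.cong) (auto simp: a_def)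
      then have "laurent B a = s" using B(1) 3 by simp
      moreover have "a \<in> exponent_box B 1" using 3 by (auto simp: funs_into_def a_def)
      ultimately have "s * 1 \<in> bounded_module B {1} 1" using bounded_module_base[of a B 1 1 "{1}"] by simp
      then have "s * 1 * (D * e) \<in> bounded_module B E (1 + c)" using De by (rule bounded_module_scalar_mult[OF B0])
      then show ?thesis by (simp add: c'_def ac_simps)
    qed
  qed
  have step: "D * s * z \<in> bounded_module B E (m + c')" if s: "s \<in> insert 1 S" and z: "z \<in> bounded_module B E m" for s z m
    using z unfolding bounded_module_def[of B E m]
  proof (induction rule: vs.span_induct_alt)
    case base
    show ?case by (simp add: bounded_module_def vs.span_zero)
  next
    case (step r x y)
    then obtain a e where ae: "a \<in> exponent_box B m" "e \<in> E" "x = laurent B a * e" by blast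
    have "laurent B a * 1 \<in> bounded_module B {1} m" using ae(1) by (intro bounded_module_base) auto
    then have "laurent B a * 1 * (D * s * e) \<in> bounded_module B E (m + c')"
      using gen[OF s ae(2)] by (rule bounded_module_scalar_mult[OF B0])
    then have "D * s * x \<in> bounded_module B E (m + c')" by (simp add: ae(3) ac_simps)
    then have "ext_scale \<iota> r (D * s * x) + D * s * y \<in> bounded_module B E (m + c')"
      using step(2) unfolding bounded_module_def by (intro vs.span_add vs.span_scale)
    then show ?case by (simp add: scale_mult distrib_left)
  qed
  have prod: "D ^ n * x \<in> bounded_module B E (n * c')" if "x \<in> products_upto S n" for n x
    using that
  proof (induction n arbitrary: x)
    case 0
    then show ?case using bounded_module_member[OF E(2)] by simp
  next
    case (Suc n)
    then obtain s y where sy: "s \<in> insert 1 S" "y \<in> products_upto S n" "x = s * y" by force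
    have "D * s * (D ^ n * y) \<in> bounded_module B E (n * c' + c')" using sy Suc.IH by (intro step) auto
    then show ?case by (simp add: sy(3) ac_simps)
  qed
  define C where "C = card E * (c' + 1) ^ card B"
  show ?thesis
  proof (intro exI[of _ C] conjI allI impI)
    show "C \<ge> 1" using E(1,2) by (auto simp: C_def Suc_le_eq card_gt_0_iff)
    fix n F and g :: "'i \<Rightarrow> 'K"
    assume asm: "finite F \<and> g ` F \<subseteq> vs.span (products_upto S n) \<and> independent_family F g"
    then have F: "finite F" "\<And>i. i \<in> F \<Longrightarrow> g i \<in> vs.span (products_upto S n)" by auto
    have indep: "independent_family F g" using asm by blast
    define T where "T = (\<lambda>(a, e). laurent B a * e) ` (exponent_box B (n * c') \<times> E)"
    have T_eq: "T = {laurent B a * e | a e. a \<in> exponent_box B (n * c') \<and> e \<in> E}" by (auto simp: T_def)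
    have "finite T" unfolding T_def by (intro finite_imageI finite_cartesian_product E(1) finite_exponent_box[OF B(1)])
    have in_T: "D ^ n * x \<in> vs.span T" if "x \<in> vs.span (products_upto S n)" for x
      using that
    proof (induction rule: vs.span_induct_alt)
      case base
      show ?case by (simp add: vs.span_zero)
    next
      case (step r y z)
      have "D ^ n * y \<in> vs.span T" using prod[OF step(1)] unfolding bounded_module_def T_eq .
      then have "ext_scale \<iota> r (D ^ n * y) + D ^ n * z \<in> vs.span T"
        using step(2) by (intro vs.span_add vs.span_scale)
      then show ?case by (simp add: scale_mult distrib_left)
    qed
    have "card F \<le> card T"
    proof (rule independent_family_card_le[OF F(1) \<open>finite T\<close>, of "\<lambda>i. D ^ n * g i"])
      show "independent_family F (\<lambda>i. D ^ n * g i)"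
      proof (rule independent_familyI)
        fix X r assume X: "X \<subseteq> F" "X \<noteq> {}" "\<And>i. i \<in> X \<Longrightarrow> r i \<noteq> (0 :: 'k)"
        have "(\<Sum>i\<in>X. \<iota> (r i) * (D ^ n * g i)) = D ^ n * (\<Sum>i\<in>X. \<iota> (r i) * g i)"
          by (simp add: sum_distrib_left ac_simps)
        then show "(\<Sum>i\<in>X. \<iota> (r i) * (D ^ n * g i)) \<noteq> 0" using independent_familyD[OF indep X] E(3) by simp
      qed
    qed (use F in_T in auto)
    also have "\<dots> \<le> card (exponent_box B (n * c') \<times> E)"
      unfolding T_def by (intro card_image_le finite_cartesian_product E(1) finite_exponent_box[OF B(1)])
    also have "\<dots> = (n * c' + 1) ^ card B * card E"
      by (simp only: card_cartesian_product card_exponent_box[OF B(1)])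
    also have "\<dots> \<le> ((c' + 1) * (n + 1)) ^ card B * card E"
      by (intro mult_right_mono power_mono) (auto simp: algebra_simps)
    also have "\<dots> = C * (n + 1) ^ card B" by (simp only: C_def power_mult_distrib ac_simps)
    finally show "card F \<le> C * (n + 1) ^ card B" .
  qed
qed

end

section \<open>Values of elements of bounded degree\<close>

text \<open>A valuation for which distinct Laurent monomials in \<open>B\<close> have distinct values, together with a finite set \<open>S\<close> of
  elements in which \<open>B\<close> is a maximal algebraically independent subset.\<close>

locale adapted_valuation = valuation_ring \<iota> A for \<iota> :: "'k::field \<Rightarrow> 'K::field" and A +
  fixes B S :: "'K set"
  assumes finite_S: "finite S" and B_subset: "B \<subseteq> S" and indep_B: "alg_independent \<iota> B"
    and algebraic_S: "\<And>s. s \<in> S \<Longrightarrow> s \<notin> B \<Longrightarrow> \<not> alg_independent \<iota> (insert s B)"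
    and laurent_trivial: "\<And>a. a \<in> exponents B \<Longrightarrow> laurent B a \<sim>\<^sub>v 1 \<Longrightarrow> a = 0"
begin

lemma finite_B: "finite B" using finite_S B_subset finite_subset by blast

lemma zero_notin_B: "0 \<notin> B" by (rule alg_independent_nonzero[OF finite_B indep_B])

lemma laurent_nz [simp]: "laurent B a \<noteq> 0"
  by (rule laurent_nonzero[OF finite_B zero_notin_B])

lemma laurent_equiv_imp_eq:
  assumes "a \<in> exponents B" "b \<in> exponents B" "laurent B a \<sim>\<^sub>v laurent B b" shows "a = b"
proof -
  have "laurent B a / laurent B b \<sim>\<^sub>v laurent B b / laurent B b"
    using assms(3) by (intro equiv_val_divide equiv_val_refl) auto
  then have "laurent B (a - b) \<sim>\<^sub>v 1" by (simp add: laurent_diff[OF zero_notin_B])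
  then have "a - b = 0" using assms by (intro laurent_trivial exponents_diff)
  then show ?thesis by (simp only: right_minus_eq)
qed

definition piece :: "nat \<Rightarrow> 'K set" where
  "piece n = vs.span (products_upto S n)"

lemma piece_mult: "x \<in> piece m \<Longrightarrow> y \<in> piece n \<Longrightarrow> x * y \<in> piece (m + n)"
  unfolding piece_def by (rule span_products_upto_mult)

lemma piece_mono: "m \<le> n \<Longrightarrow> piece m \<subseteq> piece n"
  unfolding piece_def by (intro vs.span_mono products_upto_mono)

lemma piece_power: "x \<in> piece n \<Longrightarrow> x ^ j \<in> piece (j * n)"
proof (induction j)
  case 0
  show ?case unfolding piece_def using one_products_upto by (auto intro: vs.span_base)
next
  case (Suc j)
  then show ?case using piece_mult[of x n "x ^ j" "j * n"] by simp
qed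

lemma laurent_piece: "a \<in> exponent_box B c \<Longrightarrow> laurent B a \<in> piece (card B * c)"
  unfolding piece_def using laurent_products_upto[OF finite_B B_subset] by (blast intro: vs.span_base)

lemma growth_constant: "\<exists>C\<ge>1. \<forall>n F (g :: 'i \<Rightarrow> 'K). finite F \<and> g ` F \<subseteq> piece n \<and>
    independent_family F g \<longrightarrow> card F \<le> C * (n + 1) ^ card B"
  unfolding piece_def by (rule growth_bound[OF finite_B indep_B finite_S B_subset algebraic_S])

text \<open>Counting the products \<open>t\<^sup>a h\<^sup>j\<close> against the growth bound forces two of them to have equal value.\<close>

lemma bounded_value_relation:
  obtains J where "J \<ge> 1" "\<And>n h. n \<ge> 1 \<Longrightarrow> h \<in> piece n \<Longrightarrow> h \<noteq> 0 \<Longrightarrow>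
     \<exists>k a. 1 \<le> k \<and> k \<le> J \<and> a \<in> exponents B \<and> (\<forall>x. \<bar>a x\<bar> \<le> int (J * n)) \<and> h ^ k \<sim>\<^sub>v laurent B a"
proof -
  obtain C where C1: "C \<ge> 1" and bnd: "\<forall>n F (g :: ('K \<Rightarrow> int) \<times> nat \<Rightarrow> 'K). finite F \<and> g ` F \<subseteq> piece n \<and>
    independent_family F g \<longrightarrow> card F \<le> C * (n + 1) ^ card B"
    using growth_constant by (elim exE conjE) (rule that)
  note C = C1 bnd[rule_format, OF conjI[OF _ conjI]]
  define r where "r = card B"
  \<comment> \<open>With exponents up to \<open>J n\<close> and powers up to \<open>J\<close> there are \<open>(J + 1) (J n + 1)\<^sup>r\<close> products, in degree at most \<open>(r + 1) J n\<close>.\<close>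
  define J where "J = C * (r + 1) ^ r"
  have J: "J \<ge> 1" using C(1) by (simp add: J_def)
  show ?thesis
  proof (rule that[OF J])
    fix n h assume n: "n \<ge> 1" and h: "h \<in> piece n" "h \<noteq> 0"
    define F where "F = exponent_box B (J * n) \<times> {..J}"
    define g where "g = (\<lambda>(a, j). laurent B a * h ^ j)"
    have finF: "finite F" unfolding F_def by (intro finite_cartesian_product finite_exponent_box[OF finite_B]) simp
    have g_piece: "g i \<in> vs.span (products_upto S ((r + 1) * (J * n)))" if i: "i \<in> F" for i
    proof -
      obtain a j where aj: "i = (a, j)" "a \<in> exponent_box B (J * n)" "j \<le> J" using i unfolding F_def by auto
      have "g i \<in> piece (r * (J * n) + j * n)"
        unfolding g_def aj(1) prod.case r_def by (intro piece_mult laurent_piece aj(2) piece_power h(1))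
      moreover have "r * (J * n) + j * n \<le> (r + 1) * (J * n)" using aj(3) by simp
      ultimately show ?thesis using piece_mono unfolding piece_def by blast
    qed
    have "\<exists>i\<in>F. \<exists>j\<in>F. i \<noteq> j \<and> g i \<sim>\<^sub>v g j"
    proof (rule ccontr)
      assume neg: "\<not> ?thesis"
      have "card F \<le> C * ((r + 1) * (J * n) + 1) ^ r"
        unfolding r_def
      proof (rule C(2)[OF finF])
        show "g ` F \<subseteq> piece ((card B + 1) * (J * n))" using g_piece unfolding r_def piece_def by blast
        show "independent_family F g"
        proof (rule independent_familyI)
          fix X c assume X: "X \<subseteq> F" "X \<noteq> {}" "\<And>i. i \<in> X \<Longrightarrow> c i \<noteq> (0 :: 'k)"
          show "(\<Sum>i\<in>X. \<iota> (c i) * g i) \<noteq> 0"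
          proof (rule inequivalent_combination_nonzero)
            show "finite X" using finF X(1) finite_subset by blast
            show "\<not> g i \<sim>\<^sub>v g j" if "i \<in> X" "j \<in> X" "i \<noteq> j" for i j using neg X(1) that by blast
            show "g i \<noteq> 0" for i using h(2) by (simp add: g_def split: prod.split)
          qed (use X in auto)
        qed
      qed
      also have "\<dots> \<le> C * ((r + 1) * (J * n + 1)) ^ r"
        by (intro mult_left_mono power_mono) auto
      also have "\<dots> = J * (J * n + 1) ^ r" by (simp only: J_def power_mult_distrib ac_simps)
      also have "\<dots> < (J * n + 1) ^ r * (J + 1)" by simp
      also have "\<dots> = card F"
        by (simp only: F_def card_cartesian_product card_exponent_box[OF finite_B] r_def card_atMost Suc_eq_plus1)
      finally show False by simp
    qed
    then obtain a j b i where *: "(a, j) \<in> F" "(b, i) \<in> F" "(a, j) \<noteq> (b, i)" "laurent B a * h ^ j \<sim>\<^sub>v laurent B b * h ^ i"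
      by (auto simp: g_def)
    have key: "\<exists>k a. 1 \<le> k \<and> k \<le> J \<and> a \<in> exponents B \<and> (\<forall>x. \<bar>a x\<bar> \<le> int (J * n)) \<and> h ^ k \<sim>\<^sub>v laurent B a"
      if F: "(a, j) \<in> F" "(b, i) \<in> F" and ij: "i < j" and eq: "laurent B a * h ^ j \<sim>\<^sub>v laurent B b * h ^ i" for a b i j
    proof (intro exI conjI allI)
      have ab: "a \<in> exponent_box B (J * n)" "b \<in> exponent_box B (J * n)" "j \<le> J" using F unfolding F_def by auto
      show "1 \<le> j - i" "j - i \<le> J" using ij ab(3) by auto
      show "b - a \<in> exponents B" using ab exponent_box_subset by blast
      show "\<bar>(b - a) x\<bar> \<le> int (J * n)" for x
        using exponent_boxD[OF ab(1), of x] exponent_boxD[OF ab(2), of x] by simp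
      have "(laurent B a * h ^ j) / (laurent B a * h ^ i) \<sim>\<^sub>v (laurent B b * h ^ i) / (laurent B a * h ^ i)"
        using eq h(2) by (intro equiv_val_divide equiv_val_refl) auto
      moreover have "(laurent B a * h ^ j) / (laurent B a * h ^ i) = h ^ (j - i)" using h(2) ij by (simp add: power_diff)
      moreover have "(laurent B b * h ^ i) / (laurent B a * h ^ i) = laurent B (b - a)"
        unfolding laurent_diff[OF zero_notin_B] using h(2) by simp
      ultimately show "h ^ (j - i) \<sim>\<^sub>v laurent B (b - a)" by (simp only:)
    qed
    have "i \<noteq> j"
    proof
      assume "i = j"
      then have "laurent B a * h ^ j / h ^ j \<sim>\<^sub>v laurent B b * h ^ j / h ^ j"
        using *(4) h(2) by (intro equiv_val_divide equiv_val_refl) auto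
      then have "laurent B a \<sim>\<^sub>v laurent B b" using h(2) by simp
      moreover have "a \<in> exponents B" "b \<in> exponents B" using * exponent_box_subset unfolding F_def by blast+
      ultimately have "a = b" using laurent_equiv_imp_eq by blast
      then show False using *(3) \<open>i = j\<close> by simp
    qed
    then consider "i < j" | "j < i" by linarith
    then show "\<exists>k a. 1 \<le> k \<and> k \<le> J \<and> a \<in> exponents B \<and> (\<forall>x. \<bar>a x\<bar> \<le> int (J * n)) \<and> h ^ k \<sim>\<^sub>v laurent B a"
    proof cases
      case 1
      then show ?thesis using key * by blast
    next
      case 2
      then show ?thesis using key[of b i a j] * equiv_val_sym by blast
    qed
  qed
qed

text \<open>A system of \<open>l\<close> elements whose nontrivial combinations over the base field all have the value
  of \<open>y\<close>. For a subspace \<open>U\<close> the largest possible \<open>l\<close> is the dimension of a leaf, that is, of the corresponding graded piece of the valuation filtration.\<close>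

definition leaf_system :: "'K set \<Rightarrow> 'K \<Rightarrow> nat \<Rightarrow> (nat \<Rightarrow> 'K) \<Rightarrow> bool" where
  "leaf_system U y l g \<longleftrightarrow> (\<forall>i<l. g i \<in> U) \<and>
     (\<forall>c. (\<exists>i<l. c i \<noteq> 0) \<longrightarrow> (\<Sum>i<l. \<iota> (c i) * g i) \<sim>\<^sub>v y)"

lemma leaf_systemD:
  assumes "leaf_system U y l g" "i < l" "c i \<noteq> 0" shows "(\<Sum>i<l. \<iota> (c i) * g i) \<sim>\<^sub>v y"
  using assms unfolding leaf_system_def by (elim conjE allE[of _ c]) blast

lemma leaf_system_mult:
  assumes "leaf_system U y l g" "x \<noteq> 0" "\<And>u. u \<in> U \<Longrightarrow> x * u \<in> U'"
  shows "leaf_system U' (x * y) l (\<lambda>i. x * g i)"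
  unfolding leaf_system_def
proof (intro conjI allI impI)
  show "x * g i \<in> U'" if "i < l" for i using assms that by (auto simp: leaf_system_def)
  fix c assume "\<exists>i<l. c i \<noteq> (0 :: 'k)"
  then have "(\<Sum>i<l. \<iota> (c i) * g i) \<sim>\<^sub>v y" using leaf_systemD[OF assms(1)] by (elim exE conjE)
  then have "x * (\<Sum>i<l. \<iota> (c i) * g i) \<sim>\<^sub>v x * y" using assms(2) by (intro equiv_val_mult equiv_val_refl)
  moreover have "x * (\<Sum>i<l. \<iota> (c i) * g i) = (\<Sum>i<l. \<iota> (c i) * (x * g i))"
    by (simp add: sum_distrib_left mult.left_commute)
  ultimately show "(\<Sum>i<l. \<iota> (c i) * (x * g i)) \<sim>\<^sub>v x * y" by simp
qed

lemma leaf_system_equiv: "leaf_system U y l g \<Longrightarrow> y \<sim>\<^sub>v z \<Longrightarrow> leaf_system U z l g"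
  unfolding leaf_system_def using equiv_val_trans by blast

text \<open>Collecting a combination by values leaves one term for each value that occurs, and terms of distinct
  values cannot cancel.\<close>

lemma leaf_systems_independent:
  fixes c :: "'i \<times> nat \<Rightarrow> 'k"
  assumes ys: "finite Y" "\<And>y z. y \<in> Y \<Longrightarrow> z \<in> Y \<Longrightarrow> y \<noteq> z \<Longrightarrow> \<not> f y \<sim>\<^sub>v f z"
    and g: "\<And>y. y \<in> Y \<Longrightarrow> leaf_system U (f y) l (g y)"
    and X: "X \<subseteq> Y \<times> {..<l}" "X \<noteq> {}" "\<And>p. p \<in> X \<Longrightarrow> c p \<noteq> 0"
  shows "(\<Sum>p\<in>X. \<iota> (c p) * g (fst p) (snd p)) \<noteq> 0"
proof -
  define c' where "c' p = (if p \<in> X then c p else 0)" for p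
  define s where "s y = (\<Sum>i<l. \<iota> (c' (y, i)) * g y i)" for y
  have "(\<Sum>p\<in>X. \<iota> (c p) * g (fst p) (snd p)) = (\<Sum>p\<in>X. \<iota> (c' p) * g (fst p) (snd p))"
    by (intro sum.cong) (auto simp: c'_def)
  also have "\<dots> = (\<Sum>p\<in>fst ` X \<times> {..<l}. \<iota> (c' p) * g (fst p) (snd p))"
  proof (rule sum.mono_neutral_left)
    show "finite (fst ` X \<times> {..<l})" using X(1) ys(1) by (meson finite_SigmaI finite_cartesian_product finite_imageI finite_lessThan finite_subset)
    show "X \<subseteq> fst ` X \<times> {..<l}" using X(1) by force
  qed (auto simp: c'_def)
  also have "\<dots> = (\<Sum>y\<in>fst ` X. s y)" by (simp add: s_def sum.cartesian_product split_def)
  finally have eq: "(\<Sum>p\<in>X. \<iota> (c p) * g (fst p) (snd p)) = (\<Sum>y\<in>fst ` X. s y)" .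
  have s: "s y \<sim>\<^sub>v f y" if y: "y \<in> fst ` X" for y
  proof -
    obtain i where "(y, i) \<in> X" using y by auto
    then have "c' (y, i) \<noteq> 0" "i < l" "y \<in> Y" using X by (auto simp: c'_def)
    then show ?thesis unfolding s_def using leaf_systemD[OF g, of y i "\<lambda>i. c' (y, i)"] by blast
  qed
  have "(\<Sum>y\<in>fst ` X. s y) \<noteq> 0"
  proof (rule sum_inequivalent_nonzero)
    show "finite (fst ` X)" using X(1) ys(1) by (meson finite_SigmaI finite_imageI finite_lessThan finite_subset)
    show "s y \<noteq> 0" if "y \<in> fst ` X" for y using s[OF that] by (auto simp: equiv_val_def)
    fix y z assume yz: "y \<in> fst ` X" "z \<in> fst ` X" "y \<noteq> z"
    then have "y \<in> Y" "z \<in> Y" using X(1) by auto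
    then have "\<not> f y \<sim>\<^sub>v f z" using ys(2) yz(3) by blast
    then show "\<not> s y \<sim>\<^sub>v s z" using s[OF yz(1)] s[OF yz(2)] equiv_val_sym equiv_val_trans by blast
  qed (use X(2) in auto)
  then show ?thesis using eq by simp
qed

text \<open>Multiplying a leaf system by all monomials of bounded degree gives independent elements, too many of
  them for the growth bound if \<open>l\<close> is large.\<close>

lemma leaf_system_bound:
  obtains e where "\<And>n y l g. n \<ge> 1 \<Longrightarrow> leaf_system (piece n) y l g \<Longrightarrow> l \<le> e"
proof -
  obtain C where C1: "C \<ge> 1" and bnd: "\<forall>n F (g :: ('K \<Rightarrow> int) \<times> nat \<Rightarrow> 'K). finite F \<and> g ` F \<subseteq> piece n \<and>
    independent_family F g \<longrightarrow> card F \<le> C * (n + 1) ^ card B"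
    using growth_constant by (elim exE conjE) (rule that)
  note C = C1 bnd[rule_format, OF conjI[OF _ conjI]]
  define r where "r = card B"
  show ?thesis
  proof (rule that[of "C * (r + 1) ^ r"])
    fix n y l g assume n: "n \<ge> 1" and g: "leaf_system (piece n) y l g"
    define Y where "Y = exponent_box B n"
    have finY: "finite Y" unfolding Y_def by (rule finite_exponent_box[OF finite_B])
    show "l \<le> C * (r + 1) ^ r"
    proof (cases "l = 0")
      case False
      have "(\<Sum>i<l. \<iota> 1 * g i) \<sim>\<^sub>v y" using False by (intro leaf_systemD[OF g, of 0]) auto
      then have y: "y \<noteq> 0" by (auto simp: equiv_val_def)
      have in_piece: "laurent B a * u \<in> piece ((r + 1) * n)" if "a \<in> Y" "u \<in> piece n" for a u
        using piece_mult[OF laurent_piece that(2), of a n] that(1) unfolding Y_def r_def by (simp add: add.commute)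
      have sys: "leaf_system (piece ((r + 1) * n)) (laurent B a * y) l (\<lambda>i. laurent B a * g i)" if "a \<in> Y" for a
        using leaf_system_mult[OF g, of "laurent B a"] in_piece[OF that] by simp
      have "card (Y \<times> {..<l}) \<le> C * ((r + 1) * n + 1) ^ r"
        unfolding r_def
      proof (rule C(2)[where g = "\<lambda>p. laurent B (fst p) * g (snd p)"])
        show "finite (Y \<times> {..<l})" using finY by simp
        show "(\<lambda>p. laurent B (fst p) * g (snd p)) ` (Y \<times> {..<l}) \<subseteq> piece ((card B + 1) * n)"
          using sys unfolding leaf_system_def r_def by auto
        show "independent_family (Y \<times> {..<l}) (\<lambda>p. laurent B (fst p) * g (snd p))"
        proof (rule independent_familyI)
          fix X c assume X: "X \<subseteq> Y \<times> {..<l}" "X \<noteq> {}" "\<And>i. i \<in> X \<Longrightarrow> c i \<noteq> (0 :: 'k)"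
          show "(\<Sum>i\<in>X. \<iota> (c i) * (laurent B (fst i) * g (snd i))) \<noteq> 0"
          proof (rule leaf_systems_independent[OF finY _ sys X])
            fix a b assume ab: "a \<in> Y" "b \<in> Y" "a \<noteq> b"
            show "\<not> laurent B a * y \<sim>\<^sub>v laurent B b * y"
            proof
              assume "laurent B a * y \<sim>\<^sub>v laurent B b * y"
              then have "laurent B a * y / y \<sim>\<^sub>v laurent B b * y / y" using y by (intro equiv_val_divide equiv_val_refl)
              then have "laurent B a \<sim>\<^sub>v laurent B b" using y by simp
              then show False using laurent_equiv_imp_eq[of a b] ab exponent_box_subset unfolding Y_def by blast
            qed
          qed auto
        qed
      qed
      also have "\<dots> \<le> C * ((r + 1) * (n + 1)) ^ r" by (intro mult_left_mono power_mono) auto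
      also have "\<dots> = C * (r + 1) ^ r * (n + 1) ^ r" by (simp only: power_mult_distrib ac_simps)
      finally have "(n + 1) ^ r * l \<le> C * (r + 1) ^ r * (n + 1) ^ r"
        by (simp only: card_cartesian_product Y_def card_exponent_box[OF finite_B] r_def card_lessThan)
      then have "(n + 1) ^ r * l \<le> (n + 1) ^ r * (C * (r + 1) ^ r)" by (simp only: mult.commute)
      moreover have "0 < (n + 1) ^ r" by simp
      ultimately show ?thesis by (metis mult_le_cancel1)
    qed simp
  qed
qed

text \<open>Removing the part of strictly larger value than the minimal one costs at most \<open>e\<close> dimensions: a
  complement of it is a leaf system.\<close>

lemma dim_le_leaf_bound:
  assumes U: "vs.subspace U" "finite T" "U \<subseteq> vs.span T" and Y: "finite Y"
    and vals: "\<And>x. x \<in> U \<Longrightarrow> x \<noteq> 0 \<Longrightarrow> \<exists>y\<in>Y. x \<sim>\<^sub>v y"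
    and e: "\<And>y l g. leaf_system U y l g \<Longrightarrow> l \<le> e"
  shows "vs.dim U \<le> e * card Y"
  using Y U vals e
proof (induction Y arbitrary: U rule: finite_psubset_induct)
  case (psubset Y)
  show ?case
  proof (cases "U \<subseteq> {0}")
    case True
    then show ?thesis using vs.dim_le_card[of U "{}"] by (simp add: vs.span_empty)
  next
    case False
    obtain b where b: "b \<subseteq> U" "vs.independent b" "U \<subseteq> vs.span b" "card b = vs.dim U"
      using vs.basis_exists by blast
    have finb: "finite b" using vs.independent_span_bound[OF psubset.prems(2) b(2)] b(1) psubset.prems(3) by auto
    have bne: "b \<noteq> {}" using False b(3) by auto
    have b0: "x \<noteq> 0" if "x \<in> b" for x using b(2) that vs.dependent_zero by blast
    obtain m where m: "m \<in> b" "\<And>x. x \<in> b \<Longrightarrow> x / m \<in> A"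
      using minimal_element[of b id] finb bne b0 by auto
    have m0: "m \<noteq> 0" using m b0 by auto
    have Am: "x / m \<in> A" if "x \<in> U" for x
    proof -
      have "x \<in> vs.span b" using b(3) that by auto
      then show ?thesis
      proof (induction rule: vs.span_induct_alt)
        case (step c x y)
        have "\<iota> c * (x / m) + y / m \<in> A" using m step emb_mem by (intro add_mem mult_mem) auto
        then show ?case by (simp add: ext_scale_def add_divide_distrib)
      qed (simp add: zero_mem)
    qed
    define U' where "U' = {x \<in> U. x = 0 \<or> \<not> x \<sim>\<^sub>v m}"
    have equiv_iff: "x \<sim>\<^sub>v m \<longleftrightarrow> inverse (x / m) \<in> A" if "x \<in> U" "x \<noteq> 0" for x
      using Am[OF that(1)] that m0 by (simp add: equiv_val_def)
    have U': "vs.subspace U'"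
      unfolding vs.subspace_def
    proof (intro conjI ballI allI)
      show "0 \<in> U'" using psubset.prems(1) by (simp add: U'_def vs.subspace_0)
      fix x y assume xy: "x \<in> U'" "y \<in> U'"
      have "x / m + y / m = 0 \<or> inverse (x / m + y / m) \<notin> A"
        using xy equiv_iff Am m0 by (intro nonunits_add) (auto simp: U'_def)
      moreover have "x + y \<in> U" using xy psubset.prems(1) by (auto simp: U'_def vs.subspace_add)
      ultimately show "x + y \<in> U'" using equiv_iff[of "x + y"] m0 by (auto simp: U'_def simp flip: add_divide_distrib)
    next
      fix c x assume x: "x \<in> U'"
      show "ext_scale \<iota> c x \<in> U'"
      proof (cases "c = 0 \<or> x = 0")
        case True
        then have eq: "ext_scale \<iota> c x = 0" by (auto simp: ext_scale_def)
        show ?thesis unfolding eq using vs.subspace_0[OF psubset.prems(1)] by (simp add: U'_def)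
      next
        case False
        then have "\<iota> c * x \<sim>\<^sub>v x" by (intro equiv_val_scale) auto
        then have "\<not> \<iota> c * x \<sim>\<^sub>v m" using x False equiv_val_sym equiv_val_trans unfolding U'_def by blast
        moreover have "ext_scale \<iota> c x \<in> U" using x psubset.prems(1) by (auto simp: U'_def vs.subspace_scale)
        ultimately show ?thesis by (simp add: U'_def ext_scale_def)
      qed
    qed
    obtain y0 where y0: "y0 \<in> Y" "m \<sim>\<^sub>v y0" using psubset.prems(4)[of m] m(1) b(1) m0 by blast
    have IH: "vs.dim U' \<le> e * card (Y - {y0})"
    proof (rule psubset.IH)
      show "Y - {y0} \<subset> Y" using y0 by auto
      show "finite T" by (rule psubset.prems(2))
      show "U' \<subseteq> vs.span T" using psubset.prems(3) by (auto simp: U'_def)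
      show "\<exists>y\<in>Y - {y0}. x \<sim>\<^sub>v y" if x: "x \<in> U'" "x \<noteq> 0" for x
      proof -
        obtain y where y: "y \<in> Y" "x \<sim>\<^sub>v y" using psubset.prems(4)[of x] x by (auto simp: U'_def)
        have "y \<noteq> y0" using x y y0 equiv_val_sym equiv_val_trans unfolding U'_def by blast
        then show ?thesis using y by blast
      qed
      show "l \<le> e" if "leaf_system U' y l g" for y l g
        using that by (intro psubset.prems(5)[of y l g]) (auto simp: leaf_system_def U'_def)
    qed (rule U')
    obtain b' where b': "b' \<subseteq> U'" "vs.independent b'" "U' \<subseteq> vs.span b'" "card b' = vs.dim U'"
      using vs.basis_exists by blast
    have "U' \<subseteq> U" by (auto simp: U'_def)
    have b'U: "b' \<subseteq> U" using b'(1) \<open>U' \<subseteq> U\<close> by blast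
    obtain b'' where b'': "b' \<subseteq> b''" "b'' \<subseteq> U" "vs.independent b''" "U \<subseteq> vs.span b''"
      using vs.maximal_independent_subset_extend[OF b'U b'(2)] by blast
    have finb'': "finite b''"
      using vs.independent_span_bound[OF psubset.prems(2) b''(3)] b''(2) psubset.prems(3) by auto
    define R where "R = b'' - b'"
    have finR: "finite R" using finb'' by (simp add: R_def)
    obtain h where h: "bij_betw h {..<card R} R" using ex_bij_betw_nat_finite[OF finR] by (auto simp: atLeast0LessThan)
    have "leaf_system U m (card R) h"
      unfolding leaf_system_def
    proof (intro conjI allI impI)
      show "h i \<in> U" if "i < card R" for i using h that b''(2) unfolding bij_betw_def R_def by blast
      fix c assume c: "\<exists>i<card R. c i \<noteq> (0 :: 'k)"
      define x where "x = (\<Sum>i<card R. \<iota> (c i) * h i)"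
      have injh: "inj_on h {..<card R}" and hR: "h ` {..<card R} = R" using h by (auto simp: bij_betw_def)
      define r where "r = (\<lambda>z. c (the_inv_into {..<card R} h z))"
      have rh: "r (h i) = c i" if "i < card R" for i using that injh by (simp add: r_def the_inv_into_f_f)
      have "(\<Sum>z\<in>h ` {..<card R}. ext_scale \<iota> (r z) z) = (\<Sum>i<card R. ext_scale \<iota> (r (h i)) (h i))"
        by (simp only: sum.reindex[OF injh] comp_def)
      also have "\<dots> = x" unfolding x_def by (intro sum.cong) (auto simp: rh ext_scale_def)
      finally have x_sum: "x = (\<Sum>z\<in>R. ext_scale \<iota> (r z) z)" by (simp only: hR)
      have xU: "x \<in> U"
        unfolding x_sum using psubset.prems(1) b''(2) by (intro vs.subspace_sum vs.subspace_scale) (auto simp: R_def)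
      have xs: "x \<notin> vs.span b'"
      proof
        assume "x \<in> vs.span b'"
        then obtain T' q where T': "finite T'" "T' \<subseteq> b'" "x = (\<Sum>z\<in>T'. ext_scale \<iota> (q z) z)"
          unfolding vs.span_explicit by blast
        define w where "w z = (if z \<in> R then r z else - q z)" for z
        have disj: "R \<inter> T' = {}" using T'(2) by (auto simp: R_def)
        have "(\<Sum>z\<in>R \<union> T'. ext_scale \<iota> (w z) z) = (\<Sum>z\<in>R. ext_scale \<iota> (w z) z) + (\<Sum>z\<in>T'. ext_scale \<iota> (w z) z)"
          using finR T'(1) disj by (rule sum.union_disjoint)
        also have "(\<Sum>z\<in>R. ext_scale \<iota> (w z) z) = x" unfolding x_sum by (intro sum.cong) (auto simp: w_def)
        also have "(\<Sum>z\<in>T'. ext_scale \<iota> (w z) z) = - x"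
          unfolding T'(3) sum_negf[symmetric] using disj by (intro sum.cong) (auto simp: w_def ext_scale_def)
        finally have "(\<Sum>z\<in>R \<union> T'. ext_scale \<iota> (w z) z) = 0" by simp
        moreover have "R \<union> T' \<subseteq> b''" using T'(2) b''(1) by (auto simp: R_def)
        ultimately have w0: "w z = 0" if "z \<in> R" for z
          using vs.independentD[OF b''(3), of "R \<union> T'" w z] finR T'(1) that by auto
        obtain i where i: "i < card R" "c i \<noteq> 0" using c by blast
        then have "h i \<in> R" using hR by auto
        then have "r (h i) = 0" using w0[of "h i"] by (simp add: w_def)
        then show False using i rh by simp
      qed
      have "x \<notin> U'" using xs b'(3) by blast
      then show "(\<Sum>i<card R. \<iota> (c i) * h i) \<sim>\<^sub>v m" using xU unfolding U'_def x_def by blast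
    qed
    then have "card R \<le> e" by (rule psubset.prems(5))
    have "vs.dim U \<le> card b''" using b''(4) finb'' by (rule vs.dim_le_card)
    also have "\<dots> = card R + card b'"
      unfolding R_def using finb'' b''(1) by (simp add: card_Diff_subset finite_subset card_mono)
    also have "\<dots> \<le> e + e * card (Y - {y0})" using \<open>card R \<le> e\<close> IH b'(4) by simp
    also have "\<dots> = e * card Y" unfolding card.remove[OF \<open>finite Y\<close> y0(1)] by simp
    finally show ?thesis .
  qed
qed

lemma leaf_systems_dim:
  assumes Y: "finite Y" "\<And>y z. y \<in> Y \<Longrightarrow> z \<in> Y \<Longrightarrow> y \<noteq> z \<Longrightarrow> \<not> f y \<sim>\<^sub>v f z"
    and g: "\<And>y. y \<in> Y \<Longrightarrow> \<exists>g. leaf_system U (f y) l g"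
    and U: "finite T" "U \<subseteq> vs.span T"
  shows "l * card Y \<le> vs.dim U"
proof -
  obtain b where b: "b \<subseteq> U" "vs.independent b" "U \<subseteq> vs.span b" "card b = vs.dim U"
    using vs.basis_exists by blast
  have finb: "finite b" using vs.independent_span_bound[OF U(1) b(2)] b(1) U(2) by auto
  from g have "\<forall>y\<in>Y. \<exists>g. leaf_system U (f y) l g" by blast
  from bchoice[OF this] obtain g where g: "\<forall>y\<in>Y. leaf_system U (f y) l (g y)" by (rule exE)
  have gY: "leaf_system U (f y) l (g y)" if "y \<in> Y" for y using g that by (rule bspec)
  have "card (Y \<times> {..<l}) \<le> card b"
  proof (rule independent_family_card_le[where g = "\<lambda>p. g (fst p) (snd p)"])
    show "finite (Y \<times> {..<l})" using Y(1) by simp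
    show "g (fst i) (snd i) \<in> vs.span b" if "i \<in> Y \<times> {..<l}" for i
      using that gY b(3) unfolding leaf_system_def by auto
    show "independent_family (Y \<times> {..<l}) (\<lambda>p. g (fst p) (snd p))"
    proof (rule independent_familyI)
      fix X c assume X: "X \<subseteq> Y \<times> {..<l}" "X \<noteq> {}" "\<And>i. i \<in> X \<Longrightarrow> c i \<noteq> (0 :: 'k)"
      show "(\<Sum>i\<in>X. \<iota> (c i) * g (fst i) (snd i)) \<noteq> 0"
        by (rule leaf_systems_independent[OF Y gY X])
    qed
  qed (rule finb)
  then show ?thesis using b(4) by (simp add: card_cartesian_product mult.commute)
qed

end

section \<open>Graded linear series\<close>

context field_ext
begin

lemma span_one: "vs.span {1} = range \<iota>"
proof (intro equalityI subsetI)
  fix x assume "x \<in> vs.span {1}"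
  then obtain c where "x = ext_scale \<iota> c 1" by (auto simp: vs.span_singleton)
  then show "x \<in> range \<iota>" by (auto simp: ext_scale_def)
next
  fix x assume "x \<in> range \<iota>"
  then obtain c where "x = ext_scale \<iota> c 1" by (auto simp: ext_scale_def)
  then show "x \<in> vs.span {1}" by (simp add: vs.span_base vs.span_scale)
qed

lemma sum_mem_subalgebra:
  assumes "is_subalgebra \<iota> H" "finite F" "\<And>i. i \<in> F \<Longrightarrow> f i \<in> H"
  shows "sum f F \<in> H"
  using assms(2,3)
proof (induction F rule: finite_induct)
  case empty
  have "[:\<iota> 0:] \<in> H" using assms(1) unfolding is_subalgebra_def by blast
  then show ?case by simp
next
  case (insert i F)
  then show ?case using assms(1) by (auto simp: is_subalgebra_def)
qed

lemma alg_independent_empty: "alg_independent \<iota> {}"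
proof (rule ccontr)
  assume neg: "\<not> alg_independent \<iota> {}"
  show False
  proof (rule alg_dependent_relation[OF finite.emptyI neg])
    fix X and c :: "('K \<Rightarrow> int) \<Rightarrow> 'k"
    assume X: "X \<noteq> {}" "X \<subseteq> exponents {}" "\<And>a. a \<in> X \<Longrightarrow> c a \<noteq> 0" "(\<Sum>a\<in>X. \<iota> (c a) * laurent {} a) = 0"
    have "exponents {} = {\<lambda>_ :: 'K. 0}" by (auto simp: exponents_def)
    then have "X = {\<lambda>_. 0}" using X(1,2) by auto
    then show False using X(3,4) by (simp add: laurent_def)
  qed
qed

lemma trdeg_basis:
  assumes "trdeg \<iota> L = enat d"
  obtains B where "finite B" "B \<subseteq> L" "alg_independent \<iota> B" "card B = d"
    "\<And>x. x \<in> L \<Longrightarrow> x \<notin> B \<Longrightarrow> \<not> alg_independent \<iota> (insert x B)"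
proof -
  define \<B> where "\<B> = {B. finite B \<and> B \<subseteq> L \<and> alg_independent \<iota> B}"
  have ne: "{} \<in> \<B>" by (simp add: \<B>_def alg_independent_empty)
  have sup: "Sup ((\<lambda>B. enat (card B)) ` \<B>) = enat d" using assms by (simp add: trdeg_def \<B>_def)
  define E where "E = (\<lambda>B. enat (card B)) ` \<B>"
  have "E \<noteq> {}" using ne by (auto simp: E_def)
  moreover from this have "finite E" using sup unfolding E_def[symmetric] by (simp add: Sup_enat_def split: if_splits)
  ultimately have "enat d \<in> E" using sup Max_in[of E] unfolding E_def[symmetric] by (simp add: Sup_enat_def)
  then obtain B where B: "B \<in> \<B>" "card B = d" by (auto simp: E_def)
  have le: "card B' \<le> d" if "B' \<in> \<B>" for B'
  proof -
    have "enat (card B') \<le> enat d" unfolding sup[symmetric] using that by (rule SUP_upper)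
    then show ?thesis by simp
  qed
  show ?thesis
  proof (rule that[of B])
    fix x assume x: "x \<in> L" "x \<notin> B"
    show "\<not> alg_independent \<iota> (insert x B)"
    proof
      assume "alg_independent \<iota> (insert x B)"
      then have "insert x B \<in> \<B>" using B x by (auto simp: \<B>_def)
      then show False using le[of "insert x B"] B x by (auto simp: \<B>_def)
    qed
  qed (use B in \<open>auto simp: \<B>_def\<close>)
qed

text \<open>Only elements of \<open>S\<close> are added, so that the original set stays a distinguished part of the larger one.\<close>

lemma extend_to_maximal_independent:
  assumes "finite B" "alg_independent \<iota> B" "finite S"
  obtains B' where "B \<subseteq> B'" "B' \<subseteq> B \<union> S" "alg_independent \<iota> B'"
    "\<And>s. s \<in> B \<union> S \<Longrightarrow> s \<notin> B' \<Longrightarrow> \<not> alg_independent \<iota> (insert s B')"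
proof -
  define \<B> where "\<B> = {B'. B \<subseteq> B' \<and> B' \<subseteq> B \<union> S \<and> alg_independent \<iota> B'}"
  have "\<B> \<subseteq> Pow (B \<union> S)" by (auto simp: \<B>_def)
  then have "finite \<B>" using assms by (meson finite_Pow_iff finite_UnI finite_subset)
  moreover have "B \<in> \<B>" using assms by (simp add: \<B>_def)
  ultimately obtain B' where B': "B' \<in> \<B>" "\<And>C. C \<in> \<B> \<Longrightarrow> B' \<subseteq> C \<Longrightarrow> B' = C"
    using finite_has_maximal[of \<B>] by blast
  show ?thesis
  proof (rule that[of B'])
    fix s assume s: "s \<in> B \<union> S" "s \<notin> B'"
    show "\<not> alg_independent \<iota> (insert s B')"
    proof
      assume "alg_independent \<iota> (insert s B')"
      then have "insert s B' \<in> \<B>" using B'(1) s by (auto simp: \<B>_def)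
      then show False using B'(2)[of "insert s B'"] s by blast
    qed
  qed (use B' in \<open>auto simp: \<B>_def\<close>)
qed

text \<open>With \<open>S\<close> the set of coefficients of the generators, the polynomials whose coefficient of degree \<open>n\<close> is a
  combination of products of at most \<open>n\<close> elements of \<open>S\<close> form a subalgebra. It contains the generators, because
  their constant coefficients lie in the base field.\<close>

lemma finite_type_products:
  assumes W: "graded_linear_series \<iota> W" "finite_type \<iota> W"
  obtains S where "finite S" "\<And>n. W n \<subseteq> vs.span (products_upto S n)"
proof -
  obtain G where G: "finite G" "is_subalgebra \<iota> hull G = total_space W"
    using W(2) by (auto simp: finite_type_def)
  define S where "S = (\<Union>p\<in>G. set (coeffs p))"
  define X where "X = {p. \<forall>n. coeff p n \<in> vs.span (products_upto S n)}"
  have "is_subalgebra \<iota> X"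
    unfolding is_subalgebra_def
  proof (intro conjI allI ballI)
    fix c
    have "\<iota> c \<in> vs.span (products_upto S 0)" using span_one by auto
    then show "[:\<iota> c:] \<in> X" by (auto simp: X_def coeff_pCons vs.span_zero split: nat.split)
  next
    fix p q assume pq: "p \<in> X" "q \<in> X"
    then show "p + q \<in> X" by (auto simp: X_def vs.span_add)
    show "p * q \<in> X"
      unfolding X_def
    proof (intro CollectI allI)
      fix n
      have "coeff p i * coeff q (n - i) \<in> vs.span (products_upto S n)" if "i \<le> n" for i
        using span_products_upto_mult[of "coeff p i" S i "coeff q (n - i)" "n - i"] pq that by (auto simp: X_def)
      then show "coeff (p * q) n \<in> vs.span (products_upto S n)"
        unfolding coeff_mult by (intro vs.span_sum) auto
    qed
  qed
  moreover have "G \<subseteq> X"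
  proof
    fix p assume p: "p \<in> G"
    show "p \<in> X"
      unfolding X_def
    proof (intro CollectI allI)
      fix n
      show "coeff p n \<in> vs.span (products_upto S n)"
      proof (cases n)
        case 0
        have "p \<in> total_space W" using p G(2) hull_subset[of G "is_subalgebra \<iota>"] by auto
        then have "coeff p 0 \<in> range \<iota>" using W(1) by (auto simp: total_space_def graded_linear_series_def)
        then show ?thesis using 0 span_one by simp
      next
        case (Suc m)
        show ?thesis
        proof (cases "coeff p n = 0")
          case False
          then have "coeff p n \<in> S" unfolding S_def using p by (metis UN_iff coeff_in_coeffs degree_0 le_degree leading_coeff_0_iff coeff_0)
          then have "coeff p n \<in> products_upto S (Suc 0)" by (rule generator_products_upto)
          then have "coeff p n \<in> products_upto S n" using products_upto_mono[of "Suc 0" n S] Suc by (metis Suc_le_mono le0 subsetD)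
          then show ?thesis by (rule vs.span_base)
        qed (simp add: vs.span_zero)
      qed
    qed
  qed
  ultimately have "total_space W \<subseteq> X" unfolding G(2)[symmetric] by (intro hull_minimal)
  have "W n \<subseteq> vs.span (products_upto S n)" for n
  proof
    fix f assume f: "f \<in> W n"
    have "0 \<in> W m" for m
    proof (cases "m = 0")
      case True
      then show ?thesis using W(1) emb_simps(2) unfolding graded_linear_series_def by (metis rangeI)
    next
      case False
      then have "m \<ge> 1" by simp
      then obtain T where "W m = vs.span T" using W(1) unfolding graded_linear_series_def by blast
      then show ?thesis by (simp add: vs.span_zero)
    qed
    then have "monom f n \<in> total_space W" using f by (auto simp: total_space_def)
    then have "coeff (monom f n) n \<in> vs.span (products_upto S n)" using \<open>total_space W \<subseteq> X\<close> unfolding X_def by blast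
    then show "f \<in> vs.span (products_upto S n)" by simp
  qed
  moreover have "finite S" using G(1) by (simp add: S_def)
  ultimately show ?thesis by (intro that)
qed

end

locale graded_series = field_ext \<iota> for \<iota> :: "'k::field \<Rightarrow> 'K::field" +
  fixes V :: "nat \<Rightarrow> 'K set"
  assumes gls: "graded_linear_series \<iota> V"
begin

lemma V_0: "V 0 = range \<iota>"
  using gls by (simp add: graded_linear_series_def)

lemma V_span: "\<exists>T. finite T \<and> V n = vs.span T"
proof (cases "n = 0")
  case True
  then show ?thesis using V_0 span_one by (intro exI[of _ "{1}"]) simp
next
  case False
  then show ?thesis using gls unfolding graded_linear_series_def by auto
qed

lemma V_subspace: "vs.subspace (V n)"
  using V_span[of n] by auto

lemma V_zero [simp]: "0 \<in> V n" using V_subspace by (rule vs.subspace_0)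

lemma V_add: "f \<in> V n \<Longrightarrow> g \<in> V n \<Longrightarrow> f + g \<in> V n"
  using V_subspace by (rule vs.subspace_add)

lemma V_one: "1 \<in> V 0" using V_0 emb_simps(1) by (metis rangeI)

lemma V_mult: assumes "f \<in> V m" "g \<in> V n" shows "f * g \<in> V (m + n)"
proof -
  have "monom f m \<in> total_space V" "monom g n \<in> total_space V" using assms by (auto simp: total_space_def)
  then have "monom f m * monom g n \<in> total_space V"
    using gls unfolding graded_linear_series_def is_subalgebra_def by blast
  then have "coeff (monom (f * g) (m + n)) (m + n) \<in> V (m + n)" unfolding mult_monom total_space_def by blast
  then show ?thesis by simp
qed

lemma V_power: "f \<in> V n \<Longrightarrow> f ^ j \<in> V (j * n)"
proof (induction j)
  case 0
  show ?case using V_one by simp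
next
  case (Suc j)
  then show ?case using V_mult[of f n "f ^ j" "j * n"] by simp
qed

lemma V_const_mult: "f \<in> V n \<Longrightarrow> \<iota> c * f \<in> V n"
  using V_mult[of "\<iota> c" 0 f n] V_0 by auto

lemma V_uminus: "f \<in> V n \<Longrightarrow> - f \<in> V n"
  using V_const_mult[of f n "- 1"] by simp

lemma V_nonzero_iff: "V n \<noteq> {0} \<longleftrightarrow> (\<exists>f\<in>V n. f \<noteq> 0)"
  using V_zero[of n] by blast

lemma fraction_in_function_field:
  assumes "f \<in> V n" "g \<in> V n" "g \<noteq> 0" shows "f / g \<in> function_field \<iota> V"
proof -
  let ?G = "range \<iota> \<union> {f / g | f g. f \<noteq> 0 \<and> g \<noteq> 0 \<and> (\<exists>n\<ge>1. {f, g} \<subseteq> V n)}"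
  have "f / g \<in> ?G"
  proof (cases "n = 0")
    case True
    then obtain a b where "f = \<iota> a" "g = \<iota> b" using assms V_0 by blast
    then have "f / g = \<iota> (a * inverse b)" by (simp only: emb_simps(4) emb_inverse divide_inverse)
    then show ?thesis by blast
  next
    case False
    show ?thesis
    proof (cases "f = 0")
      case True
      then have "f / g = \<iota> 0" by simp
      then show ?thesis by blast
    next
      case f: False
      have "n \<ge> 1" "{f, g} \<subseteq> V n" using False assms by auto
      then show ?thesis using f assms(3) by blast
    qed
  qed
  then show ?thesis unfolding function_field_def field_adjoin_def by (rule hull_inc)
qed

text \<open>Fractions of elements of equal positive degree are closed under the field operations, so no
  iteration is needed to generate the function field.\<close>

lemma function_field_fraction:
  assumes x: "x \<in> function_field \<iota> V" and ne: "\<exists>n\<ge>1. V n \<noteq> {0}"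
  obtains f g n where "n \<ge> 1" "f \<in> V n" "g \<in> V n" "g \<noteq> 0" "x = f / g"
proof -
  obtain n0 f0 where f0: "n0 \<ge> 1" "f0 \<in> V n0" "f0 \<noteq> 0" using ne V_nonzero_iff by blast
  define Q where "Q = {x. \<exists>n f g. n \<ge> 1 \<and> f \<in> V n \<and> g \<in> V n \<and> g \<noteq> 0 \<and> x = f / g}"
  have "is_subfield Q"
    unfolding is_subfield_def
  proof (intro conjI ballI)
    show "1 \<in> Q" unfolding Q_def using f0 by (intro CollectI exI[of _ n0] exI[of _ f0]) auto
  next
    fix x y assume "x \<in> Q" "y \<in> Q"
    then obtain m f g n f' g' where *: "m \<ge> 1" "f \<in> V m" "g \<in> V m" "g \<noteq> 0" "x = f / g"
      "n \<ge> 1" "f' \<in> V n" "g' \<in> V n" "g' \<noteq> 0" "y = f' / g'" unfolding Q_def by blast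
    have d: "g * g' \<in> V (m + n)" "g * g' \<noteq> 0" "m + n \<ge> 1" using * V_mult by auto
    have "f * g' + g * - f' \<in> V (m + n)" using * by (intro V_add V_mult V_uminus)
    moreover have "x - y = (f * g' + g * - f') / (g * g')" using * by (simp add: field_simps)
    ultimately show "x - y \<in> Q" using d unfolding Q_def by blast
    have "f * f' \<in> V (m + n)" using * by (intro V_mult)
    moreover have "x * y = (f * f') / (g * g')" using * by simp
    ultimately show "x * y \<in> Q" using d unfolding Q_def by blast
  next
    fix x assume "x \<in> Q"
    then obtain n f g where *: "n \<ge> 1" "f \<in> V n" "g \<in> V n" "g \<noteq> 0" "x = f / g" unfolding Q_def by blast
    show "inverse x \<in> Q"
    proof (cases "f = 0")
      case True
      then show ?thesis using * \<open>x \<in> Q\<close> by simp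
    next
      case False
      then show ?thesis unfolding Q_def using * by (intro CollectI exI[of _ n] exI[of _ g] exI[of _ f]) simp
    qed
  qed
  moreover have "range \<iota> \<union> {f / g | f g. f \<noteq> 0 \<and> g \<noteq> 0 \<and> (\<exists>n\<ge>1. {f, g} \<subseteq> V n)} \<subseteq> Q"
  proof
    fix z assume "z \<in> range \<iota> \<union> {f / g | f g. f \<noteq> 0 \<and> g \<noteq> 0 \<and> (\<exists>n\<ge>1. {f, g} \<subseteq> V n)}"
    then consider c where "z = \<iota> c" | f g n where "z = f / g" "g \<noteq> 0" "n \<ge> 1" "f \<in> V n" "g \<in> V n" by auto
    then show "z \<in> Q"
    proof cases
      case 1
      have "\<iota> c * f0 \<in> V n0" using f0(2) by (rule V_const_mult)
      moreover have "z = \<iota> c * f0 / f0" using 1 f0(3) by simp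
      ultimately show ?thesis unfolding Q_def using f0 by blast
    qed (auto simp: Q_def)
  qed
  ultimately have "function_field \<iota> V \<subseteq> Q"
    unfolding function_field_def field_adjoin_def by (intro hull_minimal)
  then show ?thesis using x that unfolding Q_def by blast
qed

definition sub_lists :: "nat \<Rightarrow> nat \<Rightarrow> (nat \<times> 'K) list set" where
  "sub_lists m n = {xs. (\<forall>p\<in>set xs. 1 \<le> fst p \<and> fst p \<le> m \<and> snd p \<in> V (fst p)) \<and> sum_list (map fst xs) = n}"

text \<open>The graded linear series generated by the pieces of degree at most \<open>m\<close>.\<close>

definition subseries :: "nat \<Rightarrow> nat \<Rightarrow> 'K set" where
  "subseries m n = vs.span ((\<lambda>xs. prod_list (map snd xs)) ` sub_lists m n)"

lemma subseries_subset: "subseries m n \<subseteq> V n"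
proof -
  have "prod_list (map snd xs) \<in> V (sum_list (map fst xs))" if "\<forall>p\<in>set xs. snd p \<in> V (fst p)" for xs
    using that by (induction xs) (auto simp: V_one V_mult)
  then have "(\<lambda>xs. prod_list (map snd xs)) ` sub_lists m n \<subseteq> V n" by (auto simp: sub_lists_def)
  then show ?thesis unfolding subseries_def using V_subspace by (rule vs.span_minimal)
qed

lemma product_in_subseries: "xs \<in> sub_lists m n \<Longrightarrow> prod_list (map snd xs) \<in> subseries m n"
  unfolding subseries_def by (rule vs.span_base) blast

lemma subset_subseries: assumes "n \<le> m" shows "V n \<subseteq> subseries m n"
proof
  fix f assume f: "f \<in> V n"
  show "f \<in> subseries m n"
  proof (cases "n = 0")
    case True
    then obtain c where c: "f = ext_scale \<iota> c 1" using f V_0 by (auto simp: ext_scale_def)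
    have "[] \<in> sub_lists m n" using True by (simp add: sub_lists_def)
    from product_in_subseries[OF this] have "1 \<in> subseries m n" by simp
    then show ?thesis using c by (simp add: subseries_def vs.span_scale)
  next
    case False
    have "[(n, f)] \<in> sub_lists m n" using False f assms by (simp add: sub_lists_def)
    then have "prod_list (map snd [(n, f)]) \<in> subseries m n" by (rule product_in_subseries)
    then show ?thesis by simp
  qed
qed

lemma subseries_mult: assumes "x \<in> subseries m i" "y \<in> subseries m j" shows "x * y \<in> subseries m (i + j)"
proof -
  let ?P = "\<lambda>n. (\<lambda>xs. prod_list (map snd xs)) ` sub_lists m n"
  have "x * y \<in> vs.span {s * t | s t. s \<in> ?P i \<and> t \<in> ?P j}"
    using assms unfolding subseries_def by (rule span_mult)
  moreover have "{s * t | s t. s \<in> ?P i \<and> t \<in> ?P j} \<subseteq> ?P (i + j)"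
  proof
    fix z assume "z \<in> {s * t | s t. s \<in> ?P i \<and> t \<in> ?P j}"
    then obtain xs ys where xy: "xs \<in> sub_lists m i" "ys \<in> sub_lists m j" "z = prod_list (map snd (xs @ ys))" by auto
    then have "xs @ ys \<in> sub_lists m (i + j)" by (auto simp: sub_lists_def)
    then show "z \<in> ?P (i + j)" using xy(3) by blast
  qed
  ultimately show ?thesis unfolding subseries_def using vs.span_mono by blast
qed

lemma subseries_subspace: "vs.subspace (subseries m n)"
  unfolding subseries_def by simp

lemma subseries_0: "subseries m 0 = range \<iota>"
  using subseries_subset[of m 0] subset_subseries[of 0 m] V_0 by auto

lemma subseries_subalgebra: "is_subalgebra \<iota> (total_space (subseries m))"
  unfolding is_subalgebra_def
proof (intro conjI allI ballI)
  fix c show "[:\<iota> c:] \<in> total_space (subseries m)"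
    using subseries_0[of m] vs.subspace_0[OF subseries_subspace]
    by (auto simp: total_space_def coeff_pCons split: nat.split)
next
  fix p q assume pq: "p \<in> total_space (subseries m)" "q \<in> total_space (subseries m)"
  then show "p + q \<in> total_space (subseries m)"
    using vs.subspace_add[OF subseries_subspace] by (auto simp: total_space_def)
  show "p * q \<in> total_space (subseries m)"
    unfolding total_space_def
  proof (intro CollectI allI)
    fix n
    have "coeff p i * coeff q (n - i) \<in> subseries m n" if "i \<le> n" for i
      using subseries_mult[of "coeff p i" m i "coeff q (n - i)" "n - i"] pq that by (auto simp: total_space_def)
    then show "coeff (p * q) n \<in> subseries m n"
      unfolding coeff_mult by (intro vs.subspace_sum[OF subseries_subspace]) auto
  qed
qed

lemma subseries_graded: "graded_linear_series \<iota> (subseries m)"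
  unfolding graded_linear_series_def
proof (intro conjI allI impI)
  show "is_subalgebra \<iota> (total_space (subseries m))" by (rule subseries_subalgebra)
  show "subseries m 0 = range \<iota>" by (rule subseries_0)
  fix n :: nat
  obtain T where T: "finite T" "V n = vs.span T" using V_span by blast
  obtain b where b: "b \<subseteq> subseries m n" "vs.independent b" "subseries m n \<subseteq> vs.span b"
    by (rule vs.basis_exists[of "subseries m n"]) (rule that)
  have "b \<subseteq> vs.span T" using b(1) subseries_subset T(2) by blast
  then have "finite b" using vs.independent_span_bound[OF T(1) b(2)] by blast
  moreover have "vs.span b \<subseteq> subseries m n" using b(1) subseries_subspace by (rule vs.span_minimal)
  ultimately show "\<exists>b. finite b \<and> subseries m n = vs.span b" using b(3) by blast
qed

lemma subseries_finite_type: "finite_type \<iota> (subseries m)"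
proof -
  define T where "T n = (SOME T. finite T \<and> V n = vs.span T)" for n
  have "finite (T n) \<and> V n = vs.span (T n)" for n unfolding T_def by (rule someI_ex[OF V_span])
  then have T: "\<And>n. finite (T n)" "\<And>n. V n = vs.span (T n)" by blast+
  define S where "S = (\<lambda>(j, b). monom b j) ` (SIGMA j:{1..m}. T j)"
  have "finite S" using T(1) by (simp add: S_def)
  moreover have "is_subalgebra \<iota> hull S = total_space (subseries m)"
  proof
    show "is_subalgebra \<iota> hull S \<subseteq> total_space (subseries m)"
    proof (rule hull_minimal)
      show "is_subalgebra \<iota> (total_space (subseries m))" by (rule subseries_subalgebra)
      show "S \<subseteq> total_space (subseries m)"
      proof
        fix p assume "p \<in> S"
        then obtain j b where jb: "1 \<le> j" "j \<le> m" "b \<in> T j" "p = monom b j" by (auto simp: S_def)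
        have "b \<in> V j" unfolding T(2) using jb(3) by (rule vs.span_base)
        then have "b \<in> subseries m j" using subset_subseries jb(2) by blast
        then show "p \<in> total_space (subseries m)"
          using vs.subspace_0[OF subseries_subspace] by (auto simp: total_space_def jb(4))
      qed
    qed
    show "total_space (subseries m) \<subseteq> is_subalgebra \<iota> hull S"
      unfolding hull_def
    proof (intro Inter_greatest)
      fix H assume "H \<in> {t. is_subalgebra \<iota> t \<and> S \<subseteq> t}"
      then have H: "is_subalgebra \<iota> H" "S \<subseteq> H" by auto
      have H_add: "p + q \<in> H" and H_mult: "p * q \<in> H" if "p \<in> H" "q \<in> H" for p q
        using H(1) that by (auto simp: is_subalgebra_def)
      have H_const: "[:\<iota> c:] \<in> H" for c using H(1) by (auto simp: is_subalgebra_def)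
      have H_span: "monom f n \<in> H" if "f \<in> vs.span X" "\<And>b. b \<in> X \<Longrightarrow> monom b n \<in> H" for f X n
        using that(1)
      proof (induction rule: vs.span_induct_alt)
        case base
        show ?case using H_const[of 0] by simp
      next
        case (step c b y)
        have "[:\<iota> c:] * monom b n + monom y n \<in> H" using H_const that(2)[OF step(1)] step(2) by (intro H_add H_mult)
        then show ?case by (simp add: ext_scale_def add_monom smult_monom)
      qed
      have gen: "monom f j \<in> H" if "1 \<le> j" "j \<le> m" "f \<in> V j" for f j
        using that(3) unfolding T(2)
      proof (rule H_span)
        fix b assume "b \<in> T j"
        then have "monom b j \<in> S" using that unfolding S_def by force
        then show "monom b j \<in> H" using H(2) by blast
      qed
      have lists: "monom (prod_list (map snd xs)) (sum_list (map fst xs)) \<in> H"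
        if "\<forall>p\<in>set xs. 1 \<le> fst p \<and> fst p \<le> m \<and> snd p \<in> V (fst p)" for xs
        using that
      proof (induction xs)
        case Nil
        show ?case using H_const[of 1] by (simp add: monom_0)
      next
        case (Cons p xs)
        have "monom (snd p) (fst p) * monom (prod_list (map snd xs)) (sum_list (map fst xs)) \<in> H"
          using Cons by (intro H_mult[OF gen]) auto
        then show ?case by (simp add: mult_monom)
      qed
      have piece: "monom f n \<in> H" if "f \<in> subseries m n" for f n
        using that unfolding subseries_def
      proof (rule H_span)
        fix b assume "b \<in> (\<lambda>xs. prod_list (map snd xs)) ` sub_lists m n"
        then show "monom b n \<in> H" using lists by (auto simp: sub_lists_def)
      qed
      show "total_space (subseries m) \<subseteq> H"
      proof
        fix p assume "p \<in> total_space (subseries m)"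
        then have "(\<Sum>i\<le>degree p. monom (coeff p i) i) \<in> H"
          using piece by (intro sum_mem_subalgebra[OF H(1)]) (auto simp: total_space_def)
        then show "p \<in> H" by (simp add: poly_as_sum_of_monoms)
      qed
    qed
  qed
  ultimately show ?thesis unfolding finite_type_def by blast
qed

end

section \<open>The value semigroup of a graded linear series\<close>

text \<open>What the value semigroup uses of a subseries: closure under products, and all elements of low degree.\<close>

definition agrees_up_to :: "nat \<Rightarrow> (nat \<Rightarrow> 'a::monoid_mult set) \<Rightarrow> (nat \<Rightarrow> 'a set) \<Rightarrow> bool" where
  "agrees_up_to M W V \<longleftrightarrow> 1 \<in> W 0 \<and> (\<forall>n. W n \<subseteq> V n) \<and>
     (\<forall>m n. \<forall>f\<in>W m. \<forall>h\<in>W n. f * h \<in> W (m + n)) \<and> (\<forall>n\<le>M. V n \<subseteq> W n)"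

lemma (in valuation_ring) equiv_val_power_int: "x \<sim>\<^sub>v y \<Longrightarrow> x powi k \<sim>\<^sub>v y powi k"
  by (auto simp: power_int_def intro: equiv_val_power equiv_val_inverse)

lemma laurent_power_int: "laurent B a powi k = laurent B (\<lambda>x. k * a x)"
proof (cases "k \<ge> 0")
  case True
  then show ?thesis using laurent_multiple[of B "nat k" a] by (simp add: power_int_def)
next
  case False
  have "laurent B (\<lambda>x. k * a x) = laurent B (- (\<lambda>x. int (nat (- k)) * a x))"
    using False by (intro arg_cong[of _ _ "laurent B"] ext) simp
  then show ?thesis using False laurent_multiple[of B "nat (- k)" a]
    by (simp only: laurent_uminus) (simp add: power_int_def power_inverse)
qed

text \<open>Inside \<open>B\<close> the subset \<open>B0\<close> is a transcendence basis of the function field of \<open>V\<close>; its cardinality is the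
  Kodaira-Iitaka dimension.\<close>

locale series_valuation = graded_series \<iota> V + adapted_valuation \<iota> A B S
  for \<iota> :: "'k::field \<Rightarrow> 'K::field" and V A B S +
  fixes B0 :: "'K set"
  assumes V_piece: "V n \<subseteq> piece n"
    and B0_subset: "B0 \<subseteq> B"
    and indep_B0: "alg_independent \<iota> B0"
    and B0_function_field: "B0 \<subseteq> function_field \<iota> V"
    and B0_algebraic: "x \<in> function_field \<iota> V \<Longrightarrow> x \<notin> B0 \<Longrightarrow> \<not> alg_independent \<iota> (insert x B0)"
    and nontrivial: "\<exists>n\<ge>1. V n \<noteq> {0}"
begin

lemma finite_B0: "finite B0" using finite_B B0_subset finite_subset by blast

lemma zero_notin_B0: "0 \<notin> B0" using zero_notin_B B0_subset by blast

text \<open>One constant that serves the elements of all degrees.\<close>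

definition exponent_bound :: nat where
  "exponent_bound = (SOME J. J \<ge> 1 \<and> (\<forall>n h. n \<ge> 1 \<and> h \<in> piece n \<and> h \<noteq> 0 \<longrightarrow>
     (\<exists>k a. 1 \<le> k \<and> k \<le> J \<and> a \<in> exponents B \<and> (\<forall>x. \<bar>a x\<bar> \<le> int (J * n)) \<and> h ^ k \<sim>\<^sub>v laurent B a)))"

lemma exponent_bound:
  "exponent_bound \<ge> 1"
  "n \<ge> 1 \<Longrightarrow> h \<in> piece n \<Longrightarrow> h \<noteq> 0 \<Longrightarrow> \<exists>k a. 1 \<le> k \<and> k \<le> exponent_bound \<and> a \<in> exponents B \<and>
     (\<forall>x. \<bar>a x\<bar> \<le> int (exponent_bound * n)) \<and> h ^ k \<sim>\<^sub>v laurent B a"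
proof -
  have "\<exists>J. J \<ge> 1 \<and> (\<forall>n h. n \<ge> 1 \<and> h \<in> piece n \<and> h \<noteq> 0 \<longrightarrow>
     (\<exists>k a. 1 \<le> k \<and> k \<le> J \<and> a \<in> exponents B \<and> (\<forall>x. \<bar>a x\<bar> \<le> int (J * n)) \<and> h ^ k \<sim>\<^sub>v laurent B a))"
    by (rule bounded_value_relation, rule exI, intro conjI allI impI, assumption, elim conjE) simp
  from someI_ex[OF this] show "exponent_bound \<ge> 1"
    "n \<ge> 1 \<Longrightarrow> h \<in> piece n \<Longrightarrow> h \<noteq> 0 \<Longrightarrow> \<exists>k a. 1 \<le> k \<and> k \<le> exponent_bound \<and> a \<in> exponents B \<and>
     (\<forall>x. \<bar>a x\<bar> \<le> int (exponent_bound * n)) \<and> h ^ k \<sim>\<^sub>v laurent B a"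
    unfolding exponent_bound_def[symmetric] by blast+
qed

text \<open>A common multiple of the possible exponents: the \<open>N\<close>-th power of every nonzero element of \<open>V n\<close> has the value of a Laurent
  monomial, whose exponent vector serves as the value of the element.\<close>

definition N :: nat where "N = fact exponent_bound"

lemma N_pos: "N \<ge> 1" by (simp add: N_def fact_ge_1)

definition has_value :: "'K \<Rightarrow> ('K \<Rightarrow> int) \<Rightarrow> bool" where
  "has_value h a \<longleftrightarrow> h \<noteq> 0 \<and> a \<in> exponents B \<and> h ^ N \<sim>\<^sub>v laurent B a"

definition val :: "'K \<Rightarrow> 'K \<Rightarrow> int" where
  "val h = (THE a. has_value h a)"

lemma has_value_unique: assumes "has_value h a" "has_value h b" shows "a = b"
proof (rule laurent_equiv_imp_eq)
  have "laurent B a \<sim>\<^sub>v h ^ N" "h ^ N \<sim>\<^sub>v laurent B b"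
    using assms by (auto simp: has_value_def intro: equiv_val_sym)
  then show "laurent B a \<sim>\<^sub>v laurent B b" by (rule equiv_val_trans)
qed (use assms in \<open>auto simp: has_value_def\<close>)

lemma val_eq: "has_value h a \<Longrightarrow> val h = a"
  unfolding val_def using has_value_unique by (intro the_equality)

lemma has_value_mult: assumes "has_value h a" "has_value k b" shows "has_value (h * k) (a + b)"
  unfolding has_value_def laurent_add[OF zero_notin_B] power_mult_distrib
  using assms by (intro conjI equiv_val_mult exponents_add) (simp_all add: has_value_def)

lemma has_value_divide: assumes "has_value h a" "has_value k b" shows "has_value (h / k) (a - b)"
  unfolding has_value_def laurent_diff[OF zero_notin_B] power_divide
  using assms by (intro conjI equiv_val_divide exponents_diff) (simp_all add: has_value_def)

lemma has_value_power: assumes "has_value h a" shows "has_value (h ^ n) (\<lambda>x. int n * a x)"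
proof -
  have "(h ^ N) ^ n \<sim>\<^sub>v laurent B a ^ n" using assms by (intro equiv_val_power) (simp add: has_value_def)
  then have "(h ^ n) ^ N \<sim>\<^sub>v laurent B (\<lambda>x. int n * a x)"
    unfolding laurent_multiple by (simp only: power_mult[symmetric] mult.commute)
  moreover have "(\<lambda>x. int n * a x) \<in> exponents B" using assms by (auto simp: has_value_def exponents_def)
  ultimately show ?thesis using assms by (simp add: has_value_def)
qed

lemma has_value_equiv: assumes "has_value h a" "has_value k a" shows "h \<sim>\<^sub>v k"
proof (rule equiv_val_powerD[OF _ N_pos])
  have "h ^ N \<sim>\<^sub>v laurent B a" "laurent B a \<sim>\<^sub>v k ^ N"
    using assms by (auto simp: has_value_def intro: equiv_val_sym)
  then show "h ^ N \<sim>\<^sub>v k ^ N" by (rule equiv_val_trans)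
qed

lemma equiv_has_value: assumes "has_value h a" "h \<sim>\<^sub>v k" shows "has_value k a"
proof -
  have "k ^ N \<sim>\<^sub>v h ^ N" "h ^ N \<sim>\<^sub>v laurent B a"
    using assms by (auto simp: has_value_def intro: equiv_val_power equiv_val_sym)
  then have "k ^ N \<sim>\<^sub>v laurent B a" by (rule equiv_val_trans)
  then show ?thesis using assms by (auto simp: has_value_def equiv_val_def)
qed

lemma has_value_bounded:
  assumes "h \<in> V n" "h \<noteq> 0"
  obtains a where "has_value h a" "\<And>x. \<bar>a x\<bar> \<le> int (N * exponent_bound * n)"
proof (cases "n = 0")
  case True
  then obtain c where c: "h = \<iota> c" using assms(1) V_0 by blast
  have "h ^ N \<sim>\<^sub>v 1"
  proof -
    have "h \<sim>\<^sub>v 1" using equiv_val_scale[of 1 c] assms(2) c by simp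
    then show ?thesis using equiv_val_power[of h 1 N] by simp
  qed
  then have "has_value h 0" using assms(2) unfolding has_value_def laurent_zero by blast
  then show ?thesis by (rule that) simp
next
  case False
  have hp: "h \<in> piece n" using assms(1) V_piece by blast
  have "n \<ge> 1" using False by simp
  from exponent_bound(2)[OF this hp assms(2)]
  obtain k a where ka: "1 \<le> k" "k \<le> exponent_bound" "a \<in> exponents B" "\<And>x. \<bar>a x\<bar> \<le> int (exponent_bound * n)" "h ^ k \<sim>\<^sub>v laurent B a"
    by blast
  have "k dvd N" unfolding N_def using ka by (intro dvd_fact) auto
  then obtain q where q: "N = k * q" by auto
  have qN: "q \<le> N" using q ka(1) by simp
  have "(h ^ k) ^ q \<sim>\<^sub>v laurent B a ^ q" using ka(5) by (rule equiv_val_power)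
  then have "h ^ N \<sim>\<^sub>v laurent B (\<lambda>x. int q * a x)" unfolding laurent_multiple q by (simp only: power_mult)
  then have "has_value h (\<lambda>x. int q * a x)" using assms(2) ka(3) by (auto simp: has_value_def exponents_def)
  moreover have "\<bar>int q * a x\<bar> \<le> int (N * exponent_bound * n)" for x
  proof -
    have "\<bar>int q * a x\<bar> \<le> int N * int (exponent_bound * n)"
      unfolding abs_mult using qN ka(4) by (intro mult_mono) auto
    then show ?thesis by (simp add: mult.assoc)
  qed
  ultimately show ?thesis by (rule that)
qed

lemma has_value_val: assumes "h \<in> V n" "h \<noteq> 0" shows "has_value h (val h)"
proof (rule has_value_bounded[OF assms])
  fix a assume "has_value h a"
  then show ?thesis using val_eq by simp
qed

lemma val_bound: assumes "h \<in> V n" "h \<noteq> 0" shows "\<bar>val h x\<bar> \<le> int (N * exponent_bound * n)"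
proof (rule has_value_bounded[OF assms])
  fix a assume "has_value h a" "\<And>x. \<bar>a x\<bar> \<le> int (N * exponent_bound * n)"
  then show ?thesis using val_eq by simp
qed

lemma has_value_variable:
  assumes "b \<in> B" shows "has_value b (\<lambda>x. if x = b then int N else 0)"
proof -
  have "laurent B (\<lambda>x. if x = b then int N else 0) = (\<Prod>x\<in>B. if x = b then b ^ N else 1)"
    unfolding laurent_def by (intro prod.cong) auto
  also have "\<dots> = b ^ N" using finite_B assms by simp
  finally have eq: "laurent B (\<lambda>x. if x = b then int N else 0) = b ^ N" .
  have "b \<noteq> 0" using assms zero_notin_B by auto
  then show ?thesis unfolding has_value_def eq using assms by (auto simp: exponents_def intro: equiv_val_refl)
qed

text \<open>Elements of the function field are algebraic over \<open>k(B0)\<close>, so their values are rational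
  combinations of those of \<open>B0\<close>.\<close>

lemma function_field_value_supp:
  assumes x: "x \<in> function_field \<iota> V" and a: "has_value x a" and y: "y \<notin> B0"
  shows "a y = 0"
proof (cases "x \<in> B0")
  case True
  then have "has_value x (\<lambda>y. if y = x then int N else 0)" using has_value_variable B0_subset by blast
  then have "a = (\<lambda>y. if y = x then int N else 0)" using a has_value_unique by blast
  then show ?thesis using True y by auto
next
  case False
  let ?B = "insert x B0"
  have x0: "x \<noteq> 0" using a by (simp add: has_value_def)
  have finB: "finite ?B" "0 \<notin> ?B" using finite_B0 zero_notin_B0 x0 by auto
  have dep: "\<not> alg_independent \<iota> ?B" using B0_algebraic[OF x False] .
  have "\<exists>d. d \<in> exponents ?B \<and> d \<noteq> 0 \<and> laurent ?B d \<sim>\<^sub>v 1"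
  proof (rule alg_dependent_relation[OF finB(1) dep])
    fix X and c :: "('K \<Rightarrow> int) \<Rightarrow> 'k"
    assume X: "finite X" "X \<noteq> {}" "X \<subseteq> exponents ?B" "\<And>a. a \<in> X \<Longrightarrow> c a \<noteq> 0" "(\<Sum>a\<in>X. \<iota> (c a) * laurent ?B a) = 0"
    have "\<exists>a1\<in>X. \<exists>a2\<in>X. a1 \<noteq> a2 \<and> laurent ?B a1 \<sim>\<^sub>v laurent ?B a2"
    proof (rule ccontr)
      assume neg: "\<not> ?thesis"
      have "(\<Sum>a\<in>X. \<iota> (c a) * laurent ?B a) \<noteq> 0"
      proof (rule inequivalent_combination_nonzero[OF X(1,2) _ X(4)])
        show "laurent ?B a \<noteq> 0" for a using finB by (rule laurent_nonzero)
        show "\<not> laurent ?B i \<sim>\<^sub>v laurent ?B j" if "i \<in> X" "j \<in> X" "i \<noteq> j" for i j using neg that by blast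
      qed
      then show False using X(5) by blast
    qed
    then obtain a1 a2 where a12: "a1 \<in> X" "a2 \<in> X" "a1 \<noteq> a2" "laurent ?B a1 \<sim>\<^sub>v laurent ?B a2" by blast
    have "laurent ?B a1 / laurent ?B a2 \<sim>\<^sub>v laurent ?B a2 / laurent ?B a2"
      using a12(4) by (intro equiv_val_divide equiv_val_refl laurent_nonzero finB)
    then have "laurent ?B (a1 - a2) \<sim>\<^sub>v 1"
      unfolding laurent_diff[OF finB(2)] using laurent_nonzero[OF finB] by simp
    moreover have "a1 - a2 \<in> exponents ?B" using a12 X(3) by (intro exponents_diff) auto
    moreover have "a1 - a2 \<noteq> 0" using a12(3) by (simp only: right_minus_eq not_False_eq_True)
    ultimately show ?thesis by blast
  qed
  \<comment> \<open>The exponent \<open>d\<close> says that the \<open>d x\<close>-th power of \<open>x\<close> has the value of a monomial in \<open>B0\<close>.\<close>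
  then obtain d where d: "d \<in> exponents ?B" "d \<noteq> 0" "laurent ?B d \<sim>\<^sub>v 1" by blast
  define r where "r = (\<lambda>z. if z = x then 0 else d z)"
  have rB0: "r \<in> exponents B0" using d(1) by (auto simp: exponents_def r_def)
  have rB: "r \<in> exponents B" using rB0 exponents_mono[OF B0_subset] by blast
  have "laurent ?B d = x powi d x * (\<Prod>b\<in>B0. b powi d b)"
    using False finite_B0 by (simp add: laurent_def)
  also have "(\<Prod>b\<in>B0. b powi d b) = laurent B0 r"
    unfolding laurent_def using False by (intro prod.cong) (auto simp: r_def)
  also have "\<dots> = laurent B r" by (rule laurent_extend[OF finite_B B0_subset rB0, symmetric])
  finally have split: "laurent ?B d = x powi d x * laurent B r" .
  have "(laurent ?B d) ^ N \<sim>\<^sub>v 1 ^ N" using d(3) by (rule equiv_val_power)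
  moreover have "(laurent ?B d) ^ N = (x ^ N) powi d x * laurent B (\<lambda>z. int N * r z)"
  proof -
    have "(x powi k) ^ n = (x ^ n) powi k" for k n
      unfolding power_int_of_nat[symmetric] power_int_mult[symmetric] by (simp only: mult.commute)
    then show ?thesis unfolding split power_mult_distrib laurent_multiple by (simp only:)
  qed
  ultimately have "(x ^ N) powi d x * laurent B (\<lambda>z. int N * r z) \<sim>\<^sub>v 1" by simp
  moreover have "(x ^ N) powi d x * laurent B (\<lambda>z. int N * r z) \<sim>\<^sub>v laurent B a powi d x * laurent B (\<lambda>z. int N * r z)"
    using a unfolding has_value_def by (intro equiv_val_mult equiv_val_power_int equiv_val_refl laurent_nz) blast
  ultimately have "laurent B a powi d x * laurent B (\<lambda>z. int N * r z) \<sim>\<^sub>v 1"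
    by (rule_tac equiv_val_trans[OF equiv_val_sym])
  then have "laurent B ((\<lambda>z. d x * a z) + (\<lambda>z. int N * r z)) \<sim>\<^sub>v 1"
    unfolding laurent_power_int laurent_add[OF zero_notin_B] .
  moreover have "(\<lambda>z. d x * a z) + (\<lambda>z. int N * r z) \<in> exponents B"
  proof (rule exponents_add)
    show "(\<lambda>z. d x * a z) \<in> exponents B" using a by (simp add: has_value_def exponents_def)
    show "(\<lambda>z. int N * r z) \<in> exponents B" using rB by (simp add: exponents_def)
  qed
  ultimately have z0: "(\<lambda>z. d x * a z) + (\<lambda>z. int N * r z) = 0" by (rule_tac laurent_trivial)
  have e: "d x * a z + int N * r z = 0" for z using fun_cong[OF z0, of z] by simp
  have "d x \<noteq> 0"
  proof
    assume "d x = 0"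
    then have r0: "r z = 0" for z using e[of z] N_pos by simp
    have "d z = 0" for z using \<open>d x = 0\<close> r0[of z] by (cases "z = x") (simp_all add: r_def)
    then have "d = 0" by (intro ext) simp
    then show False using d(2) by blast
  qed
  moreover have "r y = 0" using rB0 y by (simp add: exponents_def)
  ultimately show ?thesis using e[of y] by simp
qed

end

text \<open>The degrees that occur are multiples of \<open>g\<close>, and \<open>f1 / f2\<close> is a homogeneous element of degree \<open>g\<close>. Dividing
  by its powers moves all pieces of \<open>V\<close> into the function field.\<close>

locale normalized_series = series_valuation \<iota> V A B S B0
  for \<iota> :: "'k::field \<Rightarrow> 'K::field" and V A B S B0 +
  fixes g s :: nat and f1 f2 :: 'K
  assumes g_pos: "g \<ge> 1" and g_dvd: "V n \<noteq> {0} \<Longrightarrow> g dvd n"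
    and f1: "f1 \<in> V (s + g)" "f1 \<noteq> 0" and f2: "f2 \<in> V s" "f2 \<noteq> 0"
begin

definition w :: "'K \<Rightarrow> int" where
  "w = val f1 - val f2"

definition level_val :: "nat \<Rightarrow> 'K \<Rightarrow> 'K \<Rightarrow> int" where
  "level_val m f = (\<lambda>x. val f x - int m * w x)"

text \<open>The values in degree \<open>g m\<close>, translated by the value of the \<open>m\<close>-th power of an element of degree \<open>g\<close>.\<close>

definition values_of :: "(nat \<Rightarrow> 'K set) \<Rightarrow> nat \<Rightarrow> ('K \<Rightarrow> int) set" where
  "values_of W m = level_val m ` (W (g * m) - {0})"

lemma has_value_f1: "has_value f1 (val f1)" and has_value_f2: "has_value f2 (val f2)"
  using has_value_val f1 f2 by blast+

lemma val_inj: "level_val m f = level_val m f' \<Longrightarrow> val f = val f'"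
  by (auto simp: level_val_def fun_eq_iff)

text \<open>The quotient of \<open>f\<close> by the \<open>m\<close>-th power of \<open>f1 / f2\<close>, written as a fraction of two elements of equal degree.\<close>

lemma fraction_value:
  assumes f: "f \<in> V (g * m)" "f \<noteq> 0"
  shows "f * f2 ^ m \<in> V (m * (s + g))" "f1 ^ m \<in> V (m * (s + g))"
    "has_value (f * f2 ^ m) (val f + (\<lambda>x. int m * val f2 x))"
    "has_value (f1 ^ m) (\<lambda>x. int m * val f1 x)"
    "level_val m f = (val f + (\<lambda>x. int m * val f2 x)) - (\<lambda>x. int m * val f1 x)"
proof -
  have "f * f2 ^ m \<in> V (g * m + m * s)" using f f2 by (intro V_mult V_power)
  moreover have "g * m + m * s = m * (s + g)" by (simp add: algebra_simps)
  ultimately show "f * f2 ^ m \<in> V (m * (s + g))" by (simp only:)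
  show "f1 ^ m \<in> V (m * (s + g))" using f1 by (intro V_power)
  show "has_value (f * f2 ^ m) (val f + (\<lambda>x. int m * val f2 x))"
    using has_value_val[OF f] has_value_f2 by (intro has_value_mult has_value_power)
  show "has_value (f1 ^ m) (\<lambda>x. int m * val f1 x)" using has_value_f1 by (rule has_value_power)
  show "level_val m f = (val f + (\<lambda>x. int m * val f2 x)) - (\<lambda>x. int m * val f1 x)"
    by (rule ext) (simp add: level_val_def w_def algebra_simps)
qed

lemma level_val_supp:
  assumes f: "f \<in> V (g * m)" "f \<noteq> 0" and x: "x \<notin> B0"
  shows "level_val m f x = 0"
proof (rule function_field_value_supp[OF _ _ x])
  note fv = fraction_value[OF f]
  show "(f * f2 ^ m) / (f1 ^ m) \<in> function_field \<iota> V"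
    using fv(1,2) f1(2) by (intro fraction_in_function_field) auto
  show "has_value ((f * f2 ^ m) / (f1 ^ m)) (level_val m f)"
    unfolding fv(5) using fv(3,4) by (rule has_value_divide)
qed

lemma level_val_mult:
  assumes "f \<in> V (g * m)" "f \<noteq> 0" "h \<in> V (g * n)" "h \<noteq> 0"
  shows "level_val (m + n) (f * h) = level_val m f + level_val n h"
proof -
  have "has_value (f * h) (val f + val h)" using assms has_value_val by (intro has_value_mult) auto
  then have "val (f * h) = val f + val h" by (rule val_eq)
  then show ?thesis by (intro ext) (simp add: level_val_def algebra_simps)
qed

lemma level_val_one: "level_val 0 1 = 0"
proof -
  have "has_value 1 0" unfolding has_value_def laurent_zero by (auto intro: equiv_val_refl)
  then have "val 1 = 0" by (rule val_eq)
  then show ?thesis by (intro ext) (simp add: level_val_def)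
qed

lemma s_dvd: obtains t where "s = g * t"
  using g_dvd[of s] f2 V_nonzero_iff by blast

definition C :: nat where
  "C = N * exponent_bound * g + nat (\<Sum>x\<in>B. \<bar>w x\<bar>)"

lemma level_val_bound:
  assumes "f \<in> V (g * m)" "f \<noteq> 0" shows "\<bar>level_val m f x\<bar> \<le> int (C * m)"
proof -
  have w: "\<bar>w x\<bar> \<le> (\<Sum>x\<in>B. \<bar>w x\<bar>)"
  proof (cases "x \<in> B")
    case True
    then show ?thesis using finite_B by (intro member_le_sum) auto
  next
    case False
    then have "w x = 0" using has_value_f1 has_value_f2 by (simp add: w_def has_value_def exponents_def)
    then show ?thesis by (simp add: sum_nonneg)
  qed
  have "\<bar>level_val m f x\<bar> \<le> \<bar>val f x\<bar> + \<bar>int m * w x\<bar>" by (simp add: level_val_def)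
  also have "\<dots> \<le> int (N * exponent_bound * (g * m)) + int m * (\<Sum>x\<in>B. \<bar>w x\<bar>)"
    unfolding abs_mult using val_bound[OF assms] w by (intro add_mono mult_mono) auto
  also have "\<dots> = int (C * m)" by (simp add: C_def algebra_simps sum_nonneg)
  finally show ?thesis .
qed

lemma nonzero_degree: assumes "f \<in> V n" "f \<noteq> 0" obtains m where "n = g * m"
  using g_dvd[of n] assms V_nonzero_iff by blast

sublocale \<Gamma>: bounded_semigroup B0 "values_of V" C
proof
  show "finite B0" by (rule finite_B0)
  show "0 \<in> values_of V 0"
    unfolding values_of_def using V_one level_val_one by (intro image_eqI[of _ _ 1]) auto
next
  fix x y m n assume "x \<in> values_of V m" "y \<in> values_of V n"
  then obtain f h where fh: "f \<in> V (g * m)" "f \<noteq> 0" "x = level_val m f" "h \<in> V (g * n)" "h \<noteq> 0" "y = level_val n h"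
    unfolding values_of_def by blast
  have "f * h \<in> V (g * (m + n)) - {0}" using V_mult[OF fh(1,4)] fh by (simp add: algebra_simps)
  then have "level_val (m + n) (f * h) \<in> values_of V (m + n)" unfolding values_of_def by (rule imageI)
  then show "x + y \<in> values_of V (m + n)" by (simp only: level_val_mult[OF fh(1,2,4,5)] fh(3,6))
next
  fix z n i assume "z \<in> values_of V n"
  then obtain f where "f \<in> V (g * n)" "f \<noteq> 0" "z = level_val n f" unfolding values_of_def by blast
  then show "i \<notin> B0 \<Longrightarrow> z i = 0" "\<bar>z i\<bar> \<le> int (C * n)" using level_val_supp level_val_bound by blast+
qed

sublocale \<Gamma>: full_semigroup B0 "values_of V" C N
proof
  show "N \<ge> 1" by (rule N_pos)
next
  fix b assume b: "b \<in> B0"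
  then have "b \<in> function_field \<iota> V" using B0_function_field by blast
  then obtain f h n where fh: "n \<ge> 1" "f \<in> V n" "h \<in> V n" "h \<noteq> 0" "b = f / h"
    using function_field_fraction nontrivial by metis
  have "b \<noteq> 0" using b zero_notin_B0 by auto
  then have f0: "f \<noteq> 0" using fh by auto
  obtain m where m: "n = g * m" using fh by (auto elim: nonzero_degree)
  have "has_value b (val f - val h)" unfolding fh(5) using has_value_val fh f0 by (intro has_value_divide) auto
  then have "(\<lambda>j. if j = b then int N else 0) = val f - val h"
    using has_value_variable[of b] b B0_subset has_value_unique by blast
  also have "\<dots> = level_val m f - level_val m h" by (rule ext) (simp add: level_val_def)
  finally have eq: "(\<lambda>j. if j = b then int N else 0) = level_val m f - level_val m h" .
  have "level_val m f \<in> values_of V m" "level_val m h \<in> values_of V m"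
    unfolding values_of_def using fh f0 m by auto
  then show "(\<lambda>j. if j = b then int N else 0) \<in> \<Gamma>.differences" unfolding \<Gamma>.differences_def eq by blast
next
  obtain t where t: "s = g * t" by (rule s_dvd)
  have "level_val t f2 \<in> values_of V t" "level_val (Suc t) f1 \<in> values_of V (Suc t)"
    unfolding values_of_def using f1 f2 t by (auto simp: algebra_simps)
  then show "\<exists>t. values_of V t \<noteq> {} \<and> values_of V (Suc t) \<noteq> {}" by blast
next
  fix z m assume "z \<in> values_of V m"
  then obtain f where f: "f \<in> V (g * m)" "f \<noteq> 0" "z = level_val m f" unfolding values_of_def by blast
  obtain t where t: "s = g * t" by (rule s_dvd)
  note fv = fraction_value[OF f(1,2)]
  define m' where "m' = m * (t + 1)"
  have deg: "m * (s + g) = g * m'" by (simp add: m'_def t algebra_simps)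
  have "level_val m' (f * f2 ^ m) \<in> values_of V m'" "level_val m' (f1 ^ m) \<in> values_of V m'"
    unfolding values_of_def using fv(1,2) f(2) f1(2) f2(2) by (auto simp flip: deg)
  moreover have "z = level_val m' (f * f2 ^ m) - level_val m' (f1 ^ m)"
    unfolding f(3) fv(5) level_val_def val_eq[OF fv(3)] val_eq[OF fv(4)] by (rule ext) (simp add: w_def algebra_simps)
  ultimately show "z \<in> \<Gamma>.differences" unfolding \<Gamma>.differences_def by blast
qed

lemma leaf_system_mono: "leaf_system U y l h \<Longrightarrow> U \<subseteq> U' \<Longrightarrow> leaf_system U' y l h"
  unfolding leaf_system_def by blast

text \<open>Leaf dimensions are bounded on all of \<open>V\<close>, so the largest one is attained. Its value \<open>y\<close> can be taken in \<open>V\<close>,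
  and the degree is a multiple of \<open>g\<close> because \<open>y\<close> is nonzero.\<close>

lemma maximal_leaf_system:
  obtains e m y h where "e \<ge> 1" "y \<in> V (g * m)" "y \<noteq> 0" "leaf_system (V (g * m)) y e h"
    "\<And>n y l h. n \<ge> 1 \<Longrightarrow> leaf_system (V n) y l h \<Longrightarrow> l \<le> e"
proof -
  obtain e0 where e0: "\<And>n y l h. n \<ge> 1 \<Longrightarrow> leaf_system (piece n) y l h \<Longrightarrow> l \<le> e0"
    by (rule leaf_system_bound) (rule that)
  define L where "L = {l. \<exists>n y h. n \<ge> 1 \<and> leaf_system (V n) y l h}"
  have le: "l \<le> e0" if "l \<in> L" for l
  proof -
    obtain n y h where nyh: "n \<ge> 1" "leaf_system (V n) y l h" using \<open>l \<in> L\<close> unfolding L_def by blast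
    show ?thesis using e0[OF nyh(1) leaf_system_mono[OF nyh(2) V_piece]] .
  qed
  then have finL: "finite L" by (meson finite_nat_set_iff_bounded_le)
  obtain n0 f0 where f0: "n0 \<ge> 1" "f0 \<in> V n0" "f0 \<noteq> 0" using nontrivial V_nonzero_iff by blast
  have "leaf_system (V n0) f0 1 (\<lambda>_. f0)"
    unfolding leaf_system_def using f0 by (auto intro: equiv_val_scale)
  then have one: "1 \<in> L" unfolding L_def using f0(1) by blast
  define e where "e = Max L"
  have "e \<in> L" unfolding e_def using finL one by (intro Max_in) auto
  then obtain n y h where nyh: "n \<ge> 1" "leaf_system (V n) y e h" unfolding L_def by blast
  have e1: "e \<ge> 1" unfolding e_def using finL one by (intro Max_ge)
  have h0V: "h 0 \<in> V n" using nyh(2) e1 by (simp add: leaf_system_def)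
  have "(\<Sum>i<e. \<iota> (if i = 0 then 1 else 0) * h i) \<sim>\<^sub>v y"
    by (rule leaf_systemD[OF nyh(2), of 0]) (use e1 in auto)
  moreover have "(\<Sum>i<e. \<iota> (if i = 0 then 1 else 0) * h i) = (\<Sum>i<e. if i = 0 then h i else 0)"
    by (intro sum.cong) auto
  moreover have "\<dots> = h 0" using e1 by simp
  ultimately have h0: "h 0 \<sim>\<^sub>v y" by simp
  then have "h 0 \<noteq> 0" by (simp add: equiv_val_def)
  obtain m where m: "n = g * m" using h0V \<open>h 0 \<noteq> 0\<close> by (rule nonzero_degree)
  show ?thesis
  proof (rule that[of e "h 0" m h])
    show "leaf_system (V (g * m)) (h 0) e h"
      using leaf_system_equiv[OF nyh(2) equiv_val_sym[OF h0]] m by simp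
    fix n y l h assume "n \<ge> 1" "leaf_system (V n) y l h"
    then have "l \<in> L" unfolding L_def by blast
    then show "l \<le> e" unfolding e_def using finL by (intro Max_ge)
  qed (use e1 h0V \<open>h 0 \<noteq> 0\<close> m in auto)
qed

definition rep :: "(nat \<Rightarrow> 'K set) \<Rightarrow> nat \<Rightarrow> ('K \<Rightarrow> int) \<Rightarrow> 'K" where
  "rep W m z = (SOME f. f \<in> W (g * m) \<and> f \<noteq> 0 \<and> level_val m f = z)"

lemma rep: assumes "z \<in> values_of W m" shows "rep W m z \<in> W (g * m)" "rep W m z \<noteq> 0" "level_val m (rep W m z) = z"
proof -
  have "rep W m z \<in> W (g * m) \<and> rep W m z \<noteq> 0 \<and> level_val m (rep W m z) = z"
    unfolding rep_def by (rule someI_ex) (use assms in \<open>auto simp: values_of_def\<close>)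
  then show "rep W m z \<in> W (g * m)" "rep W m z \<noteq> 0" "level_val m (rep W m z) = z" by auto
qed

lemma dim_upper:
  assumes e: "\<And>n y l h. n \<ge> 1 \<Longrightarrow> leaf_system (V n) y l h \<Longrightarrow> l \<le> e" and m: "m \<ge> 1"
  shows "vs.dim (V (g * m)) \<le> e * card (values_of V m)"
proof -
  obtain T where T: "finite T" "V (g * m) = vs.span T" using V_span by blast
  have "vs.dim (V (g * m)) \<le> e * card (rep V m ` values_of V m)"
  proof (rule dim_le_leaf_bound[OF V_subspace T(1)])
    show "V (g * m) \<subseteq> vs.span T" using T(2) by simp
    show "finite (rep V m ` values_of V m)" by (intro finite_imageI \<Gamma>.finite_level)
    show "\<exists>y\<in>rep V m ` values_of V m. x \<sim>\<^sub>v y" if x: "x \<in> V (g * m)" "x \<noteq> 0" for x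
    proof -
      have z: "level_val m x \<in> values_of V m" using x by (auto simp: values_of_def)
      note r = rep[OF z]
      have "val (rep V m (level_val m x)) = val x" using r(3) by (rule val_inj)
      then have "x \<sim>\<^sub>v rep V m (level_val m x)"
        using has_value_equiv[of x "val x"] has_value_val[OF x] has_value_val[OF r(1,2)] by simp
      then show ?thesis using z by blast
    qed
    show "l \<le> e" if "leaf_system (V (g * m)) y l h" for y l h
      using e[of "g * m"] that m g_pos by simp
  qed
  also have "\<dots> \<le> e * card (values_of V m)" by (intro mult_left_mono card_image_le \<Gamma>.finite_level) simp
  finally show ?thesis .
qed

text \<open>Multiplying a leaf system of maximal size by elements of \<open>W\<close> of all values makes every leaf maximal after a
  translation of the degree.\<close>

lemma dim_lower:
  assumes W: "\<And>n. W n \<subseteq> V n" "\<And>f h m n. f \<in> W m \<Longrightarrow> h \<in> W n \<Longrightarrow> f * h \<in> W (m + n)"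
    and y: "y \<in> V (g * m1)" "y \<noteq> 0" and h: "leaf_system (V (g * m1)) y e h" "V (g * m1) \<subseteq> W (g * m1)"
  shows "e * card (values_of W m) \<le> vs.dim (W (g * (m + m1)))"
proof -
  obtain T where T: "finite T" "V (g * (m + m1)) = vs.span T" using V_span by blast
  have sub: "values_of W m \<subseteq> values_of V m" using W(1) unfolding values_of_def by blast
  show ?thesis
  proof (rule leaf_systems_dim[where f = "\<lambda>z. rep W m z * y" and T = T])
    show "finite (values_of W m)" using sub \<Gamma>.finite_level by (rule finite_subset)
    show "finite T" by (rule T(1))
    show "W (g * (m + m1)) \<subseteq> vs.span T" using W(1) T(2) by blast
    fix z assume z: "z \<in> values_of W m"
    note r = rep[OF z]
    have "leaf_system (W (g * (m + m1))) (rep W m z * y) e (\<lambda>i. rep W m z * h i)"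
    proof (rule leaf_system_mult[OF h(1) r(2)])
      fix u assume "u \<in> V (g * m1)"
      then have "rep W m z * u \<in> W (g * m + g * m1)" using W(2) r(1) h(2) by blast
      then show "rep W m z * u \<in> W (g * (m + m1))" by (simp add: algebra_simps)
    qed
    then show "\<exists>h. leaf_system (W (g * (m + m1))) (rep W m z * y) e h" by blast
  next
    fix z z' assume z: "z \<in> values_of W m" "z' \<in> values_of W m" "z \<noteq> z'"
    note r = rep[OF z(1)] and r' = rep[OF z(2)]
    show "\<not> rep W m z * y \<sim>\<^sub>v rep W m z' * y"
    proof
      assume "rep W m z * y \<sim>\<^sub>v rep W m z' * y"
      then have "rep W m z * y / y \<sim>\<^sub>v rep W m z' * y / y" using y(2) by (intro equiv_val_divide equiv_val_refl)
      then have eq: "rep W m z \<sim>\<^sub>v rep W m z'" using y(2) by simp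
      have "rep W m z \<in> V (g * m)" "rep W m z' \<in> V (g * m)" using r(1) r'(1) W(1) by auto
      then have "has_value (rep W m z) (val (rep W m z))" "has_value (rep W m z') (val (rep W m z'))"
        using r(2) r'(2) has_value_val by blast+
      then have "val (rep W m z) = val (rep W m z')" using equiv_has_value[OF _ eq] has_value_unique by blast
      then have "z = z'" using r(3) r'(3) unfolding level_val_def by metis
      then show False using z(3) by simp
    qed
  qed
qed

theorem normalized_growth:
  obtains a K :: real where "a > 0" "K \<ge> 0"
    "\<And>m. m \<ge> 1 \<Longrightarrow> real (vs.dim (V (g * m))) \<le> a * real m ^ card B0 + real (card B0) * K * real m ^ (card B0 - 1)"
    "\<And>\<epsilon>. \<epsilon> > 0 \<Longrightarrow> \<exists>M. \<forall>W. agrees_up_to M W V \<longrightarrow> growth_at_least (card B0) (\<lambda>m. real (vs.dim (W (g * m)))) (a - \<epsilon>)"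
proof -
  obtain e m1 y h where e: "e \<ge> 1" and y: "y \<in> V (g * m1)" "y \<noteq> 0" "leaf_system (V (g * m1)) y e h"
    and emax: "\<And>n y l h. n \<ge> 1 \<Longrightarrow> leaf_system (V n) y l h \<Longrightarrow> l \<le> e"
    by (rule maximal_leaf_system) (rule that)
  define lam where "lam = \<Gamma>.density / real (card \<Gamma>.coset_reps)"
  have lpos: "lam > 0" using \<Gamma>.density_pos \<Gamma>.card_coset_reps_pos by (simp add: lam_def)
  obtain K where K: "K \<ge> 0" "\<And>n. n \<ge> 1 \<Longrightarrow> real (card (values_of V n)) \<le> lam * real n ^ card B0 + real (card B0) * K * real n ^ (card B0 - 1)"
    by (rule \<Gamma>.card_level_le[folded lam_def]) (rule that)
  show ?thesis
  proof (rule that[of "real e * lam" "real e * K"])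
    show "real e * lam > 0" using e lpos by simp
    show "real e * K \<ge> 0" using K(1) by simp
    fix m :: nat assume m: "m \<ge> 1"
    have "real (vs.dim (V (g * m))) \<le> real (e * card (values_of V m))"
      using dim_upper[OF emax m] by (simp only: of_nat_le_iff)
    also have "\<dots> \<le> real e * (lam * real m ^ card B0 + real (card B0) * K * real m ^ (card B0 - 1))"
      using K(2)[OF m] by (simp add: mult_left_mono)
    also have "\<dots> = real e * lam * real m ^ card B0 + real (card B0) * (real e * K) * real m ^ (card B0 - 1)"
      by (simp add: algebra_simps)
    finally show "real (vs.dim (V (g * m))) \<le> real e * lam * real m ^ card B0 + real (card B0) * (real e * K) * real m ^ (card B0 - 1)" .
  next
    fix \<epsilon> :: real assume eps: "\<epsilon> > 0"
    have "\<epsilon> / real e > 0" using eps e by simp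
    from \<Gamma>.subsemigroup_growth[folded lam_def, OF this]
    obtain M0 where M0: "\<forall>\<Gamma>'. 0 \<in> \<Gamma>' 0 \<and> (\<forall>m n. \<forall>x\<in>\<Gamma>' m. \<forall>y\<in>\<Gamma>' n. x + y \<in> \<Gamma>' (m + n)) \<and>
      (\<forall>n. \<Gamma>' n \<subseteq> values_of V n) \<and> (\<forall>n\<le>M0. values_of V n \<subseteq> \<Gamma>' n) \<longrightarrow>
      growth_at_least (card B0) (\<lambda>n. real (card (\<Gamma>' n))) (lam - \<epsilon> / real e)"
      by (rule exE)
    show "\<exists>M. \<forall>W. agrees_up_to M W V \<longrightarrow> growth_at_least (card B0) (\<lambda>m. real (vs.dim (W (g * m)))) (real e * lam - \<epsilon>)"
    proof (intro exI[of _ "g * (M0 + m1)"] allI impI)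
      fix W assume "agrees_up_to (g * (M0 + m1)) W V"
      then have W: "1 \<in> W 0" "\<And>n. W n \<subseteq> V n" "\<And>f h m n. f \<in> W m \<Longrightarrow> h \<in> W n \<Longrightarrow> f * h \<in> W (m + n)"
        "\<And>n. n \<le> g * (M0 + m1) \<Longrightarrow> V n \<subseteq> W n" unfolding agrees_up_to_def by blast+
      have "growth_at_least (card B0) (\<lambda>n. real (card (values_of W n))) (lam - \<epsilon> / real e)"
      proof (rule M0[rule_format], intro conjI allI ballI impI)
        show "0 \<in> values_of W 0"
          unfolding values_of_def using W(1) level_val_one by (intro image_eqI[of _ _ 1]) auto
        show "values_of W n \<subseteq> values_of V n" for n using W(2) unfolding values_of_def by blast
        show "values_of V n \<subseteq> values_of W n" if "n \<le> M0" for n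
          using W(4)[of "g * n"] that unfolding values_of_def by auto
        fix x y m n assume "x \<in> values_of W m" "y \<in> values_of W n"
        then obtain f h where fh: "f \<in> W (g * m)" "f \<noteq> 0" "x = level_val m f" "h \<in> W (g * n)" "h \<noteq> 0" "y = level_val n h"
          unfolding values_of_def by blast
        have "f * h \<in> W (g * (m + n)) - {0}" using W(3)[OF fh(1,4)] fh by (simp add: algebra_simps)
        moreover have "level_val (m + n) (f * h) = x + y"
          unfolding fh(3,6) using fh W(2) by (intro level_val_mult) auto
        ultimately show "x + y \<in> values_of W (m + n)" unfolding values_of_def by (metis imageI)
      qed
      then have "growth_at_least (card B0) (\<lambda>n. real e * real (card (values_of W n))) (real e * (lam - \<epsilon> / real e))"
        using e by (intro growth_at_least_mult) auto
      moreover have "real e * (lam - \<epsilon> / real e) = real e * lam - \<epsilon>" using e by (simp add: algebra_simps)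
      ultimately have "growth_at_least (card B0) (\<lambda>n. real e * real (card (values_of W n))) (real e * lam - \<epsilon>)" by simp
      then have gr: "growth_at_least (card B0) (\<lambda>n. real e * real (card (values_of W (n - m1)))) (real e * lam - \<epsilon>)"
        by (rule growth_at_least_shift)
      show "growth_at_least (card B0) (\<lambda>m. real (vs.dim (W (g * m)))) (real e * lam - \<epsilon>)"
      proof (rule growth_at_least_mono[OF gr])
        show "\<forall>\<^sub>F m in sequentially. real e * real (card (values_of W (m - m1))) \<le> real (vs.dim (W (g * m)))"
          using eventually_ge_at_top[of m1]
        proof eventually_elim
          case (elim m)
          have "V (g * m1) \<subseteq> W (g * m1)" by (intro W(4)) simp
          then have "e * card (values_of W (m - m1)) \<le> vs.dim (W (g * (m - m1 + m1)))"
            by (intro dim_lower[OF W(2) W(3) y])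
          then have "e * card (values_of W (m - m1)) \<le> vs.dim (W (g * m))" using elim by simp
          then show ?case by (metis of_nat_le_iff of_nat_mult)
        qed
      qed
    qed
  qed
qed

end

text \<open>The period \<open>g\<close> is the smallest positive difference between two degrees that occur. A degree not divisible by \<open>g\<close>
  would produce a smaller difference.\<close>

theorem (in graded_series) dimension_growth:
  assumes sub: "subfinite_type \<iota> V" and tr: "trdeg \<iota> (function_field \<iota> V) = enat d"
    and ne: "\<exists>n\<ge>1. V n \<noteq> {0}"
  obtains g and a K :: real where "g \<ge> 1" "\<And>n. V n \<noteq> {0} \<Longrightarrow> g dvd n" "a > 0" "K \<ge> 0"
    "\<And>m. m \<ge> 1 \<Longrightarrow> real (vs.dim (V (g * m))) \<le> a * real m ^ d + real d * K * real m ^ (d - 1)"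
    "\<And>\<epsilon>. \<epsilon> > 0 \<Longrightarrow> \<exists>M. \<forall>W. agrees_up_to M W V \<longrightarrow> growth_at_least d (\<lambda>m. real (vs.dim (W (g * m)))) (a - \<epsilon>)"
proof -
  obtain W0 where W0: "graded_linear_series \<iota> W0" "finite_type \<iota> W0" "contained_in V W0"
    using sub unfolding subfinite_type_def by blast
  obtain S0 where S0: "finite S0" "\<And>n. W0 n \<subseteq> vs.span (products_upto S0 n)"
    by (rule finite_type_products[OF W0(1,2)]) (rule that)
  obtain B0 where B0: "finite B0" "B0 \<subseteq> function_field \<iota> V" "alg_independent \<iota> B0" "card B0 = d"
    "\<And>x. x \<in> function_field \<iota> V \<Longrightarrow> x \<notin> B0 \<Longrightarrow> \<not> alg_independent \<iota> (insert x B0)"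
    by (rule trdeg_basis[OF tr]) (rule that)
  obtain B where B: "B0 \<subseteq> B" "B \<subseteq> B0 \<union> S0" "alg_independent \<iota> B"
    "\<And>s. s \<in> B0 \<union> S0 \<Longrightarrow> s \<notin> B \<Longrightarrow> \<not> alg_independent \<iota> (insert s B)"
    by (rule extend_to_maximal_independent[OF B0(1,3) S0(1)]) (rule that)
  have finB: "finite B" using B(2) B0(1) S0(1) by (meson finite_UnI finite_subset)
  obtain A where A: "valuation_ring \<iota> A"
    "\<And>a. a \<in> exponents B \<Longrightarrow> valuation_ring.equiv_val A (laurent B a) 1 \<Longrightarrow> a = 0"
    by (rule adapted_valuation_ring[OF finB B(3)]) (rule that)
  interpret A: valuation_ring \<iota> A by (rule A(1))
  interpret A: adapted_valuation \<iota> A B "B0 \<union> S0"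
    by unfold_locales (use B0(1) S0(1) B A(2) in auto)
  have mono: "products_upto S0 n \<subseteq> products_upto (B0 \<union> S0) n" for n
    by (induction n) auto
  interpret A: series_valuation \<iota> V A B "B0 \<union> S0" B0
  proof
    fix n
    have "V n \<subseteq> vs.span (products_upto S0 n)" using W0(3) S0(2) unfolding contained_in_def by blast
    also have "\<dots> \<subseteq> vs.span (products_upto (B0 \<union> S0) n)" by (rule vs.span_mono[OF mono])
    finally show "V n \<subseteq> A.piece n" unfolding A.piece_def .
  qed (use B B0 ne in auto)
  define gap where "gap g \<longleftrightarrow> g > 0 \<and> (\<exists>s. V s \<noteq> {0} \<and> V (s + g) \<noteq> {0})" for g
  obtain n0 where n0: "n0 \<ge> 1" "V n0 \<noteq> {0}" using ne by blast
  have "V 0 \<noteq> {0}" using V_one V_nonzero_iff[of 0] by (metis zero_neq_one)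
  then have "gap n0" using n0 unfolding gap_def by (intro conjI exI[of _ 0]) auto
  define g where "g = (LEAST g. gap g)"
  have gap: "gap g" unfolding g_def using \<open>gap n0\<close> by (rule LeastI)
  have least: "g \<le> r" if "gap r" for r unfolding g_def using that by (rule Least_le)
  have deg_mult: "V (m + n) \<noteq> {0}" if mn: "V m \<noteq> {0}" "V n \<noteq> {0}" for m n
  proof -
    obtain f where "f \<in> V m" "f \<noteq> 0" using mn(1) V_nonzero_iff by blast
    moreover obtain h where "h \<in> V n" "h \<noteq> 0" using mn(2) V_nonzero_iff by blast
    ultimately have "f * h \<in> V (m + n)" "f * h \<noteq> 0" using V_mult by auto
    then show ?thesis using V_nonzero_iff by blast
  qed
  have deg_power: "V (q * n) \<noteq> {0}" if n: "V n \<noteq> {0}" for n q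
  proof -
    obtain f where "f \<in> V n" "f \<noteq> 0" using n V_nonzero_iff by blast
    then have "f ^ q \<in> V (q * n)" "f ^ q \<noteq> 0" using V_power by auto
    then show ?thesis using V_nonzero_iff by blast
  qed
  obtain s where s: "V s \<noteq> {0}" "V (s + g) \<noteq> {0}" and gpos: "g > 0" using gap unfolding gap_def by blast
  have gdvd: "g dvd n" if n: "V n \<noteq> {0}" for n
  proof (rule ccontr)
    assume "\<not> g dvd n"
    then have r: "n mod g > 0" by (simp add: mod_greater_zero_iff_not_dvd)
    have eq: "n + n div g * s = n div g * (s + g) + n mod g"
      using div_mult_mod_eq[of n g] by (simp add: algebra_simps)
    have "V (n div g * (s + g) + n mod g) \<noteq> {0}" using deg_mult[OF n deg_power[OF s(1), of "n div g"]] by (simp only: eq not_False_eq_True)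
    moreover have "V (n div g * (s + g)) \<noteq> {0}" by (rule deg_power[OF s(2)])
    ultimately have "gap (n mod g)" using r unfolding gap_def by (intro conjI exI)
    then have "g \<le> n mod g" by (rule least)
    moreover have "n mod g < g" using gpos by simp
    ultimately show False by linarith
  qed
  obtain f1 where f1: "f1 \<in> V (s + g)" "f1 \<noteq> 0" using s(2) V_nonzero_iff by blast
  obtain f2 where f2: "f2 \<in> V s" "f2 \<noteq> 0" using s(1) V_nonzero_iff by blast
  interpret A: normalized_series \<iota> V A B "B0 \<union> S0" B0 g s f1 f2
    by unfold_locales (use gpos gdvd f1 f2 in auto)
  obtain a K :: real where aK: "a > 0" "K \<ge> 0"
    "\<And>m. m \<ge> 1 \<Longrightarrow> real (vs.dim (V (g * m))) \<le> a * real m ^ card B0 + real (card B0) * K * real m ^ (card B0 - 1)"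
    "\<And>\<epsilon>. \<epsilon> > 0 \<Longrightarrow> \<exists>M. \<forall>W. agrees_up_to M W V \<longrightarrow> growth_at_least (card B0) (\<lambda>m. real (vs.dim (W (g * m)))) (a - \<epsilon>)"
    by (rule A.normalized_growth) (rule that)
  show ?thesis
    by (rule that[of g a K, OF _ gdvd aK[unfolded B0(4)]]) (use gpos in auto)
qed

section \<open>Volumes\<close>

text \<open>The degrees divisible by \<open>g\<close> already give the lower bound, whatever happens in the other degrees.\<close>

lemma limsup_ge_growth:
  fixes D :: "nat \<Rightarrow> real"
  assumes gr: "growth_at_least d (\<lambda>m. D (g * m)) b" and g: "g \<ge> 1"
  shows "ereal (fact d * b / real g ^ d) \<le> limsup (\<lambda>n. ereal (D n / (real n ^ d / fact d)))"
proof (rule ereal_le_epsilon2)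
    fix e :: real assume e: "e > 0"
    define \<epsilon> where "\<epsilon> = e * real g ^ d / fact d"
    have eps: "\<epsilon> > 0" using e g by (simp add: \<epsilon>_def)
    define X where "X = (\<lambda>n. ereal (D n / (real n ^ d / fact d)))"
    have "\<forall>\<^sub>F m in sequentially. D (g * m) \<ge> (b - \<epsilon>) * real m ^ d"
      using gr eps by (auto simp: growth_at_least_def)
    then have "\<forall>\<^sub>F m in sequentially. ereal (fact d * b / real g ^ d - e) \<le> (X \<circ> (\<lambda>m. g * m)) m"
      using eventually_gt_at_top[of 0]
    proof eventually_elim
      case (elim m)
      have gm: "real (g * m) ^ d > 0" using elim g by simp
      have "fact d * b / real g ^ d - e = fact d * ((b - \<epsilon>) * real m ^ d) / real (g * m) ^ d"
        using elim g by (simp add: \<epsilon>_def power_mult_distrib field_simps)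
      also have "\<dots> \<le> fact d * D (g * m) / real (g * m) ^ d"
        using elim gm by (intro divide_right_mono mult_left_mono) auto
      also have "\<dots> = D (g * m) / (real (g * m) ^ d / fact d)" by simp
      finally show ?case by (simp add: X_def)
    qed
    then have "ereal (fact d * b / real g ^ d - e) \<le> limsup (X \<circ> (\<lambda>m. g * m))"
      by (intro le_Limsup) simp_all
    also have "\<dots> \<le> limsup X" using g by (intro limsup_subseq_mono) (simp add: strict_mono_def)
    finally have "ereal (fact d * b / real g ^ d - e) + ereal e \<le> limsup X + ereal e" by (rule add_right_mono)
    then show "ereal (fact d * b / real g ^ d) \<le> limsup (\<lambda>n. ereal (D n / (real n ^ d / fact d))) + ereal e"
      by (simp add: X_def)
qed

lemma (in field_ext) dim_mono:
  assumes "U \<subseteq> U'" "finite T" "U' \<subseteq> vs.span T" shows "vs.dim U \<le> vs.dim U'"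
proof (rule vs.basis_exists[of U'])
  fix b assume b: "b \<subseteq> U'" "vs.independent b" "U' \<subseteq> vs.span b" "card b = vs.dim U'"
  have "finite b" using vs.independent_span_bound[OF assms(2) b(2)] b(1) assms(3) by auto
  then have "vs.dim U \<le> card b" using assms(1) b(3) by (intro vs.dim_le_card) auto
  then show ?thesis using b(4) by simp
qed

lemma kodaira_dim_real:
  "kodaira_dim \<iota> V = ereal (real d) \<longleftrightarrow> (\<exists>n\<ge>1. V n \<noteq> {0}) \<and> trdeg \<iota> (function_field \<iota> V) = enat d"
proof (cases "trdeg \<iota> (function_field \<iota> V)")
  case (enat m)
  then show ?thesis by (auto simp: kodaira_dim_def)
next
  case infinity
  then show ?thesis by (auto simp: kodaira_dim_def)
qed

lemma series_volume_limsup: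
  assumes "kodaira_dim \<iota> V = ereal (real d)"
  shows "series_volume \<iota> V = limsup (\<lambda>n. ereal (real (dim_over \<iota> (V n)) / (real n ^ d / fact d)))"
proof -
  have "(THE d'::nat. kodaira_dim \<iota> V = ereal (real d')) = d" using assms by auto
  then show ?thesis by (simp add: series_volume_def)
qed

lemma series_volume_mono:
  assumes "field_embedding \<iota>" "graded_linear_series \<iota> V" "contained_in W V"
    "kodaira_dim \<iota> V = ereal (real d)" "kodaira_dim \<iota> W = ereal (real d)"
  shows "series_volume \<iota> W \<le> series_volume \<iota> V"
proof -
  interpret graded_series \<iota> V by unfold_locales (use assms in auto)
  show ?thesis
    unfolding series_volume_limsup[OF assms(4)] series_volume_limsup[OF assms(5)]
  proof (intro Limsup_mono always_eventually allI)
    fix n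
    obtain T where T: "finite T" "V n = vs.span T" using V_span by blast
    have "vs.dim (W n) \<le> vs.dim (V n)"
      using assms(3) T by (intro dim_mono[OF _ T(1)]) (auto simp: contained_in_def)
    then show "ereal (real (dim_over \<iota> (W n)) / (real n ^ d / fact d)) \<le> ereal (real (dim_over \<iota> (V n)) / (real n ^ d / fact d))"
      by (simp add: dim_over_def divide_right_mono)
  qed
qed

text \<open>Finitely many fractions generate a transcendence basis, so their numerators and denominators lie in
  bounded degrees.\<close>

lemma (in graded_series) subseries_kodaira_dim:
  assumes "kodaira_dim \<iota> V = ereal (real d)"
  shows "\<exists>M. \<forall>m\<ge>M. kodaira_dim \<iota> (subseries m) = ereal (real d)"
proof -
  have ne: "\<exists>n\<ge>1. V n \<noteq> {0}" and tr: "trdeg \<iota> (function_field \<iota> V) = enat d"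
    using assms by (auto simp: kodaira_dim_real)
  obtain n0 where n0: "n0 \<ge> 1" "V n0 \<noteq> {0}" using ne by blast
  obtain B where B: "finite B" "B \<subseteq> function_field \<iota> V" "alg_independent \<iota> B" "card B = d"
    by (rule trdeg_basis[OF tr]) (rule that)
  have "\<exists>M. \<forall>b\<in>B. \<exists>l\<le>M. \<exists>f\<in>V l. \<exists>h\<in>V l. h \<noteq> 0 \<and> b = f / h"
  proof (rule finite_bounded_choice[OF B(1)])
    fix b assume "b \<in> B"
    then have "b \<in> function_field \<iota> V" using B(2) by blast
    then show "\<exists>l. \<exists>f\<in>V l. \<exists>h\<in>V l. h \<noteq> 0 \<and> b = f / h"
    proof (rule function_field_fraction[OF _ ne])
      fix f h n assume "f \<in> V n" "h \<in> V n" "h \<noteq> 0" "b = f / h"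
      then show ?thesis by blast
    qed
  qed
  then obtain M where M: "\<And>b. b \<in> B \<Longrightarrow> \<exists>l\<le>M. \<exists>f\<in>V l. \<exists>h\<in>V l. h \<noteq> 0 \<and> b = f / h" by blast
  show ?thesis
  proof (intro exI[of _ "max M n0"] allI impI)
    fix m assume m: "m \<ge> max M n0"
    interpret W: graded_series \<iota> "subseries m" by unfold_locales (rule subseries_graded)
    have "V n0 \<subseteq> subseries m n0" using m by (intro subset_subseries) simp
    then have "subseries m n0 \<noteq> {0}" using n0(2) V_nonzero_iff W.V_nonzero_iff by blast
    moreover have "trdeg \<iota> (function_field \<iota> (subseries m)) = enat d"
    proof (rule antisym)
      let ?Q = "\<lambda>V. {f / h | f h. f \<noteq> 0 \<and> h \<noteq> 0 \<and> (\<exists>n\<ge>1. {f, h} \<subseteq> V n)}"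
      have "?Q (subseries m) \<subseteq> ?Q V"
      proof
        fix q assume "q \<in> ?Q (subseries m)"
        then obtain f h n where "q = f / h" "f \<noteq> 0" "h \<noteq> 0" "n \<ge> 1" "{f, h} \<subseteq> subseries m n" by blast
        moreover from this have "{f, h} \<subseteq> V n" using subseries_subset[of m n] by (rule_tac subset_trans)
        ultimately show "q \<in> ?Q V" by blast
      qed
      then have "range \<iota> \<union> ?Q (subseries m) \<subseteq> range \<iota> \<union> ?Q V" by (intro Un_mono order.refl)
      then have "function_field \<iota> (subseries m) \<subseteq> function_field \<iota> V"
        unfolding function_field_def field_adjoin_def by (rule hull_mono)
      then show "trdeg \<iota> (function_field \<iota> (subseries m)) \<le> enat d"
        unfolding tr[symmetric] trdeg_def by (intro SUP_subset_mono) auto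
      have "B \<subseteq> function_field \<iota> (subseries m)"
      proof
        fix b assume "b \<in> B"
        then obtain l f h where l: "l \<le> M" "f \<in> V l" "h \<in> V l" "h \<noteq> 0" "b = f / h" using M by blast
        have "V l \<subseteq> subseries m l" using l(1) m by (intro subset_subseries) simp
        then show "b \<in> function_field \<iota> (subseries m)"
          unfolding l(5) using l(2-4) by (intro W.fraction_in_function_field) auto
      qed
      then show "enat d \<le> trdeg \<iota> (function_field \<iota> (subseries m))"
        unfolding trdeg_def B(4)[symmetric] using B(1,3) by (intro SUP_upper) auto
    qed
    ultimately show "kodaira_dim \<iota> (subseries m) = ereal (real d)" using n0(1) unfolding kodaira_dim_real by blast
  qed
qed

theorem theorem1p5:
  fixes \<iota> :: "'k::field \<Rightarrow> 'K::field" and V :: "nat \<Rightarrow> 'K set" and d :: nat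
  assumes "field_embedding \<iota>"
    and "fin_gen_extension \<iota>"
    and "graded_linear_series \<iota> V"
    and "subfinite_type \<iota> V"
    and "kodaira_dim \<iota> V = ereal (real d)"
  shows "\<exists>v::real. v > 0
    \<and> ((\<lambda>n. real (dim_over \<iota> (V n)) / (real n ^ d / fact d)) \<longlongrightarrow> v)
         (inf sequentially (principal {n. V n \<noteq> {0}}))
    \<and> series_volume \<iota> V = ereal v
    \<and> series_volume \<iota> V =
        (SUP W\<in>{W. graded_linear_series \<iota> W \<and> finite_type \<iota> W \<and> contained_in W V
                    \<and> kodaira_dim \<iota> W = ereal (real d)}. series_volume \<iota> W)
    \<and> (\<exists>f::nat \<Rightarrow> real. (\<forall>n. f n \<ge> 0)
         \<and> (\<lambda>n. f n - v * (real n ^ d / fact d)) \<in> O(\<lambda>n. real n powr (real d - 1))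
         \<and> (\<forall>n. real (dim_over \<iota> (V n)) \<le> f n))"
proof -
  interpret graded_series \<iota> V by unfold_locales (use assms in auto)
  have ne: "\<exists>n\<ge>1. V n \<noteq> {0}" and tr: "trdeg \<iota> (function_field \<iota> V) = enat d"
    using assms(5) by (auto simp: kodaira_dim_real)
  obtain g and a K :: real where g: "g \<ge> 1" and g_dvd: "\<And>n. V n \<noteq> {0} \<Longrightarrow> g dvd n"
    and a: "a > 0" and K: "K \<ge> 0"
    and upper: "\<And>m. m \<ge> 1 \<Longrightarrow> real (vs.dim (V (g * m))) \<le> a * real m ^ d + real d * K * real m ^ (d - 1)"
    and lower: "\<And>\<epsilon>. \<epsilon> > 0 \<Longrightarrow> \<exists>M. \<forall>W. agrees_up_to M W V \<longrightarrow> growth_at_least d (\<lambda>m. real (vs.dim (W (g * m)))) (a - \<epsilon>)"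
    by (rule dimension_growth[OF assms(4) tr ne]) (rule that)
  define D where "D n = real (dim_over \<iota> (V n))" for n
  \<comment> \<open>The rate \<open>a\<close> refers to \<open>m\<close> in degree \<open>g m\<close>, whence the division by \<open>g ^ d\<close>.\<close>
  define v where "v = fact d * a / real g ^ d"
  have v: "v > 0" using a g by (simp add: v_def)
  have D_dim: "D n = real (vs.dim (V n))" for n by (simp add: D_def dim_over_def)
  have va: "v * (x / fact d) = a / real g ^ d * x" for x by (simp add: v_def)
  have bound: "D n \<le> v * (real n ^ d / fact d) + real d * K * real n ^ (d - 1)" if n: "n \<ge> 1" for n
  proof (cases "V n = {0}")
    case True
    then have "vs.dim (V n) = 0" using vs.dim_le_card[of "V n" "{}"] by (simp add: vs.span_empty)
    then show ?thesis using v K by (simp add: D_dim)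
  next
    case False
    then obtain m where m: "n = g * m" using g_dvd by blast
    then have m1: "m \<ge> 1" using n by (cases m) auto
    have "1 * m \<le> n" unfolding m using g by (rule mult_le_mono1)
    then have "real m \<le> real n" by simp
    then have "real m ^ (d - 1) \<le> real n ^ (d - 1)" by (intro power_mono) auto
    then have "real d * K * real m ^ (d - 1) \<le> real d * K * real n ^ (d - 1)" using K by (intro mult_left_mono) auto
    moreover have "a * real m ^ d = v * (real n ^ d / fact d)" unfolding va using g by (simp add: m power_mult_distrib)
    ultimately show ?thesis using upper[OF m1] by (simp add: D_dim m)
  qed
  have growth: "growth_at_least d (\<lambda>m. D (g * m)) a"
    unfolding growth_at_least_def
  proof (intro allI impI)
    fix \<epsilon> :: real assume e: "\<epsilon> > 0"
    then obtain M where M: "\<forall>W. agrees_up_to M W V \<longrightarrow> growth_at_least d (\<lambda>m. real (vs.dim (W (g * m)))) (a - \<epsilon> / 2)"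
      using lower[of "\<epsilon> / 2"] by auto
    have "growth_at_least d (\<lambda>m. real (vs.dim (V (g * m)))) (a - \<epsilon> / 2)"
      by (rule M[rule_format]) (simp add: agrees_up_to_def V_one V_mult)
    then have "\<forall>\<^sub>F m in sequentially. (a - \<epsilon> / 2 - \<epsilon> / 2) * real m ^ d \<le> real (vs.dim (V (g * m)))"
      using e unfolding growth_at_least_def by (meson half_gt_zero)
    then show "\<forall>\<^sub>F m in sequentially. (a - \<epsilon>) * real m ^ d \<le> D (g * m)" by (simp add: D_dim)
  qed
  define x where "x n = D n / (real n ^ d / fact d)" for n
  have x_upper: "x n \<le> v + fact d * real d * K / real n" if n: "n \<ge> 1" for n
  proof -
    have "x n \<le> (v * (real n ^ d / fact d) + real d * K * real n ^ (d - 1)) / (real n ^ d / fact d)"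
      unfolding x_def using bound[OF n] by (intro divide_right_mono) auto
    also have "\<dots> = v + fact d * (real d * K) * (real n ^ (d - 1) / real n ^ d)"
    proof -
      have "(v * (P / F) + c * Q) / (P / F) = v + F * c * (Q / P)" if "P > 0" "F > 0" for P F c Q :: real
        using that by (simp add: field_simps)
      then show ?thesis using n by simp
    qed
    also have "\<dots> = v + fact d * real d * K / real n"
    proof (cases "d = 0")
      case False
      then have "real n ^ d = real n * real n ^ (d - 1)" by (simp flip: power_Suc)
      then have "real n ^ (d - 1) / real n ^ d = 1 / real n" using n by simp
      then show ?thesis by simp
    qed simp
    finally show ?thesis .
  qed
  have upper_lim: "(\<lambda>n. v + fact d * real d * K / real n) \<longlonglongrightarrow> v"
    using tendsto_add[OF tendsto_const[of v] lim_const_over_n[of "fact d * real d * K"]] by simp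
  have lim: "(x \<longlongrightarrow> v) (inf sequentially (principal {n. V n \<noteq> {0}}))"
  proof (rule order_tendstoI)
    fix u assume "v < u"
    then have "\<forall>\<^sub>F n in sequentially. v + fact d * real d * K / real n < u" by (rule order_tendstoD(2)[OF upper_lim])
    then have "\<forall>\<^sub>F n in sequentially. x n < u"
      using eventually_ge_at_top[of 1]
    proof eventually_elim
      case (elim n)
      then show ?case using x_upper[of n] by simp
    qed
    then show "\<forall>\<^sub>F n in inf sequentially (principal {n. V n \<noteq> {0}}). x n < u"
      unfolding eventually_inf_principal by eventually_elim simp
  next
    fix u assume u: "u < v"
    define \<epsilon> where "\<epsilon> = (v - u) * real g ^ d / (2 * fact d)"
    have "\<epsilon> > 0" using u g by (simp add: \<epsilon>_def)
    then have "\<forall>\<^sub>F m in sequentially. D (g * m) \<ge> (a - \<epsilon>) * real m ^ d"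
      using growth by (auto simp: growth_at_least_def)
    then obtain m0 where m0: "\<And>m. m \<ge> m0 \<Longrightarrow> D (g * m) \<ge> (a - \<epsilon>) * real m ^ d"
      by (auto simp: eventually_sequentially)
    have "x n > u" if n: "n \<ge> g * (m0 + 1)" and Vn: "V n \<noteq> {0}" for n
    proof -
      obtain m where m: "n = g * m" using g_dvd[OF Vn] by blast
      have "g * (m0 + 1) \<le> g * m" using n by (simp only: m)
      then have mm: "m \<ge> m0 + 1" using g by (metis mult_le_cancel1 not_one_le_zero zero_less_iff_neq_zero)
      have half: "fact d * \<epsilon> / real g ^ d = (v - u) / 2" using g by (simp add: \<epsilon>_def)
      have "fact d * (a - \<epsilon>) / real g ^ d = fact d * a / real g ^ d - fact d * \<epsilon> / real g ^ d"
        by (simp add: right_diff_distrib diff_divide_distrib)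
      then have "fact d * (a - \<epsilon>) / real g ^ d = v - (v - u) / 2" unfolding half by (simp add: v_def)
      moreover have "u < v - (v - u) / 2" using u by (simp add: field_simps)
      ultimately have "u < fact d * (a - \<epsilon>) / real g ^ d" by (simp only:)
      also have "\<dots> = fact d * ((a - \<epsilon>) * real m ^ d) / real n ^ d"
        using mm g by (simp add: m power_mult_distrib)
      also have "\<dots> \<le> fact d * D n / real n ^ d"
        using m0[of m] mm m by (intro divide_right_mono mult_left_mono) auto
      also have "\<dots> = x n" by (simp add: x_def)
      finally show ?thesis .
    qed
    then show "\<forall>\<^sub>F n in inf sequentially (principal {n. V n \<noteq> {0}}). u < x n"
      unfolding eventually_inf_principal eventually_sequentially by (intro exI[of _ "g * (m0 + 1)"]) auto
  qed
  have volV: "series_volume \<iota> V = ereal v"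
  proof (rule antisym)
    have "series_volume \<iota> V = limsup (\<lambda>n. ereal (x n))"
      unfolding series_volume_limsup[OF assms(5)] x_def D_def ..
    also have "\<dots> \<le> limsup (\<lambda>n. ereal (v + fact d * real d * K / real n))"
      by (rule Limsup_mono, rule eventually_mono[OF eventually_ge_at_top[of 1]]) (simp add: x_upper)
    also have "\<dots> = ereal v" using upper_lim by (intro lim_imp_Limsup) auto
    finally show "series_volume \<iota> V \<le> ereal v" .
    show "ereal v \<le> series_volume \<iota> V"
      unfolding series_volume_limsup[OF assms(5)] v_def using limsup_ge_growth[OF growth g] by (simp add: D_def)
  qed
  let ?Ws = "{W. graded_linear_series \<iota> W \<and> finite_type \<iota> W \<and> contained_in W V \<and> kodaira_dim \<iota> W = ereal (real d)}"
  have sup: "series_volume \<iota> V = (SUP W\<in>?Ws. series_volume \<iota> W)"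
  proof (rule antisym)
    show "(SUP W\<in>?Ws. series_volume \<iota> W) \<le> series_volume \<iota> V"
      using assms by (intro SUP_least) (auto intro: series_volume_mono)
    show "series_volume \<iota> V \<le> (SUP W\<in>?Ws. series_volume \<iota> W)"
    proof (rule ereal_le_epsilon2)
      fix e :: real assume e: "e > 0"
      define \<epsilon> where "\<epsilon> = e * real g ^ d / fact d"
      have "\<epsilon> > 0" using e g by (simp add: \<epsilon>_def)
      from lower[OF this] obtain M where M: "\<forall>W. agrees_up_to M W V \<longrightarrow> growth_at_least d (\<lambda>m. real (vs.dim (W (g * m)))) (a - \<epsilon>)"
        by (rule exE)
      obtain M' where M': "\<And>m. m \<ge> M' \<Longrightarrow> kodaira_dim \<iota> (subseries m) = ereal (real d)"
        using subseries_kodaira_dim[OF assms(5)] by blast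
      define W where "W = subseries (max M M')"
      have kW: "kodaira_dim \<iota> W = ereal (real d)" unfolding W_def by (rule M') simp
      have "growth_at_least d (\<lambda>m. real (vs.dim (W (g * m)))) (a - \<epsilon>)"
      proof (rule M[rule_format], unfold agrees_up_to_def, intro conjI allI ballI impI)
        show "1 \<in> W 0" unfolding W_def subseries_0 using V_one V_0 by simp
        show "W n \<subseteq> V n" for n unfolding W_def by (rule subseries_subset)
        show "f * h \<in> W (m + n)" if "f \<in> W m" "h \<in> W n" for f h m n
          using that unfolding W_def by (rule subseries_mult)
        show "V n \<subseteq> W n" if "n \<le> M" for n
          unfolding W_def using that by (intro subset_subseries) simp
      qed
      then have "growth_at_least d (\<lambda>m. real (dim_over \<iota> (W (g * m)))) (a - \<epsilon>)" by (simp add: dim_over_def)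
      from limsup_ge_growth[OF this g]
      have "ereal (fact d * (a - \<epsilon>) / real g ^ d) \<le> series_volume \<iota> W"
        unfolding series_volume_limsup[OF kW] .
      moreover have "fact d * (a - \<epsilon>) / real g ^ d = v - e"
        using g by (simp add: v_def \<epsilon>_def right_diff_distrib diff_divide_distrib)
      moreover have "series_volume \<iota> W \<le> (SUP W\<in>?Ws. series_volume \<iota> W)"
      proof (rule SUP_upper)
        show "W \<in> ?Ws"
          using kW subseries_graded subseries_finite_type subseries_subset unfolding W_def contained_in_def by blast
      qed
      ultimately have "ereal (v - e) \<le> (SUP W\<in>?Ws. series_volume \<iota> W)" by simp
      then have "ereal (v - e) + ereal e \<le> (SUP W\<in>?Ws. series_volume \<iota> W) + ereal e" by (rule add_right_mono)
      then show "series_volume \<iota> V \<le> (SUP W\<in>?Ws. series_volume \<iota> W) + ereal e" unfolding volV by simp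
    qed
  qed
  \<comment> \<open>In degree \<open>0\<close> the piece is the base field, of dimension \<open>1\<close>, while the bound is only known from degree \<open>1\<close> on.\<close>
  define f where "f n = (if n = 0 then 1 else v * (real n ^ d / fact d) + real d * K * real n ^ (d - 1))" for n
  have "f n \<ge> 0" for n using v K by (simp add: f_def)
  moreover have "(\<lambda>n. f n - v * (real n ^ d / fact d)) \<in> O(\<lambda>n. real n powr (real d - 1))"
  proof (rule bigoI)
    show "\<forall>\<^sub>F n in sequentially. norm (f n - v * (real n ^ d / fact d)) \<le> real d * K * norm (real n powr (real d - 1))"
      using eventually_ge_at_top[of 1]
    proof eventually_elim
      case (elim n)
      have "real n powr (real d - 1) = real n ^ (d - 1)" if "d \<noteq> 0"
        using that elim by (subst powr_realpow[symmetric]) (auto simp: of_nat_diff)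
      then show ?case using elim K by (cases "d = 0") (auto simp: f_def)
    qed
  qed
  moreover have "D n \<le> f n" for n
  proof (cases "n = 0")
    case True
    have "vs.dim (V 0) \<le> card {1 :: 'K}" using V_0 span_one by (intro vs.dim_le_card) auto
    then show ?thesis using True by (simp add: D_dim f_def)
  next
    case False
    then show ?thesis using bound[of n] by (simp add: f_def)
  qed
  ultimately have "\<exists>f::nat \<Rightarrow> real. (\<forall>n. f n \<ge> 0)
         \<and> (\<lambda>n. f n - v * (real n ^ d / fact d)) \<in> O(\<lambda>n. real n powr (real d - 1))
         \<and> (\<forall>n. real (dim_over \<iota> (V n)) \<le> f n)"
    unfolding D_def by blast
  then show ?thesis using v lim volV sup unfolding x_def D_def by blast
qed

end
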